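(* Let $T:\hat{\mathcal{B}}_\infty\to V$ be a continuous map from the bottleneck-completed space of barcodes $\hat{\mathcal{B}}_\infty$ to a separable Banach space $V$ of type $2$. Let $\{X_i\}_{i\in\mathbb{N}}$ be an i.i.d. sequence of $\hat{\mathcal{B}}_\infty$-valued random variables such that $\mathbb{E}[T(X_1)]=0$ and $\mathbb{E}[\|T(X_1)\|^2]<\infty$, and let $$S_n:=\frac{T(X_1)+\ldots+T(X_n)}{n}.$$ Then $(\sqrt{n}\,S_n)_n$ converges weakly to a Gaussian random variable with the covariance structure of $T(X_1)$.
   Context: Barcode space: $\mathcal{B}$ is the set of finite multisets of pairs $(x,d)\in\mathbb{R}_{\ge0}^2$ (an interval with left endpoint $x$ and length $d$), where two multisets are identified if they agree after deleting pairs with $d=0$. Bottleneck distance: put $d_\infty((x_1,d_1),(x_2,d_2))=\max(|x_1-x_2|,|(x_1+d_1)-(x_2+d_2)|)$ and $d_\infty((x,d),\Delta)=d/2$. For $b_1=\{I_i\}_{i=1}^n$, $b_2=\{J_j\}_{j=1}^m$, $d_\infty(b_1,b_2)$ is the minimum over all bijections $\theta:A\to B$ with $A\subset\{1,\dots,n\}$, $B\subset\{1,\dots,m\}$ of $\max\big(\max_{a\in A}d_\infty(I_a,J_{\theta(a)}),\max_{a\notin A}d_\infty(I_a,\Delta),\max_{b\notin B}d_\infty(J_b,\Delta)\big)$. $\hat{\mathcal{B}}_\infty$ is the completion of $(\mathcal{B},d_\infty)$. Expectation of a $V$-valued random variable $\xi$ is its Pettis integral: the element $v=\mathbb{E}[\xi]\in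 V$ with $\varphi(v)=\mathbb{E}[\varphi(\xi)]$ for every continuous linear functional $\varphi$ on $V$. Type $2$: a Banach space $V$ is of type $2$ if for every Rademacher sequence $(\varepsilon_i)$ (independent random variables with values $\pm1$, each with probability $1/2$) there is a constant $C$ such that $\big(\mathbb{E}\|\sum_i\varepsilon_ix_i\|^2\big)^{1/2}\le C\big(\sum_i\|x_i\|^2\big)^{1/2}$ for all finite sequences $(x_i)$ in $V$. A Gaussian random variable $G$ with the covariance structure of $T(X_1)$ is a centered $V$-valued Gaussian random variable with $\mathbb{E}[\varphi(G)\psi(G)]=\mathbb{E}[\varphi(T(X_1))\psi(T(X_1))]$ for all continuous linear functionals $\varphi,\psi$ on $V$. *)

theory Defs
  imports "HOL-Probability.Probability"
begin

section \<open>The bottleneck distance on barcodes\<close>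

text \<open>A bar \<^term>\<open>(x, d)\<close> is the interval with left endpoint \<^term>\<open>x\<close> and length \<^term>\<open>d\<close>.\<close>

type_synonym bar = "real \<times> real"

definition bar_dist :: "bar \<Rightarrow> bar \<Rightarrow> real" where
  "bar_dist I J = max \<bar>fst I - fst J\<bar> \<bar>(fst I + snd I) - (fst J + snd J)\<bar>"

definition diag_dist :: "bar \<Rightarrow> real" where
  "diag_dist I = snd I / 2"

text \<open>Finite families of bars are lists, indexed from 0.  Adjoining \<^term>\<open>0::real\<close> to the set
  of costs only matters when both families are empty (bars have nonnegative length).\<close>

definition matching_cost :: "bar list \<Rightarrow> bar list \<Rightarrow> nat set \<Rightarrow> nat set \<Rightarrow> (nat \<Rightarrow> nat) \<Rightarrow> real" where
  "matching_cost xs ys A B \<theta> =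
     Max ({0} \<union> (\<lambda>a. bar_dist (xs ! a) (ys ! \<theta> a)) ` A
              \<union> (\<lambda>a. diag_dist (xs ! a)) ` ({..<length xs} - A)
              \<union> (\<lambda>b. diag_dist (ys ! b)) ` ({..<length ys} - B))"

definition bottleneck :: "bar list \<Rightarrow> bar list \<Rightarrow> real" where
  "bottleneck xs ys =
     Min {matching_cost xs ys A B \<theta> | A B \<theta>.
            A \<subseteq> {..<length xs} \<and> B \<subseteq> {..<length ys} \<and> bij_betw \<theta> A B}"

lemma matching_cost_le_iff:
  assumes "A \<subseteq> {..<length xs}" "B \<subseteq> {..<length ys}"
  shows "matching_cost xs ys A B \<theta> \<le> r \<longleftrightarrow>
    0 \<le> r \<and> (\<forall>a\<in>A. bar_dist (xs ! a) (ys ! \<theta> a) \<le> r) \<and>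
    (\<forall>a\<in>{..<length xs} - A. diag_dist (xs ! a) \<le> r) \<and>
    (\<forall>b\<in>{..<length ys} - B. diag_dist (ys ! b) \<le> r)"
proof -
  have "finite A" using assms(1) finite_subset by blast
  then have "finite ({0} \<union> (\<lambda>a. bar_dist (xs ! a) (ys ! \<theta> a)) ` A
      \<union> (\<lambda>a. diag_dist (xs ! a)) ` ({..<length xs} - A)
      \<union> (\<lambda>b. diag_dist (ys ! b)) ` ({..<length ys} - B))" (is "finite ?C")
    by simp
  then have "Max ?C \<le> r \<longleftrightarrow> (\<forall>c\<in>?C. c \<le> r)" by (intro Max_le_iff) auto
  then show ?thesis unfolding matching_cost_def by (auto simp: ball_Un)
qed

lemma finite_matching_costs:
  "finite {matching_cost xs ys A B \<theta> | A B \<theta>.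
     A \<subseteq> {..<length xs} \<and> B \<subseteq> {..<length ys} \<and> bij_betw \<theta> A B}" (is "finite ?S")
proof -
  let ?V = "{0} \<union> (\<lambda>(a, b). bar_dist (xs ! a) (ys ! b)) ` ({..<length xs} \<times> {..<length ys})
    \<union> (\<lambda>a. diag_dist (xs ! a)) ` {..<length xs} \<union> (\<lambda>b. diag_dist (ys ! b)) ` {..<length ys}"
  have "?S \<subseteq> ?V"
  proof (rule subsetI)
    fix c assume "c \<in> ?S"
    then obtain A B \<theta> where c: "c = matching_cost xs ys A B \<theta>"
      and AB: "A \<subseteq> {..<length xs}" "B \<subseteq> {..<length ys}" "bij_betw \<theta> A B" by blast
    let ?C = "{0} \<union> (\<lambda>a. bar_dist (xs ! a) (ys ! \<theta> a)) ` A
              \<union> (\<lambda>a. diag_dist (xs ! a)) ` ({..<length xs} - A)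
              \<union> (\<lambda>b. diag_dist (ys ! b)) ` ({..<length ys} - B)"
    have "finite A" using AB finite_subset by blast
    then have "matching_cost xs ys A B \<theta> \<in> ?C"
      unfolding matching_cost_def by (intro Max_in) auto
    moreover have "(\<lambda>a. bar_dist (xs ! a) (ys ! \<theta> a)) ` A
        \<subseteq> (\<lambda>(a, b). bar_dist (xs ! a) (ys ! b)) ` ({..<length xs} \<times> {..<length ys})"
    proof (rule image_subsetI)
      fix a assume "a \<in> A"
      then have "(a, \<theta> a) \<in> {..<length xs} \<times> {..<length ys}"
        using AB by (auto simp: bij_betw_def)
      then show "bar_dist (xs ! a) (ys ! \<theta> a)
          \<in> (\<lambda>(a, b). bar_dist (xs ! a) (ys ! b)) ` ({..<length xs} \<times> {..<length ys})"
        by (rule rev_image_eqI) simp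
    qed
    then have "?C \<subseteq> ?V" by blast
    ultimately show "c \<in> ?V" unfolding c by blast
  qed
  moreover have "finite ?V" by auto
  ultimately show ?thesis by (rule finite_subset)
qed

lemma bottleneck_le:
  assumes "A \<subseteq> {..<length xs}" "B \<subseteq> {..<length ys}" "bij_betw \<theta> A B" "0 \<le> r"
    "\<And>a. a \<in> A \<Longrightarrow> bar_dist (xs ! a) (ys ! \<theta> a) \<le> r"
    "\<And>a. a < length xs \<Longrightarrow> a \<notin> A \<Longrightarrow> diag_dist (xs ! a) \<le> r"
    "\<And>b. b < length ys \<Longrightarrow> b \<notin> B \<Longrightarrow> diag_dist (ys ! b) \<le> r"
  shows "bottleneck xs ys \<le> r"
proof -
  have "bottleneck xs ys \<le> matching_cost xs ys A B \<theta>"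
    unfolding bottleneck_def using assms by (intro Min_le finite_matching_costs) blast
  also have "\<dots> \<le> r" using assms by (subst matching_cost_le_iff) auto
  finally show ?thesis .
qed

lemma bottleneck_attained:
  obtains A B \<theta> where "A \<subseteq> {..<length xs}" "B \<subseteq> {..<length ys}" "bij_betw \<theta> A B"
    "0 \<le> bottleneck xs ys"
    "\<And>a. a \<in> A \<Longrightarrow> bar_dist (xs ! a) (ys ! \<theta> a) \<le> bottleneck xs ys"
    "\<And>a. a < length xs \<Longrightarrow> a \<notin> A \<Longrightarrow> diag_dist (xs ! a) \<le> bottleneck xs ys"
    "\<And>b. b < length ys \<Longrightarrow> b \<notin> B \<Longrightarrow> diag_dist (ys ! b) \<le> bottleneck xs ys"
proof -
  let ?S = "{matching_cost xs ys A B \<theta> | A B \<theta>.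
     A \<subseteq> {..<length xs} \<and> B \<subseteq> {..<length ys} \<and> bij_betw \<theta> A B}"
  have "matching_cost xs ys {} {} id \<in> ?S" by force
  then have "bottleneck xs ys \<in> ?S"
    unfolding bottleneck_def by (intro Min_in finite_matching_costs) blast
  then obtain A B \<theta> where 1: "A \<subseteq> {..<length xs}" "B \<subseteq> {..<length ys}" "bij_betw \<theta> A B"
    and "matching_cost xs ys A B \<theta> = bottleneck xs ys" by (smt (verit) mem_Collect_eq)
  then have "matching_cost xs ys A B \<theta> \<le> bottleneck xs ys" by simp
  with 1 show ?thesis by (intro that[of A B \<theta>]) (auto simp: matching_cost_le_iff)
qed

lemma bottleneck_nonneg: "0 \<le> bottleneck xs ys"
  by (rule bottleneck_attained)

lemma bar_dist_commute: "bar_dist I J = bar_dist J I"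
  by (simp add: bar_dist_def abs_minus_commute)

lemma bottleneck_commute_le: "bottleneck ys xs \<le> bottleneck xs ys"
proof (rule bottleneck_attained[of xs ys])
  fix A B \<theta>
  assume *: "A \<subseteq> {..<length xs}" "B \<subseteq> {..<length ys}" "bij_betw \<theta> A B"
    "0 \<le> bottleneck xs ys"
    "\<And>a. a \<in> A \<Longrightarrow> bar_dist (xs ! a) (ys ! \<theta> a) \<le> bottleneck xs ys"
    "\<And>a. a < length xs \<Longrightarrow> a \<notin> A \<Longrightarrow> diag_dist (xs ! a) \<le> bottleneck xs ys"
    "\<And>b. b < length ys \<Longrightarrow> b \<notin> B \<Longrightarrow> diag_dist (ys ! b) \<le> bottleneck xs ys"
  show ?thesis
  proof (rule bottleneck_le[of B _ A _ "inv_into A \<theta>"])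
    show "bij_betw (inv_into A \<theta>) B A" using * by (intro bij_betw_inv_into)
    fix b assume "b \<in> B"
    then have "inv_into A \<theta> b \<in> A" "\<theta> (inv_into A \<theta> b) = b"
      using *(3) by (auto simp: bij_betw_def inv_into_into f_inv_into_f)
    then show "bar_dist (ys ! b) (xs ! inv_into A \<theta> b) \<le> bottleneck xs ys"
      using *(5)[of "inv_into A \<theta> b"] by (simp add: bar_dist_commute)
  qed (use * in auto)
qed

lemma bottleneck_commute: "bottleneck xs ys = bottleneck ys xs"
  by (intro antisym bottleneck_commute_le)

lemma bottleneck_triangle: "bottleneck xs zs \<le> bottleneck xs ys + bottleneck ys zs"
proof (rule bottleneck_attained[of xs ys], rule bottleneck_attained[of ys zs])
  fix A B \<theta> C D \<eta>
  let ?r = "bottleneck xs ys" and ?s = "bottleneck ys zs"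
  assume 1: "A \<subseteq> {..<length xs}" "B \<subseteq> {..<length ys}" "bij_betw \<theta> A B" "0 \<le> ?r"
    "\<And>a. a \<in> A \<Longrightarrow> bar_dist (xs ! a) (ys ! \<theta> a) \<le> ?r"
    "\<And>a. a < length xs \<Longrightarrow> a \<notin> A \<Longrightarrow> diag_dist (xs ! a) \<le> ?r"
    "\<And>b. b < length ys \<Longrightarrow> b \<notin> B \<Longrightarrow> diag_dist (ys ! b) \<le> ?r"
  assume 2: "C \<subseteq> {..<length ys}" "D \<subseteq> {..<length zs}" "bij_betw \<eta> C D" "0 \<le> ?s"
    "\<And>a. a \<in> C \<Longrightarrow> bar_dist (ys ! a) (zs ! \<eta> a) \<le> ?s"
    "\<And>a. a < length ys \<Longrightarrow> a \<notin> C \<Longrightarrow> diag_dist (ys ! a) \<le> ?s"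
    "\<And>b. b < length zs \<Longrightarrow> b \<notin> D \<Longrightarrow> diag_dist (zs ! b) \<le> ?s"
  define E where "E = {a \<in> A. \<theta> a \<in> C}"
  have tri: "bar_dist I K \<le> bar_dist I J + bar_dist J K" for I J K
    unfolding bar_dist_def by (auto simp: max_def)
  have diag: "diag_dist I \<le> bar_dist I J + diag_dist J" for I J
    unfolding bar_dist_def diag_dist_def by linarith
  show ?thesis
  proof (rule bottleneck_le[of E _ "(\<eta> \<circ> \<theta>) ` E" _ "\<eta> \<circ> \<theta>"])
    show "E \<subseteq> {..<length xs}" using 1 by (auto simp: E_def)
    have "(\<eta> \<circ> \<theta>) ` E \<subseteq> D" using 2(3) by (auto simp: E_def bij_betw_def)
    then show "(\<eta> \<circ> \<theta>) ` E \<subseteq> {..<length zs}" using 2 by auto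
    have "inj_on (\<eta> \<circ> \<theta>) E"
      using 1(3) 2(3) by (intro comp_inj_on) (auto simp: E_def bij_betw_def inj_on_def)
    then show "bij_betw (\<eta> \<circ> \<theta>) E ((\<eta> \<circ> \<theta>) ` E)" by (simp add: bij_betw_def)
    show "0 \<le> ?r + ?s" using 1 2 by simp
    show "bar_dist (xs ! a) (zs ! (\<eta> \<circ> \<theta>) a) \<le> ?r + ?s" if "a \<in> E" for a
      using tri[of "xs ! a" "zs ! (\<eta> \<circ> \<theta>) a" "ys ! \<theta> a"] 1(5)[of a] 2(5)[of "\<theta> a"] that
      by (auto simp: E_def)
    show "diag_dist (xs ! a) \<le> ?r + ?s" if "a < length xs" "a \<notin> E" for a
    proof (cases "a \<in> A")
      case True
      then have "\<theta> a < length ys" "\<theta> a \<notin> C"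
        using that 1(2,3) by (auto simp: E_def bij_betw_def)
      then show ?thesis
        using diag[of "xs ! a" "ys ! \<theta> a"] 1(5)[OF True] 2(6)[of "\<theta> a"] by simp
    next
      case False
      then show ?thesis using 1(6)[of a] 2(4) that by simp
    qed
    show "diag_dist (zs ! c) \<le> ?r + ?s" if "c < length zs" "c \<notin> (\<eta> \<circ> \<theta>) ` E" for c
    proof (cases "c \<in> D")
      case True
      then obtain b where b: "b \<in> C" "c = \<eta> b" using 2(3) by (auto simp: bij_betw_def)
      have "b \<notin> B"
      proof
        assume "b \<in> B"
        then obtain a where "a \<in> A" "b = \<theta> a" using 1(3) by (auto simp: bij_betw_def)
        then show False using that b by (auto simp: E_def)
      qed
      moreover have "b < length ys" using b 2(1) by auto
      ultimately show ?thesis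
        using diag[of "zs ! c" "ys ! b"] 1(7)[of b] 2(5)[of b] b by (simp add: bar_dist_commute)
    next
      case False
      then show ?thesis using 2(7)[of c] 1(4) that by simp
    qed
  qed
qed

lemma image_mset_eq_imp_bij:
  assumes "finite A" "finite B" "image_mset f (mset_set A) = image_mset g (mset_set B)"
  shows "\<exists>\<theta>. bij_betw \<theta> A B \<and> (\<forall>a\<in>A. f a = g (\<theta> a))"
  using assms
proof (induction A arbitrary: B rule: finite_induct)
  case empty
  then show ?case by (auto simp: mset_set_empty_iff bij_betw_def)
next
  case (insert a A)
  have "f a \<in># image_mset g (mset_set B)"
    by (subst insert.prems(2)[symmetric]) (use insert.hyps in simp)
  then obtain b where b: "b \<in> B" "f a = g b" using insert.prems(1) by auto
  have "mset_set B = add_mset b (mset_set (B - {b}))"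
    using b insert.prems(1) by (metis mset_set.remove)
  then have "image_mset f (mset_set A) = image_mset g (mset_set (B - {b}))"
    using insert.prems(2) insert.hyps b by simp
  then obtain \<theta> where \<theta>: "bij_betw \<theta> A (B - {b})" "\<forall>a\<in>A. f a = g (\<theta> a)"
    using insert.IH[of "B - {b}"] insert.prems(1) by auto
  have "bij_betw (\<theta>(a := b)) A (B - {b})"
    using \<theta>(1) insert.hyps by (subst bij_betw_cong[where g = \<theta>]) auto
  moreover have "bij_betw (\<theta>(a := b)) {a} {b}" by simp
  ultimately have "bij_betw (\<theta>(a := b)) (A \<union> {a}) (B - {b} \<union> {b})"
    by (rule bij_betw_combine) auto
  moreover have "A \<union> {a} = insert a A" "B - {b} \<union> {b} = B" using b by auto
  ultimately have "bij_betw (\<theta>(a := b)) (insert a A) B" by (simp only:)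
  moreover have "\<forall>a'\<in>insert a A. f a' = g ((\<theta>(a := b)) a')"
    using \<theta>(2) b insert.hyps by auto
  ultimately show ?case by blast
qed

lemma filter_mset_conv_nth:
  "filter_mset P (mset xs) = image_mset ((!) xs) (mset_set {i. i < length xs \<and> P (xs ! i)})"
proof -
  have "mset xs = image_mset ((!) xs) (mset_set {..<length xs})"
    by (metis map_nth mset_map mset_upt atLeast0LessThan)
  then have "filter_mset P (mset xs) = image_mset ((!) xs) (mset_set {i \<in> {..<length xs}. P (xs ! i)})"
    by (simp add: filter_mset_image_mset)
  then show ?thesis by simp
qed

lemma bottleneck_eq_0I:
  assumes "filter_mset (\<lambda>I. snd I \<noteq> 0) (mset xs) = filter_mset (\<lambda>I. snd I \<noteq> 0) (mset ys)"
  shows "bottleneck xs ys = 0"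
proof -
  let ?A = "{i. i < length xs \<and> snd (xs ! i) \<noteq> 0}" and ?B = "{i. i < length ys \<and> snd (ys ! i) \<noteq> 0}"
  have "image_mset ((!) xs) (mset_set ?A) = image_mset ((!) ys) (mset_set ?B)"
    using assms unfolding filter_mset_conv_nth .
  then have "\<exists>\<theta>. bij_betw \<theta> ?A ?B \<and> (\<forall>a\<in>?A. xs ! a = ys ! \<theta> a)"
    by (intro image_mset_eq_imp_bij) simp_all
  then obtain \<theta> where \<theta>: "bij_betw \<theta> ?A ?B" "\<forall>a\<in>?A. xs ! a = ys ! \<theta> a"
    by blast
  have "bottleneck xs ys \<le> 0"
  proof (rule bottleneck_le[OF _ _ \<theta>(1)])
    show "bar_dist (xs ! a) (ys ! \<theta> a) \<le> 0" if "a \<in> ?A" for a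
      using bspec[OF \<theta>(2) that] by (simp add: bar_dist_def)
  qed (auto simp: diag_dist_def)
  then show ?thesis using bottleneck_nonneg[of xs ys] by simp
qed

lemma bottleneck_eq_0D:
  assumes "bottleneck xs ys = 0" "\<forall>I\<in>set xs. 0 \<le> snd I" "\<forall>I\<in>set ys. 0 \<le> snd I"
  shows "filter_mset (\<lambda>I. snd I \<noteq> 0) (mset xs) = filter_mset (\<lambda>I. snd I \<noteq> 0) (mset ys)"
proof (rule bottleneck_attained[of xs ys])
  fix A B \<theta>
  let ?A = "{i. i < length xs \<and> snd (xs ! i) \<noteq> 0}" and ?B = "{i. i < length ys \<and> snd (ys ! i) \<noteq> 0}"
  assume *: "A \<subseteq> {..<length xs}" "B \<subseteq> {..<length ys}" "bij_betw \<theta> A B"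
    "\<And>a. a \<in> A \<Longrightarrow> bar_dist (xs ! a) (ys ! \<theta> a) \<le> bottleneck xs ys"
    "\<And>a. a < length xs \<Longrightarrow> a \<notin> A \<Longrightarrow> diag_dist (xs ! a) \<le> bottleneck xs ys"
    "\<And>b. b < length ys \<Longrightarrow> b \<notin> B \<Longrightarrow> diag_dist (ys ! b) \<le> bottleneck xs ys"
  have eq: "xs ! a = ys ! \<theta> a" if "a \<in> A" for a
    using *(4)[OF that] assms(1) by (auto simp: bar_dist_def max_def prod_eq_iff split: if_splits)
  have A: "?A \<subseteq> A"
  proof clarify
    fix a assume "a < length xs" "snd (xs ! a) \<noteq> 0"
    moreover from this have "0 \<le> snd (xs ! a)" using assms(2) by auto
    ultimately show "a \<in> A" using *(5)[of a] assms(1) by (auto simp: diag_dist_def)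
  qed
  have B: "?B \<subseteq> B"
  proof clarify
    fix b assume "b < length ys" "snd (ys ! b) \<noteq> 0"
    moreover from this have "0 \<le> snd (ys ! b)" using assms(3) by auto
    ultimately show "b \<in> B" using *(6)[of b] assms(1) by (auto simp: diag_dist_def)
  qed
  have inj: "inj_on \<theta> ?A" by (rule inj_on_subset[OF bij_betw_imp_inj_on[OF *(3)] A])
  have img: "\<theta> ` ?A = ?B"
  proof
    show "\<theta> ` ?A \<subseteq> ?B"
    proof (rule image_subsetI)
      fix i assume i: "i \<in> ?A"
      then have "i \<in> A" using A by blast
      then show "\<theta> i \<in> ?B"
        using *(2) bij_betwE[OF *(3)] eq[of i] i by auto
    qed
    show "?B \<subseteq> \<theta> ` ?A"
    proof (rule subsetI)
      fix j assume j: "j \<in> ?B"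
      then have "j \<in> \<theta> ` A" using B bij_betw_imp_surj_on[OF *(3)] by blast
      then obtain i where i: "i \<in> A" "j = \<theta> i" by blast
      then have "i \<in> ?A" using j eq[of i] *(1) by auto
      then show "j \<in> \<theta> ` ?A" using i by blast
    qed
  qed
  have "mset_set ?B = image_mset \<theta> (mset_set ?A)"
    by (subst image_mset_mset_set[OF inj], subst img) (rule refl)
  then have "image_mset ((!) ys) (mset_set ?B) = image_mset (\<lambda>i. ys ! \<theta> i) (mset_set ?A)"
    by (simp only: multiset.map_comp comp_def)
  also have "\<dots> = image_mset ((!) xs) (mset_set ?A)"
  proof (rule image_mset_cong)
    fix i assume "i \<in># mset_set ?A"
    then have "i \<in> A" using A by auto
    then show "ys ! \<theta> i = xs ! i" by (rule eq[symmetric])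
  qed
  finally show ?thesis unfolding filter_mset_conv_nth by (rule sym)
qed


section \<open>The metric space of barcodes\<close>

definition barcode_eq :: "bar multiset \<Rightarrow> bar multiset \<Rightarrow> bool" where
  "barcode_eq b b' \<longleftrightarrow>
     (\<forall>I\<in>#b. 0 \<le> fst I \<and> 0 \<le> snd I) \<and> (\<forall>I\<in>#b'. 0 \<le> fst I \<and> 0 \<le> snd I) \<and>
     filter_mset (\<lambda>I. snd I \<noteq> 0) b = filter_mset (\<lambda>I. snd I \<noteq> 0) b'"

quotient_type barcode = "bar multiset" / partial: barcode_eq
proof (rule part_equivpI)
  show "\<exists>b. barcode_eq b b" by (rule exI[of _ "{#}"]) (simp add: barcode_eq_def)
  show "symp barcode_eq" by (auto simp: barcode_eq_def symp_def)
  show "transp barcode_eq" by (auto simp: barcode_eq_def transp_def)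
qed

text \<open>The value does not depend on the chosen enumerations, see \<open>bottleneck_mset_mset\<close>.\<close>

definition bottleneck_mset :: "bar multiset \<Rightarrow> bar multiset \<Rightarrow> real" where
  "bottleneck_mset b b' = bottleneck (SOME xs. mset xs = b) (SOME ys. mset ys = b')"

lemma bottleneck_cong:
  assumes "filter_mset (\<lambda>I. snd I \<noteq> 0) (mset xs) = filter_mset (\<lambda>I. snd I \<noteq> 0) (mset xs')"
    and "filter_mset (\<lambda>I. snd I \<noteq> 0) (mset ys) = filter_mset (\<lambda>I. snd I \<noteq> 0) (mset ys')"
  shows "bottleneck xs ys = bottleneck xs' ys'"
  using bottleneck_eq_0I[OF assms(1)] bottleneck_eq_0I[OF assms(2)]
    bottleneck_triangle[of xs ys xs'] bottleneck_triangle[of xs' ys ys']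
    bottleneck_triangle[of xs' ys' xs] bottleneck_triangle[of xs ys' ys]
    bottleneck_commute[of xs xs'] bottleneck_commute[of ys ys']
  by linarith

lemma bottleneck_mset_mset: "bottleneck_mset (mset xs) (mset ys) = bottleneck xs ys"
proof -
  have "mset (SOME zs. mset zs = mset xs) = mset xs" for xs :: "bar list"
    by (rule someI) simp
  then show ?thesis unfolding bottleneck_mset_def by (intro bottleneck_cong) simp_all
qed

instantiation barcode :: metric_space
begin

lift_definition dist_barcode :: "barcode \<Rightarrow> barcode \<Rightarrow> real" is bottleneck_mset
proof -
  fix b1 b2 b3 b4
  assume "barcode_eq b1 b2" "barcode_eq b3 b4"
  moreover obtain xs ys zs ws where "b1 = mset xs" "b2 = mset ys" "b3 = mset zs" "b4 = mset ws"
    by (metis ex_mset)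
  ultimately show "bottleneck_mset b1 b3 = bottleneck_mset b2 b4"
    by (auto simp: bottleneck_mset_mset barcode_eq_def intro: bottleneck_cong)
qed

definition uniformity_barcode :: "(barcode \<times> barcode) filter" where
  "uniformity_barcode = (INF e\<in>{0<..}. principal {(x, y). dist x y < e})"

definition open_barcode :: "barcode set \<Rightarrow> bool" where
  "open_barcode U \<longleftrightarrow> (\<forall>x\<in>U. \<forall>\<^sub>F (x', y) in uniformity. x' = x \<longrightarrow> y \<in> U)"

instance
proof
  fix x y z :: barcode
  show "dist x y = 0 \<longleftrightarrow> x = y"
  proof transfer
    fix b b' assume *: "barcode_eq b b" "barcode_eq b' b'"
    obtain xs ys where "b = mset xs" "b' = mset ys" by (metis ex_mset)
    then show "bottleneck_mset b b' = 0 \<longleftrightarrow> barcode_eq b b'"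
      using * bottleneck_eq_0I[of xs ys] bottleneck_eq_0D[of xs ys]
      by (auto simp: bottleneck_mset_mset barcode_eq_def)
  qed
  show "dist x y \<le> dist x z + dist y z"
  proof transfer
    fix b b' b'' :: "bar multiset"
    obtain xs ys zs where "b = mset xs" "b' = mset ys" "b'' = mset zs" by (metis ex_mset)
    then show "bottleneck_mset b b' \<le> bottleneck_mset b b'' + bottleneck_mset b' b''"
      using bottleneck_triangle[of xs ys zs] by (simp add: bottleneck_mset_mset bottleneck_commute)
  qed
qed (rule uniformity_barcode_def open_barcode_def)+

end


section \<open>Completion of a metric space\<close>

text \<open>The completion is realised as the closure of the image of the isometric Kuratowski embedding
  into the complete space of bounded continuous functions.  The lemmas \<open>dist_to_completion\<close> and
  \<open>dense_to_completion\<close> together with the \<^class>\<open>complete_space\<close> instance characterise it up to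
  isometry.\<close>

definition kuratowski :: "'a::metric_space \<Rightarrow> 'a \<Rightarrow>\<^sub>C real" where
  "kuratowski x = Bcontfun (\<lambda>y. dist x y - dist undefined y)"

lemma apply_kuratowski: "apply_bcontfun (kuratowski x) y = dist x y - dist undefined y"
proof -
  have "\<bar>dist x y - dist undefined y\<bar> \<le> dist x undefined" for y
    using dist_triangle[of x y undefined] dist_triangle[of undefined y x] dist_commute[of x undefined]
    by linarith
  then have "bounded (range (\<lambda>y. dist x y - dist undefined y))"
    by (intro boundedI[of _ "dist x undefined"]) auto
  moreover have "continuous_on UNIV (\<lambda>y. dist x y - dist undefined y)"
    by (intro continuous_intros)
  ultimately have "(\<lambda>y. dist x y - dist undefined y) \<in> bcontfun"
    by (simp add: bcontfun_def)
  then show ?thesis by (simp add: kuratowski_def Bcontfun_inverse)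
qed

lemma dist_kuratowski: "dist (kuratowski x) (kuratowski y) = dist x y"
proof (rule antisym)
  show "dist (kuratowski x) (kuratowski y) \<le> dist x y"
  proof (rule dist_bound)
    fix z
    show "dist (kuratowski x z) (kuratowski y z) \<le> dist x y"
      using dist_triangle[of x z y] dist_triangle[of y z x] dist_commute[of x y]
      unfolding apply_kuratowski dist_real_def by linarith
  qed
  show "dist x y \<le> dist (kuratowski x) (kuratowski y)"
    using dist_bounded[of "kuratowski x" y "kuratowski y"]
    by (simp add: apply_kuratowski dist_real_def)
qed

typedef (overloaded) ('a::metric_space) completion =
  "closure (range (kuratowski :: 'a \<Rightarrow> 'a \<Rightarrow>\<^sub>C real))"
  by (rule exI[of _ "kuratowski undefined"]) (rule subsetD[OF closure_subset rangeI])

setup_lifting type_definition_completion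

instantiation completion :: (metric_space) metric_space
begin

lift_definition dist_completion :: "'a completion \<Rightarrow> 'a completion \<Rightarrow> real" is dist .

definition uniformity_completion :: "('a completion \<times> 'a completion) filter" where
  "uniformity_completion = (INF e\<in>{0<..}. principal {(x, y). dist x y < e})"

definition open_completion :: "'a completion set \<Rightarrow> bool" where
  "open_completion U \<longleftrightarrow> (\<forall>x\<in>U. \<forall>\<^sub>F (x', y) in uniformity. x' = x \<longrightarrow> y \<in> U)"

instance
proof
  fix x y z :: "'a completion"
  show "dist x y = 0 \<longleftrightarrow> x = y" by transfer simp
  show "dist x y \<le> dist x z + dist y z" by transfer (rule dist_triangle2)
qed (rule uniformity_completion_def open_completion_def)+

end

instance completion :: (metric_space) complete_space
proof
  fix X :: "nat \<Rightarrow> 'a completion"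
  assume "Cauchy X"
  then have "Cauchy (\<lambda>n. Rep_completion (X n))"
    unfolding Cauchy_def dist_completion.rep_eq .
  then obtain l where l: "(\<lambda>n. Rep_completion (X n)) \<longlonglongrightarrow> l"
    using Cauchy_convergent unfolding convergent_def by blast
  have "l \<in> closure (range kuratowski)"
    by (rule closed_sequentially[OF closed_closure _ l]) (rule Rep_completion)
  then obtain x where "l = Rep_completion x" by (rule Rep_completion_cases)
  then have "X \<longlonglongrightarrow> x"
    using l unfolding tendsto_iff dist_completion.rep_eq by simp
  then show "convergent X" by (rule convergentI)
qed

lift_definition to_completion :: "'a::metric_space \<Rightarrow> 'a completion" is kuratowski
  by (rule subsetD[OF closure_subset rangeI])

lemma dist_to_completion: "dist (to_completion x) (to_completion y) = dist x y"
  unfolding dist_completion.rep_eq to_completion.rep_eq by (rule dist_kuratowski)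

lemma dense_to_completion: "closure (range to_completion) = UNIV"
proof -
  have "\<exists>y\<in>range to_completion. dist y x < e" if "0 < e" for x :: "'a completion" and e
  proof -
    have "\<exists>k\<in>range kuratowski. dist k (Rep_completion x) < e"
      using Rep_completion[of x] that unfolding closure_approachable by (elim allE impE)
    then obtain y where "dist (kuratowski y) (Rep_completion x) < e" by (elim bexE rangeE) simp
    then have "dist (to_completion y) x < e"
      unfolding dist_completion.rep_eq to_completion.rep_eq .
    then show ?thesis by (rule bexI) (rule rangeI)
  qed
  then have "x \<in> closure (range to_completion)" for x :: "'a completion"
    by (simp add: closure_approachable)
  then show ?thesis by (intro equalityI subset_UNIV subsetI)
qed


section \<open>Probability in Banach spaces\<close>

text \<open>In the theorem the class \<^class>\<open>second_countable_topology\<close> expresses separability of the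
  Banach space.  The next lemma shows that a metric space with a countable dense subset satisfies the
  class axiom; the converse is \<open>countable_dense_exists\<close>.\<close>

lemma separable_imp_second_countable:
  fixes D :: "'a::metric_space set"
  assumes D: "countable D" "closure D = UNIV"
  shows "\<exists>B :: 'a set set. countable B \<and> open = generate_topology B"
proof -
  let ?B = "(\<lambda>(x, q). ball x q) ` (D \<times> \<rat>)"
  have "topological_basis ?B"
  proof (rule topological_basisI)
    show "open b" if "b \<in> ?B" for b using that by (auto split: prod.splits)
    fix U and y :: 'a
    assume "open U" "y \<in> U"
    then obtain e where e: "0 < e" "ball y e \<subseteq> U" by (meson openE)
    obtain q where q: "q \<in> \<rat>" "0 < q" "q < e / 2" using Rats_dense_in_real[of 0 "e / 2"] e by auto
    have "y \<in> closure D" using D by simp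
    then obtain x where x: "x \<in> D" "dist x y < q"
      unfolding closure_approachable using q by blast
    have "ball x q \<subseteq> ball y e"
    proof
      fix z assume "z \<in> ball x q"
      then show "z \<in> ball y e"
        using x q dist_triangle[of y z x] by (simp add: dist_commute)
    qed
    then have "ball x q \<subseteq> U" using e by blast
    moreover have "y \<in> ball x q" using x by simp
    moreover have "ball x q \<in> ?B" by (rule image_eqI[of _ _ "(x, q)"]) (use x q in simp_all)
    ultimately show "\<exists>b\<in>?B. y \<in> b \<and> b \<subseteq> U" by (intro bexI conjI)
  qed
  moreover have "countable ?B" by (intro countable_image countable_SIGMA D(1) countable_rat)
  ultimately show ?thesis
    using topological_basis_imp_subbasis by blast
qed

definition pettis_expectation :: "'w measure \<Rightarrow> ('w \<Rightarrow> 'v::real_normed_vector) \<Rightarrow> 'v \<Rightarrow> bool" where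
  "pettis_expectation M \<xi> v \<longleftrightarrow>
     (\<forall>\<phi> :: 'v \<Rightarrow> real. bounded_linear \<phi> \<longrightarrow>
        integrable M (\<lambda>\<omega>. \<phi> (\<xi> \<omega>)) \<and> (\<integral>\<omega>. \<phi> (\<xi> \<omega>) \<partial>M) = \<phi> v)"

definition rademacher :: "'w measure \<Rightarrow> (nat \<Rightarrow> 'w \<Rightarrow> real) \<Rightarrow> bool" where
  "rademacher P \<epsilon> \<longleftrightarrow> prob_space P \<and> prob_space.indep_vars P (\<lambda>_. borel) \<epsilon> UNIV \<and>
     (\<forall>i. measure P {\<omega> \<in> space P. \<epsilon> i \<omega> = 1} = 1 / 2 \<and>
          measure P {\<omega> \<in> space P. \<epsilon> i \<omega> = - 1} = 1 / 2)"

text \<open>A definition cannot quantify over sample spaces of arbitrary type.  Only the law of the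
  Rademacher sequence matters, so its sample space is taken to be a probability measure on real
  sequences; \<open>type_2D\<close> recovers the inequality for every Rademacher sequence.\<close>

definition type_2 :: "'v::real_normed_vector itself \<Rightarrow> bool" where
  "type_2 _ \<longleftrightarrow>
     (\<forall>(P :: (nat \<Rightarrow> real) measure) \<epsilon>. rademacher P \<epsilon> \<longrightarrow>
        (\<exists>C. \<forall>n (x :: nat \<Rightarrow> 'v).
           sqrt (\<integral>\<omega>. (norm (\<Sum>i<n. \<epsilon> i \<omega> *\<^sub>R x i))\<^sup>2 \<partial>P) \<le> C * sqrt (\<Sum>i<n. (norm (x i))\<^sup>2)))"

lemma type_2D:
  fixes P :: "'w measure"
  assumes "type_2 TYPE('v::{banach, second_countable_topology})" and R: "rademacher P \<epsilon>"
  shows "\<exists>C. \<forall>n (x :: nat \<Rightarrow> 'v).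
    sqrt (\<integral>\<omega>. (norm (\<Sum>i<n. \<epsilon> i \<omega> *\<^sub>R x i))\<^sup>2 \<partial>P) \<le> C * sqrt (\<Sum>i<n. (norm (x i))\<^sup>2)"
proof -
  interpret P: prob_space P using R by (simp add: rademacher_def)
  let ?S = "PiM UNIV (\<lambda>_::nat. borel :: real measure)"
  have ind: "P.indep_vars (\<lambda>_. borel) \<epsilon> UNIV" using R by (simp add: rademacher_def)
  then have rv: "\<epsilon> i \<in> borel_measurable P" for i by (auto simp: P.indep_vars_def)
  define F where "F = (\<lambda>\<omega> i. \<epsilon> i \<omega>)"
  have F: "F \<in> measurable P ?S"
    unfolding F_def by (rule measurable_PiM_single') (use rv in \<open>auto simp: space_PiM\<close>)
  define Q where "Q = distr P ?S F"
  interpret Q: prob_space Q unfolding Q_def by (rule P.prob_space_distr[OF F])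
  have Q: "Q = PiM UNIV (\<lambda>i. distr P borel (\<epsilon> i))"
    using ind rv by (subst (asm) P.indep_vars_iff_distr_eq_PiM) (auto simp: Q_def F_def restrict_def)
  have crd: "(\<lambda>\<omega>. \<omega> i) \<in> borel_measurable ?S" for i by (rule measurable_component_singleton) simp
  have crdQ: "(\<lambda>\<omega>. \<omega> i) \<in> borel_measurable Q" for i using crd by (simp add: Q_def)
  have law: "distr Q borel (\<lambda>\<omega>. \<omega> i) = distr P borel (\<epsilon> i)" for i
    unfolding Q_def using crd F by (subst distr_distr) (auto simp: comp_def F_def)
  have "Q.indep_vars (\<lambda>_. borel) (\<lambda>i \<omega>. \<omega> i) UNIV"
  proof (subst Q.indep_vars_iff_distr_eq_PiM)
    have "distr Q ?S (\<lambda>\<omega>. \<omega>) = distr Q Q (\<lambda>\<omega>. \<omega>)" by (rule distr_cong) (auto simp: Q_def)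
    then show "distr Q ?S (\<lambda>\<omega>. \<lambda>i\<in>UNIV. \<omega> i) = PiM UNIV (\<lambda>i. distr Q borel (\<lambda>\<omega>. \<omega> i))"
      by (simp add: law Q[symmetric] restrict_def)
  qed (use crdQ in auto)
  moreover have "measure Q {\<omega> \<in> space Q. \<omega> i = c} = measure P {\<omega> \<in> space P. \<epsilon> i \<omega> = c}" for i c
  proof -
    have "measure Q {\<omega> \<in> space Q. \<omega> i = c} = measure (distr Q borel (\<lambda>\<omega>. \<omega> i)) {c}"
      using crdQ by (subst measure_distr) (auto intro!: arg_cong[of _ _ "measure Q"])
    also have "\<dots> = measure P {\<omega> \<in> space P. \<epsilon> i \<omega> = c}"
      using rv by (subst law, subst measure_distr) (auto intro!: arg_cong[of _ _ "measure P"])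
    finally show ?thesis .
  qed
  ultimately have "rademacher Q (\<lambda>i \<omega>. \<omega> i)"
    using R by (simp add: rademacher_def Q.prob_space_axioms)
  moreover have "(\<integral>\<omega>. (norm (\<Sum>i<n. \<omega> i *\<^sub>R x i))\<^sup>2 \<partial>Q)
      = (\<integral>\<omega>. (norm (\<Sum>i<n. \<epsilon> i \<omega> *\<^sub>R x i))\<^sup>2 \<partial>P)" for n and x :: "nat \<Rightarrow> 'v"
  proof -
    have "(\<lambda>\<omega>. (norm (\<Sum>i<n. \<omega> i *\<^sub>R x i))\<^sup>2) \<in> borel_measurable ?S"
      using crd by (intro measurable) measurable
    then show ?thesis unfolding Q_def by (subst integral_distr[OF F]) (simp_all add: F_def)
  qed
  ultimately show ?thesis using assms(1) unfolding type_2_def by fastforce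
qed

text \<open>A degenerate one-dimensional Gaussian is the point mass at its mean.\<close>

definition centered_gaussian :: "'w measure \<Rightarrow> ('w \<Rightarrow> 'v::real_normed_vector) \<Rightarrow> bool" where
  "centered_gaussian N G \<longleftrightarrow> prob_space N \<and> G \<in> borel_measurable N \<and>
     (\<forall>\<phi> :: 'v \<Rightarrow> real. bounded_linear \<phi> \<longrightarrow>
        distr N borel (\<lambda>\<omega>. \<phi> (G \<omega>)) = return borel 0 \<or>
        (\<exists>\<sigma>>0. distributed N lborel (\<lambda>\<omega>. \<phi> (G \<omega>)) (normal_density 0 \<sigma>)))"

definition same_covariance ::
    "'w measure \<Rightarrow> ('w \<Rightarrow> 'v::real_normed_vector) \<Rightarrow> 'u measure \<Rightarrow> ('u \<Rightarrow> 'v) \<Rightarrow> bool" where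
  "same_covariance N G M Y \<longleftrightarrow>
     (\<forall>\<phi> \<psi> :: 'v \<Rightarrow> real. bounded_linear \<phi> \<longrightarrow> bounded_linear \<psi> \<longrightarrow>
        (\<integral>\<omega>. \<phi> (G \<omega>) * \<psi> (G \<omega>) \<partial>N) = (\<integral>\<omega>. \<phi> (Y \<omega>) * \<psi> (Y \<omega>) \<partial>M))"

definition converges_weakly ::
    "'w measure \<Rightarrow> (nat \<Rightarrow> 'w \<Rightarrow> 'v::topological_space) \<Rightarrow> 'u measure \<Rightarrow> ('u \<Rightarrow> 'v) \<Rightarrow> bool" where
  "converges_weakly M Y N G \<longleftrightarrow>
     (\<forall>n. Y n \<in> borel_measurable M) \<and> G \<in> borel_measurable N \<and>
     (\<forall>f :: 'v \<Rightarrow> real. continuous_on UNIV f \<longrightarrow> bounded (range f) \<longrightarrow>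
        (\<lambda>n. \<integral>\<omega>. f (Y n \<omega>) \<partial>M) \<longlonglongrightarrow> (\<integral>\<omega>. f (G \<omega>) \<partial>N))"

end

theory Submission
  imports Defs
begin

text \<open>Let \<open>\<mu>\<close> be the law of \<open>Y\<^sub>i = T (X\<^sub>i)\<close> on the Banach space and write \<open>S\<^sub>n(F)\<close> for
  \<open>n\<close> to the power \<open>- 1/2\<close> times the sum of \<open>F (Y\<^sub>i)\<close> over \<open>1 \<le> i \<le> n\<close>, where \<open>F\<close> is a Borel map.  The
  proof compares \<open>S\<^sub>n(id)\<close> with finite-dimensional sums, and type 2 is what makes this comparison
  uniform in \<open>n\<close>.

  Since \<open>\<mu>\<close> has a finite second moment, the Pettis mean of \<open>Y\<^sub>1\<close> is a Bochner mean; as functionals separate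
  points (\<open>eq_0_if_all_functionals_0\<close>), it vanishes.  Symmetrization and the type inequality then bound
  the second moment of \<open>S\<^sub>n(F)\<close> by a constant \<open>K\<close> times that of \<open>F\<close>, for all centered \<open>F\<close> and all
  \<open>n\<close> (\<open>iid_sum_bound\<close>).

  For maps \<open>F = \<Sum> u\<^sub>i x\<^sub>i\<close> with finitely many vectors \<open>x\<^sub>i\<close> and real functions \<open>u\<^sub>i\<close> that are
  centered and orthogonal under \<open>\<mu>\<close>, the limit is explicit: \<open>S\<^sub>n(F)\<close> converges weakly to
  \<open>\<Gamma>(F) = \<Sum> \<sigma>\<^sub>i g\<^sub>i x\<^sub>i\<close>, where \<open>\<sigma>\<^sub>i\<close> is the standard deviation of \<open>u\<^sub>i\<close> and the \<open>g\<^sub>i\<close> are independent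
  standard normal variables (\<open>finite_rank_clt\<close>).  Passing to the limit in the moment bound shows that the
  second moment of \<open>\<Gamma>(F)\<close> is also at most \<open>K\<close> times that of \<open>F\<close> (\<open>gaussian_sum_bound\<close>).

  By simple functions and Gram-Schmidt orthogonalization, one orthogonal sequence \<open>u\<close> suffices to approximate the
  identity by such maps \<open>F\<^sub>k\<close> in the square mean under \<open>\<mu>\<close> (\<open>finite_rank_approximation\<close>).  All \<open>\<Gamma>(F\<^sub>k)\<close> then
  live on the same probability space, form a Cauchy sequence there, and converge to a variable \<open>G\<close>.  A
  three-term estimate for Lipschitz test functions, with both error terms small uniformly in \<open>n\<close>, gives weak
  convergence of \<open>S\<^sub>n(id)\<close> to \<open>G\<close> (\<open>normalized_sum_converges_weakly\<close>).  Constructing \<open>G\<close> in this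
  way replaces tightness and compactness arguments.

  That \<open>G\<close> is Gaussian with the right covariance needs no further computation: every functional of
  \<open>S\<^sub>n(id)\<close> is a normalized sum of real variables, so the real central limit theorem identifies the law of that
  functional of \<open>G\<close> (\<open>weak_limit_gaussian\<close>).\<close>

section \<open>Bounded functionals separate points\<close>

text \<open>The bound by the norm makes linear members continuous and keeps chains of such functionals bounded below.\<close>

definition sublinear_below_norm :: "('v::real_normed_vector \<Rightarrow> real) \<Rightarrow> bool" where
  "sublinear_below_norm p \<longleftrightarrow> (\<forall>x y. p (x + y) \<le> p x + p y) \<and>
     (\<forall>t x. 0 \<le> t \<longrightarrow> p (t *\<^sub>R x) = t * p x) \<and> (\<forall>x. p x \<le> norm x)"

lemma
  assumes "sublinear_below_norm p"
  shows sublinear_add: "p (x + y) \<le> p x + p y"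
    and sublinear_scale: "0 \<le> t \<Longrightarrow> p (t *\<^sub>R x) = t * p x"
    and sublinear_le: "p x \<le> norm x"
    and sublinear_ge: "- norm x \<le> p x"
    and sublinear_0: "p 0 = 0"
proof -
  show a: "p (x + y) \<le> p x + p y" for x y using assms by (simp add: sublinear_below_norm_def)
  show s: "0 \<le> t \<Longrightarrow> p (t *\<^sub>R x) = t * p x" for t x using assms by (simp add: sublinear_below_norm_def)
  show le: "p x \<le> norm x" for x using assms by (simp add: sublinear_below_norm_def)
  show z: "p 0 = 0" using s[of 0 0] by simp
  have "- p (- x) \<le> p x" using a[of x "-x"] z by simp
  then show "- norm x \<le> p x" using le[of "-x"] by simp
qed

text \<open>Replacing \<open>p\<close> by \<open>directional_min p y\<close> is the one-step extension of the Hahn-Banach theorem,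
  expressed with sublinear functionals: it is the largest sublinear functional below \<open>p\<close> whose
  value at \<open>- y\<close> is \<open>- p y\<close>, that is, which is linear in direction \<open>y\<close>.\<close>

definition directional_min :: "('v::real_normed_vector \<Rightarrow> real) \<Rightarrow> 'v \<Rightarrow> 'v \<Rightarrow> real" where
  "directional_min p y x = (INF t\<in>{0..}. p (x + t *\<^sub>R y) - t * p y)"

lemma directional_min_bdd:
  assumes "sublinear_below_norm p"
  shows "bdd_below ((\<lambda>t. p (x + t *\<^sub>R y) - t * p y) ` {0..})"
proof (rule bdd_belowI2)
  fix t :: real assume "t \<in> {0..}"
  then show "- p (- x) \<le> p (x + t *\<^sub>R y) - t * p y"
    using sublinear_add[OF assms, of "x + t *\<^sub>R y" "- x"] sublinear_scale[OF assms, of t y] by simp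
qed

lemma directional_min_le:
  assumes "sublinear_below_norm p" "0 \<le> t"
  shows "directional_min p y x \<le> p (x + t *\<^sub>R y) - t * p y"
  unfolding directional_min_def
  by (rule cINF_lower[OF directional_min_bdd[OF assms(1)]]) (use assms in simp)

lemma directional_min_approx:
  assumes "sublinear_below_norm p" "0 < e"
  obtains t where "0 \<le> t" "p (x + t *\<^sub>R y) - t * p y < directional_min p y x + e"
proof -
  have "\<exists>t\<in>{0..}. p (x + t *\<^sub>R y) - t * p y < directional_min p y x + e"
    using assms(2) by (subst cINF_less_iff[OF _ directional_min_bdd[OF assms(1)], symmetric])
      (auto simp: directional_min_def)
  then show ?thesis using that by auto
qed

lemma sublinear_directional_min:
  assumes p: "sublinear_below_norm p"
  shows "sublinear_below_norm (directional_min p y)"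
proof -
  let ?q = "directional_min p y"
  have "?q (a + b) \<le> ?q a + ?q b" for a b
  proof (rule field_le_epsilon)
    fix e :: real assume "0 < e"
    then have e: "0 < e / 2" by simp
    obtain s t where s: "0 \<le> s" "p (a + s *\<^sub>R y) - s * p y < ?q a + e / 2"
      and t: "0 \<le> t" "p (b + t *\<^sub>R y) - t * p y < ?q b + e / 2"
      using directional_min_approx[OF p e] by metis
    have "?q (a + b) \<le> p ((a + s *\<^sub>R y) + (b + t *\<^sub>R y)) - (s + t) * p y"
      using directional_min_le[OF p, of "s + t" y "a + b"] s t by (simp add: algebra_simps)
    also have "\<dots> \<le> (p (a + s *\<^sub>R y) - s * p y) + (p (b + t *\<^sub>R y) - t * p y)"
      using sublinear_add[OF p, of "a + s *\<^sub>R y" "b + t *\<^sub>R y"] by (simp add: algebra_simps)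
    finally show "?q (a + b) \<le> ?q a + ?q b + e" using s t by simp
  qed
  moreover have le: "?q a \<le> norm a" for a
    using directional_min_le[OF p, of 0 y a] sublinear_le[OF p, of a] by simp
  moreover have half: "?q (t *\<^sub>R a) \<le> t * ?q a" if "0 < t" for t a
  proof (rule field_le_epsilon)
    fix e :: real assume "0 < e"
    then have e: "0 < e / t" using that by simp
    obtain s where s: "0 \<le> s" "p (a + s *\<^sub>R y) - s * p y < ?q a + e / t"
      using directional_min_approx[OF p e] by metis
    have "?q (t *\<^sub>R a) \<le> p (t *\<^sub>R (a + s *\<^sub>R y)) - t * s * p y"
      using directional_min_le[OF p, of "t * s" y "t *\<^sub>R a"] s that by (simp add: algebra_simps)
    also have "\<dots> = t * (p (a + s *\<^sub>R y) - s * p y)"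
      using sublinear_scale[OF p, of t "a + s *\<^sub>R y"] that by (simp add: algebra_simps)
    also have "\<dots> \<le> t * (?q a + e / t)" using s that by (intro mult_left_mono) auto
    finally show "?q (t *\<^sub>R a) \<le> t * ?q a + e" using that by (simp add: algebra_simps)
  qed
  have scale: "?q (t *\<^sub>R a) = t * ?q a" if t: "0 < t" for t a
  proof (rule antisym[OF half[OF t]])
    show "t * ?q a \<le> ?q (t *\<^sub>R a)"
      using half[of "inverse t" "t *\<^sub>R a"] t by (simp add: field_simps)
  qed
  have "?q 0 = 0"
    using le[of 0] scale[of 2 0] by simp
  with scale have "?q (t *\<^sub>R a) = t * ?q a" if "0 \<le> t" for t a
    using that by (cases "t = 0") auto
  ultimately show ?thesis unfolding sublinear_below_norm_def by blast
qed

text \<open>Two members of a chain have a common lower member, which is what subadditivity of the infimum needs.\<close>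

lemma sublinear_chain_Inf:
  assumes ne: "C \<noteq> {}" and sub: "\<And>p. p \<in> C \<Longrightarrow> sublinear_below_norm p"
    and ch: "\<And>p q. p \<in> C \<Longrightarrow> q \<in> C \<Longrightarrow> p \<le> q \<or> q \<le> p"
  shows "sublinear_below_norm (\<lambda>x. INF p\<in>C. p x)" and "q \<in> C \<Longrightarrow> (\<lambda>x. INF p\<in>C. p x) \<le> q"
proof -
  let ?I = "\<lambda>x. INF p\<in>C. p x"
  have bdd: "bdd_below ((\<lambda>p. p x) ` C)" for x
    by (rule bdd_belowI2[of _ "- norm x"]) (rule sublinear_ge[OF sub])
  have lower: "?I x \<le> p x" if "p \<in> C" for p x by (rule cINF_lower[OF bdd that])
  then show "q \<in> C \<Longrightarrow> ?I \<le> q" by (auto simp: le_fun_def)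
  have approx: "\<exists>p\<in>C. p x < ?I x + e" if "0 < e" for x e
    using that by (subst cINF_less_iff[OF ne bdd, symmetric]) auto
  have add: "?I (x + y) \<le> ?I x + ?I y" for x y
  proof (rule field_le_epsilon)
    fix e :: real assume "0 < e"
    then have "0 < e / 2" by simp
    then obtain p q where p: "p \<in> C" "p x < ?I x + e / 2" and q: "q \<in> C" "q y < ?I y + e / 2"
      using approx by meson
    obtain r where r: "r \<in> C" "r \<le> p" "r \<le> q" using ch[OF p(1) q(1)] p q by auto
    have "?I (x + y) \<le> r x + r y" using lower[OF r(1)] sublinear_add[OF sub[OF r(1)]] order_trans by blast
    also have "\<dots> \<le> p x + q y" using r by (intro add_mono) (auto simp: le_fun_def)
    finally show "?I (x + y) \<le> ?I x + ?I y + e" using p q by simp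
  qed
  have le: "?I x \<le> norm x" for x
    using ne lower sublinear_le[OF sub] by (meson ex_in_conv order_trans)
  have half: "?I (t *\<^sub>R x) \<le> t * ?I x" if "0 < t" for t x
  proof (rule field_le_epsilon)
    fix e :: real assume "0 < e"
    then have "0 < e / t" using that by simp
    then obtain p where p: "p \<in> C" "p x < ?I x + e / t" using approx by meson
    have "?I (t *\<^sub>R x) \<le> t * p x"
      using lower[OF p(1), of "t *\<^sub>R x"] sublinear_scale[OF sub[OF p(1)], of t x] that by simp
    also have "\<dots> \<le> t * (?I x + e / t)" using p that by (intro mult_left_mono) auto
    finally show "?I (t *\<^sub>R x) \<le> t * ?I x + e" using that by (simp add: algebra_simps)
  qed
  have scale: "?I (t *\<^sub>R x) = t * ?I x" if t: "0 < t" for t x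
  proof (rule antisym[OF half[OF t]])
    show "t * ?I x \<le> ?I (t *\<^sub>R x)" using half[of "inverse t" "t *\<^sub>R x"] t by (simp add: field_simps)
  qed
  have "?I 0 = 0" using scale[of 2 0] by simp
  with scale have "?I (t *\<^sub>R x) = t * ?I x" if "0 \<le> t" for t x
    using that by (cases "t = 0") auto
  then show "sublinear_below_norm ?I" unfolding sublinear_below_norm_def using add le by blast
qed

text \<open>By Zorn's lemma there is a minimal sublinear functional below \<open>directional_min norm v\<close>.  Minimality
  forbids improving it in any direction, so it is linear; at \<open>- v\<close> it inherits the bound
  \<open>- norm v\<close> from \<open>directional_min norm v\<close>.\<close>

lemma exists_functional_neg:
  fixes v :: "'v::real_normed_vector"
  shows "\<exists>\<phi> :: 'v \<Rightarrow> real. bounded_linear \<phi> \<and> \<phi> (- v) \<le> - norm v"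
proof -
  let ?N = "norm :: 'v \<Rightarrow> real"
  have N: "sublinear_below_norm ?N"
    unfolding sublinear_below_norm_def by (auto simp: norm_triangle_ineq)
  let ?p = "directional_min ?N v"
  let ?A = "{p. sublinear_below_norm p \<and> p \<le> ?p}"
  let ?P = "\<lambda>p q :: 'v \<Rightarrow> real. q \<le> p"
  have "\<exists>m\<in>?A. \<forall>a\<in>?A. a \<le> m \<longrightarrow> a = m"
  proof (rule predicate_Zorn)
    show "partial_order_on ?A (relation_of ?P ?A)"
      by (rule partial_order_on_relation_ofI) auto
    fix C assume C: "C \<in> Chains (relation_of ?P ?A)"
    show "\<exists>u\<in>?A. \<forall>a\<in>C. u \<le> a"
    proof (cases "C = {}")
      case True
      then show ?thesis using sublinear_directional_min[OF N] by blast
    next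
      case False
      have CA: "C \<subseteq> ?A" and ch: "\<And>p q. p \<in> C \<Longrightarrow> q \<in> C \<Longrightarrow> p \<le> q \<or> q \<le> p"
        using C unfolding Chains_def relation_of_def by auto
      then have sub: "\<And>p. p \<in> C \<Longrightarrow> sublinear_below_norm p" by auto
      note I = sublinear_chain_Inf[OF False sub ch]
      obtain c where "c \<in> C" using False by auto
      then have "(\<lambda>x. INF p\<in>C. p x) \<le> ?p" using I(2)[of c] CA by (auto intro: order_trans)
      then show ?thesis using I by (intro bexI[of _ "\<lambda>x. INF p\<in>C. p x"]) auto
    qed
  qed
  then obtain m where m: "sublinear_below_norm m" "m \<le> ?p"
    and min: "\<And>q. sublinear_below_norm q \<Longrightarrow> q \<le> m \<Longrightarrow> q = m"
    by (metis (mono_tags, lifting) mem_Collect_eq order_trans)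
  (* A minimal sublinear functional is linear in every direction. *)
  have eq: "directional_min m y = m" for y
    using directional_min_le[OF m(1), of 0 y] by (intro min sublinear_directional_min[OF m(1)]) (simp add: le_fun_def)
  have add: "m (x + y) = m x + m y" for x y
    using directional_min_le[OF m(1), of 1 y x] sublinear_add[OF m(1), of x y] by (simp add: eq)
  have neg: "m (- x) = - m x" for x using add[of x "- x"] sublinear_0[OF m(1)] by simp
  have scale: "m (t *\<^sub>R x) = t * m x" for t x
    using sublinear_scale[OF m(1), of t x] sublinear_scale[OF m(1), of "- t" x] neg[of "t *\<^sub>R x"]
    by (cases "0 \<le> t") auto
  have "bounded_linear m"
  proof (rule bounded_linear_intro[of _ 1])
    show "norm (m x) \<le> norm x * 1" for x
      using sublinear_le[OF m(1), of x] sublinear_ge[OF m(1), of x] by simp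
  qed (auto simp: add scale)
  moreover have "m (- v) \<le> - norm v"
    using m(2) directional_min_le[OF N, of 1 v "- v"] by (auto simp: le_fun_def intro: order_trans)
  ultimately show ?thesis by blast
qed

lemma eq_0_if_all_functionals_0:
  fixes v :: "'v::real_normed_vector"
  assumes "\<And>\<phi> :: 'v \<Rightarrow> real. bounded_linear \<phi> \<Longrightarrow> \<phi> v = 0"
  shows "v = 0"
proof -
  obtain \<phi> :: "'v \<Rightarrow> real" where \<phi>: "bounded_linear \<phi>" "\<phi> (- v) \<le> - norm v"
    using exists_functional_neg by blast
  show ?thesis using assms[OF \<phi>(1)] \<phi>(2) by (simp add: linear_neg[OF bounded_linear.linear[OF \<phi>(1)]])
qed

section \<open>Second moments of independent sums in spaces of type 2\<close>

text \<open>Coordinates on an infinite product provide both the Rademacher sequence in which the type inequality is read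
  and the independent normal variables that drive the Gaussian limit.\<close>

lemma iid_coordinates:
  fixes \<nu> :: "real measure"
  assumes "prob_space \<nu>" and sets: "sets \<nu> = sets borel"
  defines "Q \<equiv> PiM UNIV (\<lambda>_::nat. \<nu>)"
  shows "prob_space Q"
    and "distr Q borel (\<lambda>\<omega>. \<omega> i) = \<nu>"
    and "prob_space.indep_vars Q (\<lambda>_. borel) (\<lambda>i \<omega>. \<omega> i) UNIV"
proof -
  interpret \<nu>: prob_space \<nu> by fact
  interpret P: product_prob_space "\<lambda>_::nat. \<nu>" UNIV by unfold_locales
  show Q: "prob_space Q" unfolding Q_def by (rule prob_space_PiM) (rule assms(1))
  interpret Q: prob_space Q by (rule Q)
  have sQ: "sets Q = sets (PiM UNIV (\<lambda>_::nat. borel :: real measure))"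
    unfolding Q_def by (intro sets_PiM_cong) (auto simp: sets)
  have crd: "(\<lambda>\<omega>. \<omega> i) \<in> borel_measurable Q" for i
    by (subst measurable_cong_sets[OF sQ refl]) (rule measurable_component_singleton, simp)
  show law: "distr Q borel (\<lambda>\<omega>. \<omega> i) = \<nu>" for i
    using P.PiM_component[of i] unfolding Q_def by (metis UNIV_I distr_cong sets)
  show "Q.indep_vars (\<lambda>_. borel) (\<lambda>i \<omega>. \<omega> i) UNIV"
  proof (subst Q.indep_vars_iff_distr_eq_PiM)
    have "distr Q (PiM UNIV (\<lambda>_::nat. borel :: real measure)) (\<lambda>\<omega>. \<omega>) = distr Q Q (\<lambda>\<omega>. \<omega>)"
      by (rule distr_cong) (auto simp: sQ)
    then show "distr Q (PiM UNIV (\<lambda>_. borel)) (\<lambda>\<omega>. \<lambda>i\<in>UNIV. \<omega> i) = PiM UNIV (\<lambda>i. distr Q borel (\<lambda>\<omega>. \<omega> i))"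
      by (simp add: law restrict_def) (simp add: Q_def)
  qed (use crd in auto)
qed

lemma rademacher_exists: "\<exists>(P :: (nat \<Rightarrow> real) measure) \<epsilon>. rademacher P \<epsilon>"
proof -
  define \<nu> where "\<nu> = distr (measure_pmf (pmf_of_set {1, - 1 :: real})) borel (\<lambda>x. x)"
  have \<nu>: "prob_space \<nu>" "sets \<nu> = sets borel"
    unfolding \<nu>_def by (auto intro!: measure_pmf.prob_space_distr)
  define Q where "Q = PiM UNIV (\<lambda>_::nat. \<nu>)"
  note iid = iid_coordinates[OF \<nu>, folded Q_def]
  interpret Q: prob_space Q by (rule iid)
  have crd: "(\<lambda>\<omega>. \<omega> i) \<in> borel_measurable Q" for i
    using iid(3) by (simp add: Q.indep_vars_def)
  have "measure Q {\<omega> \<in> space Q. \<omega> i = c} = measure \<nu> {c}" for i c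
    by (subst iid(2)[of i, symmetric], subst measure_distr[OF crd]) (auto intro!: arg_cong[of _ _ "measure Q"])
  moreover have "measure \<nu> {c} = 1 / 2" if "c \<in> {1, - 1}" for c
    unfolding \<nu>_def using that by (subst measure_distr) (auto simp: measure_pmf_single)
  ultimately have "rademacher Q (\<lambda>i \<omega>. \<omega> i)"
    using iid by (simp add: rademacher_def)
  then show ?thesis by blast
qed

lemma rademacher_values:
  assumes "rademacher P \<epsilon>"
  shows "AE \<omega> in P. \<forall>i. \<epsilon> i \<omega> \<in> {1, - 1}"
proof -
  interpret P: prob_space P using assms by (simp add: rademacher_def)
  have rv[measurable]: "\<epsilon> i \<in> borel_measurable P" for i
    using assms by (auto simp: rademacher_def P.indep_vars_def)
  have "AE \<omega> in P. \<epsilon> i \<omega> \<in> {1, - 1}" for i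
  proof -
    have "P.prob {\<omega> \<in> space P. \<epsilon> i \<omega> \<in> {1, -1}}
        = P.prob ({\<omega> \<in> space P. \<epsilon> i \<omega> = 1} \<union> {\<omega> \<in> space P. \<epsilon> i \<omega> = - 1})"
      by (rule arg_cong[of _ _ "P.prob"]) auto
    also have "\<dots> = P.prob {\<omega> \<in> space P. \<epsilon> i \<omega> = 1} + P.prob {\<omega> \<in> space P. \<epsilon> i \<omega> = - 1}"
      by (rule P.finite_measure_Union) auto
    also have "\<dots> = 1 / 2 + 1 / 2" using assms unfolding rademacher_def by metis
    finally show ?thesis
      by (simp add: P.prob_Collect_eq_1)
  qed
  then show ?thesis by (simp add: AE_all_countable)
qed

text \<open>The type inequality is squared and written with an integral of nonnegative functions, so that the average over
  signs can later be exchanged with expectations freely.  Almost surely the signs are \<open>1\<close> or \<open>- 1\<close>, which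
  bounds the integrand.\<close>

lemma type_2_nn:
  assumes "type_2 TYPE('v::{banach, second_countable_topology})"
  shows "\<exists>(P :: (nat \<Rightarrow> real) measure) \<epsilon> C. rademacher P \<epsilon> \<and> 0 \<le> C \<and>
    (\<forall>n (x :: nat \<Rightarrow> 'v). (\<integral>\<^sup>+\<omega>. ennreal ((norm (\<Sum>i<n. \<epsilon> i \<omega> *\<^sub>R x i))\<^sup>2) \<partial>P) \<le> ennreal (C * (\<Sum>i<n. (norm (x i))\<^sup>2)))"
proof -
  obtain P :: "(nat \<Rightarrow> real) measure" and \<epsilon> where R: "rademacher P \<epsilon>"
    using rademacher_exists by blast
  interpret P: prob_space P using R by (simp add: rademacher_def)
  have rv[measurable]: "\<epsilon> i \<in> borel_measurable P" for i
    using R by (auto simp: rademacher_def P.indep_vars_def)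
  obtain C where C: "\<And>n (x :: nat \<Rightarrow> 'v). 
      sqrt (\<integral>\<omega>. (norm (\<Sum>i<n. \<epsilon> i \<omega> *\<^sub>R x i))\<^sup>2 \<partial>P) \<le> C * sqrt (\<Sum>i<n. (norm (x i))\<^sup>2)"
    using assms R unfolding type_2_def by blast
  have "(\<integral>\<^sup>+\<omega>. ennreal ((norm (\<Sum>i<n. \<epsilon> i \<omega> *\<^sub>R x i))\<^sup>2) \<partial>P) \<le> ennreal (C\<^sup>2 * (\<Sum>i<n. (norm (x i))\<^sup>2))"
    for n and x :: "nat \<Rightarrow> 'v"
  proof -
    let ?f = "\<lambda>\<omega>. (norm (\<Sum>i<n. \<epsilon> i \<omega> *\<^sub>R x i))\<^sup>2"
    have "AE \<omega> in P. norm (?f \<omega>) \<le> (\<Sum>i<n. norm (x i))\<^sup>2"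
      using rademacher_values[OF R]
    proof eventually_elim
      case (elim \<omega>)
      have "norm (\<Sum>i<n. \<epsilon> i \<omega> *\<^sub>R x i) \<le> (\<Sum>i<n. norm (\<epsilon> i \<omega> *\<^sub>R x i))" by (rule norm_sum)
      also have "\<dots> = (\<Sum>i<n. norm (x i))"
      proof (rule sum.cong)
        show "norm (\<epsilon> i \<omega> *\<^sub>R x i) = norm (x i)" for i using elim[rule_format, of i] by auto
      qed simp
      finally show ?case by (simp add: power_mono)
    qed
    then have "integrable P ?f"
      by (intro P.integrable_const_bound) auto
    then have "(\<integral>\<^sup>+\<omega>. ennreal (?f \<omega>) \<partial>P) = ennreal (\<integral>\<omega>. ?f \<omega> \<partial>P)"
      by (rule nn_integral_eq_integral) simp
    also have "(\<integral>\<omega>. ?f \<omega> \<partial>P) = (sqrt (\<integral>\<omega>. ?f \<omega> \<partial>P))\<^sup>2" by simp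
    also have "\<dots> \<le> (C * sqrt (\<Sum>i<n. (norm (x i))\<^sup>2))\<^sup>2"
      by (rule power_mono[OF C]) simp
    also have "\<dots> = C\<^sup>2 * (\<Sum>i<n. (norm (x i))\<^sup>2)"
      by (simp add: power_mult_distrib sum_nonneg)
    finally show ?thesis by (simp add: ennreal_leI)
  qed
  then show ?thesis using R by (intro exI[of _ P] exI[of _ \<epsilon>] exI[of _ "C\<^sup>2"]) auto
qed

text \<open>Flipping signs of independent symmetric variables preserves the marginal laws, and these determine the
  joint law.\<close>

lemma (in prob_space) symmetric_sum_sign_invariant:
  fixes D :: "nat \<Rightarrow> 'a \<Rightarrow> 'v::{banach, second_countable_topology}"
  assumes ind: "indep_vars (\<lambda>_. borel) D {..<n}"
    and sym: "\<And>i. i < n \<Longrightarrow> distr M borel (\<lambda>\<omega>. - D i \<omega>) = distr M borel (D i)"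
    and s: "\<And>i. s i \<in> {1, - 1 :: real}"
    and f[measurable]: "f \<in> borel_measurable borel"
  shows "(\<integral>\<^sup>+\<omega>. f (\<Sum>i<n. s i *\<^sub>R D i \<omega>) \<partial>M) = (\<integral>\<^sup>+\<omega>. f (\<Sum>i<n. D i \<omega>) \<partial>M)"
proof (cases "n = 0")
  case False
  let ?P = "PiM {..<n} (\<lambda>_. borel :: 'v measure)"
  have D[measurable]: "i < n \<Longrightarrow> D i \<in> borel_measurable M" for i using ind by (auto simp: indep_vars_def)
  have ind': "indep_vars (\<lambda>_. borel) (\<lambda>i \<omega>. s i *\<^sub>R D i \<omega>) {..<n}"
    by (rule indep_vars_compose2[OF ind, of "\<lambda>i x. s i *\<^sub>R x"]) simp
  have law: "distr M borel (\<lambda>\<omega>. s i *\<^sub>R D i \<omega>) = distr M borel (D i)" if "i < n" for i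
    using s[of i] sym[OF that] by auto
  have "distr M ?P (\<lambda>\<omega>. \<lambda>i\<in>{..<n}. s i *\<^sub>R D i \<omega>) = PiM {..<n} (\<lambda>i. distr M borel (\<lambda>\<omega>. s i *\<^sub>R D i \<omega>))"
    using ind' False by (subst (asm) indep_vars_iff_distr_eq_PiM') auto
  also have "\<dots> = PiM {..<n} (\<lambda>i. distr M borel (D i))"
    by (rule PiM_cong) (auto simp: law)
  also have "\<dots> = distr M ?P (\<lambda>\<omega>. \<lambda>i\<in>{..<n}. D i \<omega>)"
    using ind False by (subst (asm) indep_vars_iff_distr_eq_PiM') auto
  finally have eq: "distr M ?P (\<lambda>\<omega>. \<lambda>i\<in>{..<n}. s i *\<^sub>R D i \<omega>) = distr M ?P (\<lambda>\<omega>. \<lambda>i\<in>{..<n}. D i \<omega>)" .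
  have [measurable]: "(\<lambda>\<omega>. \<Sum>i<n. \<omega> i) \<in> borel_measurable ?P"
    by (rule borel_measurable_sum) (rule measurable_component_singleton)
  have "(\<integral>\<^sup>+\<omega>. f (\<Sum>i<n. \<omega> i) \<partial>distr M ?P (\<lambda>\<omega>. \<lambda>i\<in>{..<n}. s i *\<^sub>R D i \<omega>))
      = (\<integral>\<^sup>+\<omega>. f (\<Sum>i<n. s i *\<^sub>R D i \<omega>) \<partial>M)"
    by (subst nn_integral_distr) (auto intro!: measurable_restrict)
  moreover have "(\<integral>\<^sup>+\<omega>. f (\<Sum>i<n. \<omega> i) \<partial>distr M ?P (\<lambda>\<omega>. \<lambda>i\<in>{..<n}. D i \<omega>))
      = (\<integral>\<^sup>+\<omega>. f (\<Sum>i<n. D i \<omega>) \<partial>M)"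
    by (subst nn_integral_distr) (auto intro!: measurable_restrict)
  ultimately show ?thesis by (simp add: eq)
qed simp

text \<open>By sign invariance the left-hand side may be averaged over the signs \<open>\<epsilon>\<close>.  After exchanging the
  two integrals, the type inequality applies pointwise.\<close>

lemma (in prob_space) symmetric_sum_bound:
  fixes D :: "nat \<Rightarrow> 'a \<Rightarrow> 'v::{banach, second_countable_topology}"
  assumes R: "rademacher P \<epsilon>" and C: "0 \<le> C" "\<And>n (x :: nat \<Rightarrow> 'v). 
      (\<integral>\<^sup>+\<omega>. ennreal ((norm (\<Sum>i<n. \<epsilon> i \<omega> *\<^sub>R x i))\<^sup>2) \<partial>P) \<le> ennreal (C * (\<Sum>i<n. (norm (x i))\<^sup>2))"
    and ind: "indep_vars (\<lambda>_. borel) D {..<n}"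
    and sym: "\<And>i. i < n \<Longrightarrow> distr M borel (\<lambda>\<omega>. - D i \<omega>) = distr M borel (D i)"
  shows "(\<integral>\<^sup>+\<omega>. ennreal ((norm (\<Sum>i<n. D i \<omega>))\<^sup>2) \<partial>M)
    \<le> ennreal C * (\<Sum>i<n. \<integral>\<^sup>+\<omega>. ennreal ((norm (D i \<omega>))\<^sup>2) \<partial>M)"
proof -
  interpret P: prob_space P using R by (simp add: rademacher_def)
  interpret PM: pair_sigma_finite P M ..
  have rv[measurable]: "\<epsilon> i \<in> borel_measurable P" for i
    using R by (auto simp: rademacher_def P.indep_vars_def)
  have D[measurable]: "i < n \<Longrightarrow> D i \<in> borel_measurable M" for i using ind by (auto simp: indep_vars_def)
  have Dsq: "i < n \<Longrightarrow> (\<lambda>\<omega>. ennreal ((norm (D i \<omega>))\<^sup>2)) \<in> borel_measurable M" for i by measurable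
  let ?L = "\<integral>\<^sup>+\<omega>. ennreal ((norm (\<Sum>i<n. D i \<omega>))\<^sup>2) \<partial>M"
  have "?L = (\<integral>\<^sup>+e. ?L \<partial>P)" by (simp add: P.emeasure_space_1)
  also have "\<dots> = (\<integral>\<^sup>+e. (\<integral>\<^sup>+\<omega>. ennreal ((norm (\<Sum>i<n. \<epsilon> i e *\<^sub>R D i \<omega>))\<^sup>2) \<partial>M) \<partial>P)"
  proof (rule nn_integral_cong_AE)
    show "AE e in P. ?L = (\<integral>\<^sup>+\<omega>. ennreal ((norm (\<Sum>i<n. \<epsilon> i e *\<^sub>R D i \<omega>))\<^sup>2) \<partial>M)"
      using rademacher_values[OF R]
    proof eventually_elim
      case (elim e)
      show ?case
        using symmetric_sum_sign_invariant[OF ind sym, of "\<lambda>i. \<epsilon> i e" "\<lambda>x. ennreal ((norm x)\<^sup>2)"] elim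
        by simp
    qed
  qed
  also have "\<dots> = (\<integral>\<^sup>+\<omega>. (\<integral>\<^sup>+e. ennreal ((norm (\<Sum>i<n. \<epsilon> i e *\<^sub>R D i \<omega>))\<^sup>2) \<partial>P) \<partial>M)"
    by (rule PM.Fubini'[symmetric]) measurable
  also have "\<dots> \<le> (\<integral>\<^sup>+\<omega>. ennreal (C * (\<Sum>i<n. (norm (D i \<omega>))\<^sup>2)) \<partial>M)"
    by (rule nn_integral_mono) (rule C)
  also have "\<dots> = (\<integral>\<^sup>+\<omega>. ennreal C * (\<Sum>i<n. ennreal ((norm (D i \<omega>))\<^sup>2)) \<partial>M)"
    by (intro nn_integral_cong) (simp add: ennreal_mult C sum_nonneg sum_ennreal)
  also have "\<dots> = ennreal C * (\<Sum>i<n. \<integral>\<^sup>+\<omega>. ennreal ((norm (D i \<omega>))\<^sup>2) \<partial>M)"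
  proof -
    have "(\<integral>\<^sup>+\<omega>. (\<Sum>i<n. ennreal ((norm (D i \<omega>))\<^sup>2)) \<partial>M) = (\<Sum>i<n. \<integral>\<^sup>+\<omega>. ennreal ((norm (D i \<omega>))\<^sup>2) \<partial>M)"
      by (rule nn_integral_sum) (simp add: Dsq)
    then show ?thesis by (subst nn_integral_cmult) (auto simp del: sum_ennreal intro!: borel_measurable_sum Dsq)
  qed
  finally show ?thesis .
qed

lemma (in prob_space) norm_integral_sq_le:
  fixes f :: "'a \<Rightarrow> 'v::{banach, second_countable_topology}"
  assumes f: "integrable M f"
  shows "ennreal ((norm (\<integral>\<omega>. f \<omega> \<partial>M))\<^sup>2) \<le> (\<integral>\<^sup>+\<omega>. ennreal ((norm (f \<omega>))\<^sup>2) \<partial>M)"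
proof (cases "integrable M (\<lambda>\<omega>. (norm (f \<omega>))\<^sup>2)")
  case True
  have "norm (\<integral>\<omega>. f \<omega> \<partial>M) \<le> (\<integral>\<omega>. norm (f \<omega>) \<partial>M)" by (rule integral_norm_bound)
  then have "(norm (\<integral>\<omega>. f \<omega> \<partial>M))\<^sup>2 \<le> (\<integral>\<omega>. norm (f \<omega>) \<partial>M)\<^sup>2" by (rule power_mono) simp
  also have "\<dots> \<le> (\<integral>\<omega>. (norm (f \<omega>))\<^sup>2 \<partial>M)"
    using variance_positive[of "\<lambda>\<omega>. norm (f \<omega>)"] variance_eq[of "\<lambda>\<omega>. norm (f \<omega>)"] f True by simp
  finally show ?thesis by (simp add: nn_integral_eq_integral[OF True] ennreal_leI)
next
  case False
  then have "(\<integral>\<^sup>+\<omega>. ennreal ((norm (f \<omega>))\<^sup>2) \<partial>M) = \<infinity>"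
    using borel_measurable_integrable[OF f] by (simp add: integrable_iff_bounded less_top[symmetric])
  then show ?thesis by simp
qed

text \<open>An independent centered summand can only increase the second moment, because it averages
  out to zero (Jensen's inequality).\<close>

lemma (in prob_space) second_moment_le_diff:
  fixes A B :: "'a \<Rightarrow> 'v::{banach, second_countable_topology}"
  assumes ind: "indep_var borel A borel B" and B: "integrable M B" "(\<integral>\<omega>. B \<omega> \<partial>M) = 0"
  shows "(\<integral>\<^sup>+\<omega>. ennreal ((norm (A \<omega>))\<^sup>2) \<partial>M) \<le> (\<integral>\<^sup>+\<omega>. ennreal ((norm (A \<omega> - B \<omega>))\<^sup>2) \<partial>M)"
proof -
  have [measurable]: "A \<in> borel_measurable M" "B \<in> borel_measurable M"
    using indep_var_rv1[OF ind] indep_var_rv2[OF ind] by auto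
  interpret LB: prob_space "distr M borel B" by (rule prob_space_distr) simp
  have eq: "distr M (borel \<Otimes>\<^sub>M borel) (\<lambda>\<omega>. (A \<omega>, B \<omega>)) = distr M borel A \<Otimes>\<^sub>M distr M borel B"
    using ind by (simp add: indep_var_distribution_eq)
  have "(\<integral>\<^sup>+\<omega>. ennreal ((norm (A \<omega>))\<^sup>2) \<partial>M) \<le> (\<integral>\<^sup>+\<omega>. (\<integral>\<^sup>+b. ennreal ((norm (A \<omega> - b))\<^sup>2) \<partial>distr M borel B) \<partial>M)"
  proof (rule nn_integral_mono)
    fix \<omega>
    have "integrable (distr M borel B) (\<lambda>b. A \<omega> - b)" "(\<integral>b. A \<omega> - b \<partial>distr M borel B) = A \<omega>"
      using B LB.prob_space by (simp_all add: integrable_distr_eq integral_distr)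
    then show "ennreal ((norm (A \<omega>))\<^sup>2) \<le> (\<integral>\<^sup>+b. ennreal ((norm (A \<omega> - b))\<^sup>2) \<partial>distr M borel B)"
      using LB.norm_integral_sq_le[of "\<lambda>b. A \<omega> - b"] by simp
  qed
  also have "\<dots> = (\<integral>\<^sup>+a. (\<integral>\<^sup>+b. ennreal ((norm (a - b))\<^sup>2) \<partial>distr M borel B) \<partial>distr M borel A)"
    by (rule nn_integral_distr[symmetric]) measurable
  also have "\<dots> = (\<integral>\<^sup>+x. ennreal ((norm (fst x - snd x))\<^sup>2) \<partial>(distr M borel A \<Otimes>\<^sub>M distr M borel B))"
    by (subst LB.nn_integral_fst[symmetric]) (auto simp: borel_prod)
  also have "\<dots> = (\<integral>\<^sup>+\<omega>. ennreal ((norm (A \<omega> - B \<omega>))\<^sup>2) \<partial>M)"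
    unfolding eq[symmetric] by (subst nn_integral_distr)
      (auto simp: borel_prod intro!: borel_measurable_continuous_onI continuous_intros)
  finally show ?thesis .
qed

lemma norm_diff_sq_le: "(norm (a - b :: 'v::real_normed_vector))\<^sup>2 \<le> 2 * (norm a)\<^sup>2 + 2 * (norm b)\<^sup>2"
proof -
  have "(norm (a - b))\<^sup>2 \<le> (norm a + norm b)\<^sup>2" by (rule power_mono) (auto intro: norm_triangle_ineq4)
  then show ?thesis using sum_squares_bound[of "norm a" "norm b"] by (simp add: power2_sum)
qed

text \<open>Symmetrization.  The independent copy of \<open>Z 0, \<dots>, Z (n - 1)\<close> is the next block
  \<open>Z n, \<dots>, Z (2 * n - 1)\<close> of the same sequence; subtracting it makes the summands symmetric and at most
  quadruples their second moments.\<close>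

lemma (in prob_space) iid_sum_bound:
  fixes Z :: "nat \<Rightarrow> 'a \<Rightarrow> 'v::{banach, second_countable_topology}"
  assumes R: "rademacher P \<epsilon>" and C: "0 \<le> C" "\<And>n (x :: nat \<Rightarrow> 'v). 
      (\<integral>\<^sup>+\<omega>. ennreal ((norm (\<Sum>i<n. \<epsilon> i \<omega> *\<^sub>R x i))\<^sup>2) \<partial>P) \<le> ennreal (C * (\<Sum>i<n. (norm (x i))\<^sup>2))"
    and ind: "indep_vars (\<lambda>_. borel) Z UNIV"
    and law: "\<And>i. distr M borel (Z i) = \<mu>"
    and int: "integrable \<mu> (\<lambda>x. x)" and mean: "(\<integral>x. x \<partial>\<mu>) = 0"
  shows "(\<integral>\<^sup>+\<omega>. ennreal ((norm (\<Sum>i<n. Z i \<omega>))\<^sup>2) \<partial>M)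
    \<le> ennreal (4 * C * real n) * (\<integral>\<^sup>+x. ennreal ((norm x)\<^sup>2) \<partial>\<mu>)"
proof -
  have Z[measurable]: "Z i \<in> borel_measurable M" for i using ind by (auto simp: indep_vars_def)
  have Zint: "integrable M (Z i)" "(\<integral>\<omega>. Z i \<omega> \<partial>M) = 0" for i
    using int mean unfolding law[of i, symmetric] by (simp_all add: integrable_distr_eq integral_distr)
  have Zsq: "(\<integral>\<^sup>+\<omega>. ennreal ((norm (Z i \<omega>))\<^sup>2) \<partial>M) = (\<integral>\<^sup>+x. ennreal ((norm x)\<^sup>2) \<partial>\<mu>)" for i
    unfolding law[of i, symmetric] by (subst nn_integral_distr) auto
  let ?A = "\<lambda>\<omega>. \<Sum>i<n. Z i \<omega>" and ?B = "\<lambda>\<omega>. \<Sum>i<n. Z (n + i) \<omega>" and ?D = "\<lambda>i \<omega>. Z i \<omega> - Z (n + i) \<omega>"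
  have sum_meas: "(\<lambda>\<omega>. \<Sum>i<n. \<omega> (g i)) \<in> borel_measurable (PiM J (\<lambda>_. borel :: 'v measure))" if "g ` {..<n} \<subseteq> J" for g J
    using that by (intro borel_measurable_sum measurable_component_singleton) auto
  have "indep_var borel ((\<lambda>x. \<Sum>i<n. x i) \<circ> (\<lambda>\<omega>. restrict (\<lambda>i. Z i \<omega>) {..<n}))
      borel ((\<lambda>x. \<Sum>i<n. x (n + i)) \<circ> (\<lambda>\<omega>. restrict (\<lambda>i. Z i \<omega>) {n..<2 * n}))"
    by (rule indep_var_compose[OF indep_var_restrict[OF ind] sum_meas sum_meas]) auto
  moreover have "(\<lambda>x. \<Sum>i<n. x i) \<circ> (\<lambda>\<omega>. restrict (\<lambda>i. Z i \<omega>) {..<n}) = ?A"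
    "(\<lambda>x. \<Sum>i<n. x (n + i)) \<circ> (\<lambda>\<omega>. restrict (\<lambda>i. Z i \<omega>) {n..<2 * n}) = ?B"
    by (auto simp: fun_eq_iff)
  ultimately have indAB: "indep_var borel ?A borel ?B" by simp
  have "(\<integral>\<^sup>+\<omega>. ennreal ((norm (?A \<omega>))\<^sup>2) \<partial>M) \<le> (\<integral>\<^sup>+\<omega>. ennreal ((norm (?A \<omega> - ?B \<omega>))\<^sup>2) \<partial>M)"
    by (rule second_moment_le_diff[OF indAB]) (auto simp: Zint)
  also have "\<dots> = (\<integral>\<^sup>+\<omega>. ennreal ((norm (\<Sum>i<n. ?D i \<omega>))\<^sup>2) \<partial>M)"
    by (simp add: sum_subtractf)
  also have "\<dots> \<le> ennreal C * (\<Sum>i<n. \<integral>\<^sup>+\<omega>. ennreal ((norm (?D i \<omega>))\<^sup>2) \<partial>M)"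
  proof (rule symmetric_sum_bound[OF R C])
    have "indep_vars (\<lambda>j. PiM {j, n + j} (\<lambda>_. borel)) (\<lambda>j \<omega>. restrict (\<lambda>i. Z i \<omega>) {j, n + j}) {..<n}"
      by (rule indep_vars_restrict[OF ind]) (auto simp: disjoint_family_on_def)
    then have "indep_vars (\<lambda>_. borel) (\<lambda>j \<omega>. (\<lambda>x. x j - x (n + j)) (restrict (\<lambda>i. Z i \<omega>) {j, n + j})) {..<n}"
      by (rule indep_vars_compose2) (intro borel_measurable_diff measurable_component_singleton; simp)
    then show "indep_vars (\<lambda>_. borel) ?D {..<n}" by simp
    fix i assume "i < n"
    then have "indep_var borel ((\<lambda>x. x i) \<circ> (\<lambda>\<omega>. restrict (\<lambda>i. Z i \<omega>) {i}))
      borel ((\<lambda>x. x (n + i)) \<circ> (\<lambda>\<omega>. restrict (\<lambda>i. Z i \<omega>) {n + i}))"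
      by (intro indep_var_compose[OF indep_var_restrict[OF ind]] measurable_component_singleton) auto
    then have "indep_var borel (Z i) borel (Z (n + i))" by (simp add: comp_def)
    then have pair: "distr M borel (\<lambda>\<omega>. (Z i \<omega>, Z (n + i) \<omega>)) = \<mu> \<Otimes>\<^sub>M \<mu>"
      by (simp add: indep_var_distribution_eq law borel_prod)
    have "prob_space \<mu>" unfolding law[of 0, symmetric] by (rule prob_space_distr) simp
    then interpret \<mu>: prob_space \<mu> .
    interpret \<mu>\<mu>: pair_sigma_finite \<mu> \<mu> ..
    have s: "sets \<mu> = sets borel" using law[of 0] by auto
    have s2: "sets (\<mu> \<Otimes>\<^sub>M \<mu>) = sets borel" by (simp add: borel_prod[symmetric] s cong: sets_pair_measure_cong)
    have "distr M borel (?D i) = distr (\<mu> \<Otimes>\<^sub>M \<mu>) borel (\<lambda>x. fst x - snd x)"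
      unfolding pair[symmetric]
      by (subst distr_distr) (auto simp: comp_def intro!: borel_measurable_continuous_onI continuous_intros)
    also have "\<dots> = distr (distr (\<mu> \<Otimes>\<^sub>M \<mu>) (\<mu> \<Otimes>\<^sub>M \<mu>) (\<lambda>(x, y). (y, x))) borel (\<lambda>x. fst x - snd x)"
      using \<mu>\<mu>.distr_pair_swap by simp
    also have "\<dots> = distr (\<mu> \<Otimes>\<^sub>M \<mu>) borel (\<lambda>x. - (fst x - snd x))"
    proof (subst distr_distr)
      show "(\<lambda>x. fst x - snd x) \<in> borel_measurable (\<mu> \<Otimes>\<^sub>M \<mu>)"
        unfolding measurable_cong_sets[OF s2 refl]
        by (intro borel_measurable_continuous_onI continuous_intros)
    qed (auto simp: comp_def case_prod_beta)
    also have "\<dots> = distr M borel (\<lambda>\<omega>. - ?D i \<omega>)"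
      unfolding pair[symmetric]
      by (subst distr_distr) (auto simp: comp_def intro!: borel_measurable_continuous_onI continuous_intros)
    finally show "distr M borel (\<lambda>\<omega>. - ?D i \<omega>) = distr M borel (?D i)" by simp
  qed
  also have "\<dots> \<le> ennreal C * (\<Sum>i<n. 4 * (\<integral>\<^sup>+x. ennreal ((norm x)\<^sup>2) \<partial>\<mu>))"
  proof (intro mult_left_mono sum_mono)
    fix i
    have "(\<integral>\<^sup>+\<omega>. ennreal ((norm (?D i \<omega>))\<^sup>2) \<partial>M)
        \<le> (\<integral>\<^sup>+\<omega>. 2 * ennreal ((norm (Z i \<omega>))\<^sup>2) + 2 * ennreal ((norm (Z (n + i) \<omega>))\<^sup>2) \<partial>M)"
    proof (rule nn_integral_mono)
      fix \<omega>
      have "ennreal ((norm (?D i \<omega>))\<^sup>2) \<le> ennreal (2 * (norm (Z i \<omega>))\<^sup>2 + 2 * (norm (Z (n + i) \<omega>))\<^sup>2)"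
        by (rule ennreal_leI[OF norm_diff_sq_le])
      then show "ennreal ((norm (?D i \<omega>))\<^sup>2) \<le> 2 * ennreal ((norm (Z i \<omega>))\<^sup>2) + 2 * ennreal ((norm (Z (n + i) \<omega>))\<^sup>2)"
        by (simp add: ennreal_mult)
    qed
    also have "\<dots> = 2 * (\<integral>\<^sup>+x. ennreal ((norm x)\<^sup>2) \<partial>\<mu>) + 2 * (\<integral>\<^sup>+x. ennreal ((norm x)\<^sup>2) \<partial>\<mu>)"
      by (subst nn_integral_add) (auto simp: nn_integral_cmult Zsq)
    also have "\<dots> = 4 * (\<integral>\<^sup>+x. ennreal ((norm x)\<^sup>2) \<partial>\<mu>)"
      by (simp add: distrib_right[symmetric])
    finally show "(\<integral>\<^sup>+\<omega>. ennreal ((norm (?D i \<omega>))\<^sup>2) \<partial>M) \<le> 4 * (\<integral>\<^sup>+x. ennreal ((norm x)\<^sup>2) \<partial>\<mu>)" .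
  qed simp
  also have "\<dots> = ennreal (4 * C * real n) * (\<integral>\<^sup>+x. ennreal ((norm x)\<^sup>2) \<partial>\<mu>)"
    using C(1) by (simp add: ennreal_mult ennreal_of_nat_eq_real_of_nat mult_ac)
  finally show ?thesis .
qed

lemma (in prob_space) type_2_iid_sum_bound:
  assumes "type_2 TYPE('v::{banach, second_countable_topology})"
  obtains K where "0 \<le> K"
    "\<And>(Z :: nat \<Rightarrow> 'a \<Rightarrow> 'v) \<mu> n. indep_vars (\<lambda>_. borel) Z UNIV \<Longrightarrow> (\<And>i. distr M borel (Z i) = \<mu>) \<Longrightarrow>
      integrable \<mu> (\<lambda>x. x) \<Longrightarrow> (\<integral>x. x \<partial>\<mu>) = 0 \<Longrightarrow>
      (\<integral>\<^sup>+\<omega>. ennreal ((norm (\<Sum>i<n. Z i \<omega>))\<^sup>2) \<partial>M) \<le> ennreal (K * real n) * (\<integral>\<^sup>+x. ennreal ((norm x)\<^sup>2) \<partial>\<mu>)"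
proof -
  obtain P :: "(nat \<Rightarrow> real) measure" and \<epsilon> C where R: "rademacher P \<epsilon>" "0 \<le> C"
    "\<And>n (x :: nat \<Rightarrow> 'v). (\<integral>\<^sup>+\<omega>. ennreal ((norm (\<Sum>i<n. \<epsilon> i \<omega> *\<^sub>R x i))\<^sup>2) \<partial>P) \<le> ennreal (C * (\<Sum>i<n. (norm (x i))\<^sup>2))"
    using type_2_nn[OF assms] by blast
  show ?thesis
    by (rule that[of "4 * C"]) (use R in \<open>auto intro: iid_sum_bound\<close>)
qed

lemma nn_integral_le_of_tendsto:
  fixes g :: "nat \<Rightarrow> 'a \<Rightarrow> ennreal"
  assumes g: "\<And>k. g k \<in> borel_measurable M" and lim: "AE x in M. (\<lambda>k. g k x) \<longlonglongrightarrow> h x"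
    and le: "\<forall>\<^sub>F k in sequentially. (\<integral>\<^sup>+x. g k x \<partial>M) \<le> B"
  shows "(\<integral>\<^sup>+x. h x \<partial>M) \<le> B"
proof -
  have "(\<integral>\<^sup>+x. h x \<partial>M) = (\<integral>\<^sup>+x. liminf (\<lambda>k. g k x) \<partial>M)"
    using lim by (intro nn_integral_cong_AE) (auto elim!: eventually_mono simp: lim_imp_Liminf)
  also have "\<dots> \<le> liminf (\<lambda>k. \<integral>\<^sup>+x. g k x \<partial>M)" by (rule nn_integral_liminf[OF g])
  also have "\<dots> \<le> B" using le by (intro Liminf_le) auto
  finally show ?thesis .
qed

lemma (in prob_space) second_moment_bound_imp_integrable:
  fixes f :: "'a \<Rightarrow> 'v::{banach, second_countable_topology}"
  assumes f[measurable]: "f \<in> borel_measurable M" and le: "(\<integral>\<^sup>+\<omega>. ennreal ((norm (f \<omega>))\<^sup>2) \<partial>M) \<le> ennreal b"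
    and b: "0 \<le> b"
  shows "integrable M f" "(\<integral>\<omega>. norm (f \<omega>) \<partial>M) \<le> sqrt b"
proof -
  have "integrable M (\<lambda>\<omega>. (norm (f \<omega>))\<^sup>2)"
    using le by (intro integrableI_bounded) (auto simp: le_less_trans)
  then have i: "integrable M (\<lambda>\<omega>. norm (f \<omega>))"
    by (rule square_integrable_imp_integrable[rotated]) simp
  then show "integrable M f" by (simp add: integrable_norm_iff)
  have "ennreal ((\<integral>\<omega>. norm (f \<omega>) \<partial>M)\<^sup>2) \<le> (\<integral>\<^sup>+\<omega>. ennreal ((norm (f \<omega>))\<^sup>2) \<partial>M)"
    using norm_integral_sq_le[OF i] by simp
  then have "(\<integral>\<omega>. norm (f \<omega>) \<partial>M)\<^sup>2 \<le> b" using le b by (metis ennreal_le_iff order_trans)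
  then show "(\<integral>\<omega>. norm (f \<omega>) \<partial>M) \<le> sqrt b" by (rule real_le_rsqrt)
qed

lemma integrable_prod_of_sq:
  fixes f g :: "'b \<Rightarrow> real"
  assumes [measurable]: "f \<in> borel_measurable L" "g \<in> borel_measurable L"
    and "integrable L (\<lambda>x. (f x)\<^sup>2)" "integrable L (\<lambda>x. (g x)\<^sup>2)"
  shows "integrable L (\<lambda>x. f x * g x)"
proof (rule Bochner_Integration.integrable_bound)
  show "integrable L (\<lambda>x. (f x)\<^sup>2 + (g x)\<^sup>2)" using assms by simp
  show "AE x in L. norm (f x * g x) \<le> norm ((f x)\<^sup>2 + (g x)\<^sup>2)"
  proof (rule AE_I2)
    fix x
    have "2 * (\<bar>f x\<bar> * \<bar>g x\<bar>) \<le> (f x)\<^sup>2 + (g x)\<^sup>2"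
      using sum_squares_bound[of "\<bar>f x\<bar>" "\<bar>g x\<bar>"] by simp
    moreover have "0 \<le> \<bar>f x\<bar> * \<bar>g x\<bar>" by simp
    ultimately have "\<bar>f x\<bar> * \<bar>g x\<bar> \<le> (f x)\<^sup>2 + (g x)\<^sup>2" by linarith
    then show "norm (f x * g x) \<le> norm ((f x)\<^sup>2 + (g x)\<^sup>2)" by (simp add: abs_mult)
  qed
qed measurable

section \<open>Convergence of joint characteristic functions\<close>

text \<open>Integrals of trigonometric polynomials are linear combinations of real and imaginary parts of characteristic
  functions, so their convergence is what convergence of characteristic functions provides directly.  Only the coordinates below
  \<open>m\<close> enter.\<close>

inductive trig_poly :: "nat \<Rightarrow> ((nat \<Rightarrow> real) \<Rightarrow> real) \<Rightarrow> bool" for m where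
  trig_cos: "trig_poly m (\<lambda>t. cos (\<Sum>i<m. \<theta> i * t i))"
| trig_sin: "trig_poly m (\<lambda>t. sin (\<Sum>i<m. \<theta> i * t i))"
| trig_add: "trig_poly m f \<Longrightarrow> trig_poly m g \<Longrightarrow> trig_poly m (\<lambda>t. f t + g t)"
| trig_scale: "trig_poly m f \<Longrightarrow> trig_poly m (\<lambda>t. c * f t)"

lemma trig_const: "trig_poly m (\<lambda>_. c)"
  using trig_scale[OF trig_cos[of m "\<lambda>_. 0"], of c] by simp

text \<open>Products reduce to sums by the addition theorems for sine and cosine, so trigonometric polynomials form an
  algebra, as the Stone-Weierstrass theorem requires.\<close>

lemma trig_mult:
  assumes "trig_poly m f" "trig_poly m g"
  shows "trig_poly m (\<lambda>t. f t * g t)"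
proof -
  have sums: "(\<Sum>i<m. \<theta> i * t i) + (\<Sum>i<m. \<eta> i * t i) = (\<Sum>i<m. (\<theta> i + \<eta> i) * t i)"
    "(\<Sum>i<m. \<theta> i * t i) - (\<Sum>i<m. \<eta> i * t i) = (\<Sum>i<m. (\<theta> i - \<eta> i) * t i)" for \<theta> \<eta> t :: "nat \<Rightarrow> real"
    by (simp_all add: sum.distrib sum_subtractf algebra_simps)
  have half: "trig_poly m (\<lambda>t. (p t + q t) / 2)" "trig_poly m (\<lambda>t. (p t - q t) / 2)"
    if "trig_poly m p" "trig_poly m q" for p q
    using trig_scale[OF trig_add[OF that], of "1 / 2"]
      trig_scale[OF trig_add[OF that(1) trig_scale[OF that(2), of "- 1"]], of "1 / 2"] by simp_all
  have cos: "trig_poly m (\<lambda>t. cos (\<Sum>i<m. \<theta> i * t i) * g t)" for \<theta>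
    using assms(2)
  proof induction
    case (trig_cos \<eta>)
    show ?case unfolding cos_times_cos sums by (intro half trig_poly.trig_cos)
  next
    case (trig_sin \<eta>)
    show ?case unfolding cos_times_sin sums by (intro half trig_poly.trig_sin)
  next
    case (trig_add f g)
    then show ?case unfolding distrib_left by (intro trig_poly.trig_add)
  next
    case (trig_scale f c)
    then show ?case using trig_poly.trig_scale[of m _ c] by (simp add: mult.left_commute)
  qed
  have sin: "trig_poly m (\<lambda>t. sin (\<Sum>i<m. \<theta> i * t i) * g t)" for \<theta>
    using assms(2)
  proof induction
    case (trig_cos \<eta>)
    show ?case unfolding sin_times_cos sums by (intro half trig_poly.trig_sin)
  next
    case (trig_sin \<eta>)
    show ?case unfolding sin_times_sin sums by (intro half trig_poly.trig_cos)
  next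
    case (trig_add f g)
    then show ?case unfolding distrib_left by (intro trig_poly.trig_add)
  next
    case (trig_scale f c)
    then show ?case using trig_poly.trig_scale[of m _ c] by (simp add: mult.left_commute)
  qed
  show ?thesis
    using assms(1)
  proof induction
    case (trig_add f g)
    then show ?case unfolding distrib_right by (intro trig_poly.trig_add)
  next
    case (trig_scale f c)
    then show ?case using trig_poly.trig_scale[of m _ c] by (simp add: mult.assoc)
  qed (rule cos sin)+
qed

text \<open>The substitution \<open>s i = sin (t i / K)\<close> maps \<open>nat \<Rightarrow> real\<close> to a compact cube, turns polynomials
  into trigonometric polynomials and is inverted by \<open>arcsin\<close> where \<open>\<bar>t i\<bar> \<le> K\<close>.  The
  Stone-Weierstrass theorem on the cube thus yields approximations that stay bounded everywhere.\<close>

lemma trig_approx_on_box: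
  fixes F :: "(nat \<Rightarrow> real) \<Rightarrow> real"
  assumes cont: "continuous_on UNIV F" and bd: "\<And>t. \<bar>F t\<bar> \<le> B"
    and dep: "\<And>s t. (\<And>i. i < m \<Longrightarrow> s i = t i) \<Longrightarrow> F s = F t"
    and "0 < e" "0 < K"
  shows "\<exists>h. trig_poly m h \<and> (\<forall>t. (\<forall>i<m. \<bar>t i\<bar> \<le> K) \<longrightarrow> \<bar>F t - h t\<bar> < e) \<and> (\<forall>t. \<bar>h t\<bar> \<le> B + e)"
proof -
  define S :: "(nat \<Rightarrow> real) set" where "S = PiE UNIV (\<lambda>i. if i < m then {- 1..1} else {0})"
  define \<rho> where "\<rho> t = (\<lambda>i. if i < m then sin (t i / K) else 0)" for t :: "nat \<Rightarrow> real"
  define R where "R = {p. continuous_on S p \<and> trig_poly m (\<lambda>t. p (\<rho> t))}"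
  define H where "H s = F (\<lambda>i. K * arcsin (s i))" for s :: "nat \<Rightarrow> real"
  have S_bd: "- 1 \<le> s i \<and> s i \<le> 1" if "s \<in> S" for s i
    using that by (auto simp: S_def PiE_iff split: if_splits dest!: spec[of _ i])
  have \<rho>S: "\<rho> t \<in> S" for t by (auto simp: \<rho>_def S_def)
  have "compactin (product_topology (\<lambda>_. euclidean) UNIV) S"
    unfolding S_def by (subst compactin_PiE) auto
  then have "compact S" by (simp add: euclidean_product_topology)
  have "function_ring_on R S"
  proof
    show "compact S" by fact
    show "\<exists>f\<in>R. f x \<noteq> f y" if "x \<in> S" "y \<in> S" "x \<noteq> y" for x y
    proof -
      obtain i where i: "x i \<noteq> y i" using \<open>x \<noteq> y\<close> by auto
      have "i < m"
      proof (rule ccontr)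
        assume "\<not> i < m"
        moreover have "x i \<in> (if i < m then {- 1..1} else {0})" "y i \<in> (if i < m then {- 1..1} else {0})"
          using that unfolding S_def by (auto simp: PiE_iff)
        ultimately show False using i by simp
      qed
      have "(\<Sum>j<m. (if j = i then 1 / K else 0) * t j) = t i / K" for t
        using \<open>i < m\<close> by (simp add: if_distrib[of "\<lambda>c. c * _"] cong: if_cong)
      then have "trig_poly m (\<lambda>t. \<rho> t i)"
        using trig_sin[of m "\<lambda>j. if j = i then 1 / K else 0"] \<open>i < m\<close> by (simp add: \<rho>_def)
      then have "(\<lambda>s. s i) \<in> R"
        by (simp add: R_def continuous_on_subset[OF continuous_on_product_coordinates])
      then show ?thesis using i by (intro bexI[of _ "\<lambda>s. s i"])
    qed
  qed (auto simp: R_def intro: continuous_intros trig_add trig_mult trig_const)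
  moreover have "continuous_on S H"
    unfolding H_def
  proof (rule continuous_on_compose2[OF cont])
    show "continuous_on S (\<lambda>s i. K * arcsin (s i))"
    proof (rule continuous_on_coordinatewise_then_product)
      show "continuous_on S (\<lambda>s. K * arcsin (s i))" for i
        by (intro continuous_intros continuous_on_subset[OF continuous_on_product_coordinates])
          (auto dest: S_bd)
    qed
  qed simp
  ultimately obtain p where p: "p \<in> R" "\<And>s. s \<in> S \<Longrightarrow> \<bar>H s - p s\<bar> < e"
    using function_ring_on.Stone_Weierstrass_basic[of R S H e] \<open>0 < e\<close> by blast
  have "\<bar>F t - p (\<rho> t)\<bar> < e" if t: "\<forall>i<m. \<bar>t i\<bar> \<le> K" for t
  proof -
    have "K * arcsin (sin (t i / K)) = t i" if "i < m" for i
    proof -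
      have "\<bar>t i / K\<bar> \<le> 1" using t that \<open>0 < K\<close> by (auto simp: abs_divide)
      then have "arcsin (sin (t i / K)) = t i / K"
        using pi_gt3 by (intro arcsin_sin) linarith+
      then show ?thesis using \<open>0 < K\<close> by simp
    qed
    then have "H (\<rho> t) = F t" unfolding H_def by (intro dep) (simp add: \<rho>_def)
    then show ?thesis using p(2)[OF \<rho>S, of t] by simp
  qed
  moreover have "\<bar>p (\<rho> t)\<bar> \<le> B + e" for t
    using p(2)[OF \<rho>S, of t] bd[of "\<lambda>i. K * arcsin (\<rho> t i)"] unfolding H_def by linarith
  ultimately show ?thesis using p(1) unfolding R_def by blast
qed

text \<open>Outside the cube of side \<open>2 * K\<close> the sum of squares exceeds \<open>K\<^sup>2\<close>, so for large \<open>K\<close> it absorbs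
  the bounded error there.  In this form the error is controlled by second moments.\<close>

lemma trig_approx:
  fixes F :: "(nat \<Rightarrow> real) \<Rightarrow> real"
  assumes cont: "continuous_on UNIV F" and bd: "\<And>t. \<bar>F t\<bar> \<le> B"
    and dep: "\<And>s t. (\<And>i. i < m \<Longrightarrow> s i = t i) \<Longrightarrow> F s = F t"
    and e: "0 < e"
  shows "\<exists>h. trig_poly m h \<and> (\<forall>t. \<bar>F t - h t\<bar> \<le> e * (1 + (\<Sum>i<m. (t i)\<^sup>2)))"
proof -
  have B: "0 \<le> B" using bd[of undefined] by linarith
  (* The error off the cube is at most 2 * B + e, and this K makes e * K\<^sup>2 equal to that bound. *)
  define K where "K = sqrt ((2 * B + e) / e)"
  have K: "0 < K" "e * K\<^sup>2 = 2 * B + e" unfolding K_def using B e by (auto intro: divide_pos_pos)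
  obtain h where h: "trig_poly m h" "\<And>t. (\<forall>i<m. \<bar>t i\<bar> \<le> K) \<Longrightarrow> \<bar>F t - h t\<bar> < e" "\<And>t. \<bar>h t\<bar> \<le> B + e"
    using trig_approx_on_box[OF cont bd dep e K(1)] by blast
  have "\<bar>F t - h t\<bar> \<le> e * (1 + (\<Sum>i<m. (t i)\<^sup>2))" for t
  proof (cases "\<forall>i<m. \<bar>t i\<bar> \<le> K")
    case True
    then have "\<bar>F t - h t\<bar> \<le> e * 1" using h(2) by (simp add: less_imp_le)
    also have "\<dots> \<le> e * (1 + (\<Sum>i<m. (t i)\<^sup>2))" using e by (intro mult_left_mono) (auto simp: sum_nonneg)
    finally show ?thesis .
  next
    case False
    then obtain i where i: "i < m" "K < \<bar>t i\<bar>" by auto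
    have "\<bar>F t - h t\<bar> \<le> 2 * B + e" using bd[of t] h(3)[of t] by linarith
    also have "\<dots> = e * K\<^sup>2" using K by simp
    also have "\<dots> \<le> e * (t i)\<^sup>2" using i K e by (intro mult_left_mono) (auto simp: abs_le_square_iff[symmetric])
    also have "\<dots> \<le> e * (1 + (\<Sum>i<m. (t i)\<^sup>2))"
      using e i member_le_sum[of i "{..<m}" "\<lambda>i. (t i)\<^sup>2"] by (intro mult_left_mono) auto
    finally show ?thesis .
  qed
  then show ?thesis using h(1) by blast
qed

lemma trig_poly_integral_convergence:
  fixes T :: "nat \<Rightarrow> nat \<Rightarrow> 'a \<Rightarrow> real" and S :: "nat \<Rightarrow> 'b \<Rightarrow> real"
  assumes M: "prob_space M" and Q: "prob_space Q"
    and T[measurable]: "\<And>n i. T n i \<in> borel_measurable M" and S[measurable]: "\<And>i. S i \<in> borel_measurable Q"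
    and conv: "\<And>\<theta>. (\<lambda>n. \<integral>\<omega>. iexp (\<Sum>i<m. \<theta> i * T n i \<omega>) \<partial>M) \<longlonglongrightarrow> (\<integral>\<omega>. iexp (\<Sum>i<m. \<theta> i * S i \<omega>) \<partial>Q)"
    and h: "trig_poly m h"
  shows "(\<forall>n. integrable M (\<lambda>\<omega>. h (\<lambda>i. T n i \<omega>))) \<and> integrable Q (\<lambda>\<omega>. h (\<lambda>i. S i \<omega>)) \<and>
    (\<lambda>n. \<integral>\<omega>. h (\<lambda>i. T n i \<omega>) \<partial>M) \<longlonglongrightarrow> (\<integral>\<omega>. h (\<lambda>i. S i \<omega>) \<partial>Q)"
proof -
  interpret M: prob_space M by fact
  interpret Q: prob_space Q by fact
  have iM: "integrable M (\<lambda>\<omega>. iexp (\<Sum>i<m. \<theta> i * T n i \<omega>))" for \<theta> n by (rule M.integrable_iexp) auto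
  have iQ: "integrable Q (\<lambda>\<omega>. iexp (\<Sum>i<m. \<theta> i * S i \<omega>))" for \<theta> by (rule Q.integrable_iexp) auto
  show ?thesis
    using h
  proof induction
    case (trig_cos \<theta>)
    have "cos x = Re (iexp x)" for x by (simp add: Re_exp)
    then show ?case
      using iM[of \<theta>] iQ[of \<theta>] tendsto_Re[OF conv[of \<theta>]] by (simp only: integrable_Re integral_Re) simp
  next
    case (trig_sin \<theta>)
    have "sin x = Im (iexp x)" for x by (simp add: Im_exp)
    then show ?case
      using iM[of \<theta>] iQ[of \<theta>] tendsto_Im[OF conv[of \<theta>]] by (simp only: integrable_Im integral_Im) simp
  next
    case (trig_add f g)
    then show ?case by (auto intro: tendsto_add)
  next
    case (trig_scale f c)
    then show ?case by (auto intro: tendsto_mult_left)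
  qed
qed

lemma (in prob_space) trig_approx_error:
  fixes T :: "nat \<Rightarrow> 'a \<Rightarrow> real"
  assumes F: "integrable M (\<lambda>\<omega>. F (\<lambda>i. T i \<omega>))" and h: "integrable M (\<lambda>\<omega>. h (\<lambda>i. T i \<omega>))"
    and T: "\<And>i. i < m \<Longrightarrow> integrable M (\<lambda>\<omega>. (T i \<omega>)\<^sup>2)" "(\<Sum>i<m. \<integral>\<omega>. (T i \<omega>)\<^sup>2 \<partial>M) \<le> V"
    and e: "0 \<le> e" "\<And>t. \<bar>F t - h t\<bar> \<le> e * (1 + (\<Sum>i<m. (t i)\<^sup>2))"
  shows "\<bar>(\<integral>\<omega>. F (\<lambda>i. T i \<omega>) \<partial>M) - (\<integral>\<omega>. h (\<lambda>i. T i \<omega>) \<partial>M)\<bar> \<le> e * (1 + V)"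
proof -
  have "\<bar>(\<integral>\<omega>. F (\<lambda>i. T i \<omega>) \<partial>M) - (\<integral>\<omega>. h (\<lambda>i. T i \<omega>) \<partial>M)\<bar> = \<bar>\<integral>\<omega>. F (\<lambda>i. T i \<omega>) - h (\<lambda>i. T i \<omega>) \<partial>M\<bar>"
    using F h by simp
  also have "\<dots> \<le> (\<integral>\<omega>. \<bar>F (\<lambda>i. T i \<omega>) - h (\<lambda>i. T i \<omega>)\<bar> \<partial>M)" by (rule integral_abs_bound)
  also have "\<dots> \<le> (\<integral>\<omega>. e * (1 + (\<Sum>i<m. (T i \<omega>)\<^sup>2)) \<partial>M)"
  proof (intro integral_mono e)
    show "integrable M (\<lambda>\<omega>. e * (1 + (\<Sum>i<m. (T i \<omega>)\<^sup>2)))"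
      using T(1) by (intro integrable_mult_right Bochner_Integration.integrable_add
        Bochner_Integration.integrable_sum) auto
  qed (use F h in auto)
  also have "\<dots> = e * (1 + (\<Sum>i<m. \<integral>\<omega>. (T i \<omega>)\<^sup>2 \<partial>M))"
  proof -
    have "integrable M (\<lambda>\<omega>. \<Sum>i<m. (T i \<omega>)\<^sup>2)"
      using T(1) by (intro Bochner_Integration.integrable_sum) auto
    moreover have "(\<integral>\<omega>. (\<Sum>i<m. (T i \<omega>)\<^sup>2) \<partial>M) = (\<Sum>i<m. \<integral>\<omega>. (T i \<omega>)\<^sup>2 \<partial>M)"
      using T(1) by (intro Bochner_Integration.integral_sum) auto
    ultimately show ?thesis by (simp add: prob_space)
  qed
  also have "\<dots> \<le> e * (1 + V)" using T(2) e by (intro mult_left_mono) auto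
  finally show ?thesis .
qed

text \<open>The test function is replaced by a trigonometric polynomial up to an error controlled by second moments.
  As these are bounded uniformly in \<open>n\<close>, so is the error.\<close>

lemma joint_char_convergence_imp_weak:
  fixes T :: "nat \<Rightarrow> nat \<Rightarrow> 'a \<Rightarrow> real" and S :: "nat \<Rightarrow> 'b \<Rightarrow> real" and F :: "(nat \<Rightarrow> real) \<Rightarrow> real"
  assumes M: "prob_space M" and Q: "prob_space Q"
    and T: "\<And>n i. T n i \<in> borel_measurable M" and S: "\<And>i. S i \<in> borel_measurable Q"
    and conv: "\<And>\<theta>. (\<lambda>n. \<integral>\<omega>. iexp (\<Sum>i<m. \<theta> i * T n i \<omega>) \<partial>M) \<longlonglongrightarrow> (\<integral>\<omega>. iexp (\<Sum>i<m. \<theta> i * S i \<omega>) \<partial>Q)"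
    and T2: "\<And>n i. i < m \<Longrightarrow> integrable M (\<lambda>\<omega>. (T n i \<omega>)\<^sup>2)" "\<And>n. (\<Sum>i<m. \<integral>\<omega>. (T n i \<omega>)\<^sup>2 \<partial>M) \<le> V"
    and S2: "\<And>i. i < m \<Longrightarrow> integrable Q (\<lambda>\<omega>. (S i \<omega>)\<^sup>2)" "(\<Sum>i<m. \<integral>\<omega>. (S i \<omega>)\<^sup>2 \<partial>Q) \<le> V"
    and cont: "continuous_on UNIV F" and bd: "\<And>t. \<bar>F t\<bar> \<le> B"
    and dep: "\<And>s t. (\<And>i. i < m \<Longrightarrow> s i = t i) \<Longrightarrow> F s = F t"
  shows "(\<lambda>n. \<integral>\<omega>. F (\<lambda>i. T n i \<omega>) \<partial>M) \<longlonglongrightarrow> (\<integral>\<omega>. F (\<lambda>i. S i \<omega>) \<partial>Q)"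
proof (rule LIMSEQ_I)
  interpret M: prob_space M by fact
  interpret Q: prob_space Q by fact
  fix r :: real assume r: "0 < r"
  have V: "0 \<le> V" using S2(2) by (rule order_trans[rotated]) (simp add: sum_nonneg)
  define e where "e = r / (4 * (1 + V))"
  have e: "0 < e" "e * (1 + V) = r / 4" unfolding e_def using r V by (auto simp: field_simps)
  obtain h where h: "trig_poly m h" "\<And>t. \<bar>F t - h t\<bar> \<le> e * (1 + (\<Sum>i<m. (t i)\<^sup>2))"
    using trig_approx[OF cont bd dep e(1)] by blast
  note hc = trig_poly_integral_convergence[OF M Q T S conv h(1)]
  have F: "F \<in> borel_measurable borel" by (rule borel_measurable_continuous_onI[OF cont])
  have meas: "(\<lambda>\<omega> i. T n i \<omega>) \<in> borel_measurable M" "(\<lambda>\<omega> i. S i \<omega>) \<in> borel_measurable Q" for n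
    using T S by (auto intro: measurable_coordinatewise_then_product)
  have FM: "integrable M (\<lambda>\<omega>. F (\<lambda>i. T n i \<omega>))" for n
    using bd measurable_compose[OF meas(1) F] by (intro M.integrable_const_bound[of _ B]) auto
  have FQ: "integrable Q (\<lambda>\<omega>. F (\<lambda>i. S i \<omega>))"
    using bd measurable_compose[OF meas(2) F] by (intro Q.integrable_const_bound[of _ B]) auto
  have 1: "\<bar>(\<integral>\<omega>. F (\<lambda>i. T n i \<omega>) \<partial>M) - (\<integral>\<omega>. h (\<lambda>i. T n i \<omega>) \<partial>M)\<bar> \<le> r / 4" for n
    unfolding e(2)[symmetric] using hc e(1)
    by (intro M.trig_approx_error[OF FM _ T2 less_imp_le[OF e(1)] h(2)]) auto
  have 2: "\<bar>(\<integral>\<omega>. F (\<lambda>i. S i \<omega>) \<partial>Q) - (\<integral>\<omega>. h (\<lambda>i. S i \<omega>) \<partial>Q)\<bar> \<le> r / 4"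
    unfolding e(2)[symmetric] using hc e(1)
    by (intro Q.trig_approx_error[OF FQ _ S2 less_imp_le[OF e(1)] h(2)]) auto
  obtain N where N: "\<And>n. N \<le> n \<Longrightarrow> \<bar>(\<integral>\<omega>. h (\<lambda>i. T n i \<omega>) \<partial>M) - (\<integral>\<omega>. h (\<lambda>i. S i \<omega>) \<partial>Q)\<bar> < r / 2"
    using LIMSEQ_D[of "\<lambda>n. \<integral>\<omega>. h (\<lambda>i. T n i \<omega>) \<partial>M" _ "r / 2"] hc r unfolding real_norm_def
    by (metis half_gt_zero)
  have "norm ((\<integral>\<omega>. F (\<lambda>i. T n i \<omega>) \<partial>M) - (\<integral>\<omega>. F (\<lambda>i. S i \<omega>) \<partial>Q)) < r" if "N \<le> n" for n
    using 1[of n] 2 N[OF that] unfolding real_norm_def by linarith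
  then show "\<exists>N. \<forall>n\<ge>N. norm ((\<integral>\<omega>. F (\<lambda>i. T n i \<omega>) \<partial>M) - (\<integral>\<omega>. F (\<lambda>i. S i \<omega>) \<partial>Q)) < r" by blast
qed

text \<open>The real central limit theorem, including the degenerate case of zero variance, where all partial
  sums vanish almost surely.\<close>

lemma (in prob_space) clt_char:
  fixes Z :: "nat \<Rightarrow> 'a \<Rightarrow> real"
  assumes ind: "indep_vars (\<lambda>_. borel) Z UNIV" and law: "\<And>i. distr M borel (Z i) = \<mu>"
    and sq: "integrable \<mu> (\<lambda>x. x\<^sup>2)" and mean: "(\<integral>x. x \<partial>\<mu>) = 0"
  shows "(\<lambda>n. \<integral>\<omega>. iexp ((\<Sum>i<n. Z i \<omega>) / sqrt n) \<partial>M) \<longlonglongrightarrow> complex_of_real (exp (- (\<integral>x. x\<^sup>2 \<partial>\<mu>) / 2))"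
proof -
  have Z[measurable]: "Z i \<in> borel_measurable M" for i using ind by (auto simp: indep_vars_def)
  have Z2: "integrable M (\<lambda>\<omega>. (Z i \<omega>)\<^sup>2)" "expectation (\<lambda>\<omega>. (Z i \<omega>)\<^sup>2) = (\<integral>x. x\<^sup>2 \<partial>\<mu>)"
    "expectation (Z i) = 0" for i
    using sq mean unfolding law[of i, symmetric] by (simp_all add: integrable_distr_eq integral_distr)
  define \<tau> where "\<tau> = sqrt (\<integral>x. x\<^sup>2 \<partial>\<mu>)"
  have \<tau>: "0 \<le> \<tau>" "\<tau>\<^sup>2 = (\<integral>x. x\<^sup>2 \<partial>\<mu>)" by (auto simp: \<tau>_def)
  show ?thesis
  proof (cases "\<tau> = 0")
    case True
    have "AE \<omega> in M. Z i \<omega> = 0" for i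
    proof -
      have "AE \<omega> in M. (Z i \<omega>)\<^sup>2 = 0"
        using Z2[of i] \<tau> True by (subst integral_nonneg_eq_0_iff_AE[symmetric]) auto
      then show ?thesis by simp
    qed
    then have "AE \<omega> in M. \<forall>i. Z i \<omega> = 0" by (simp add: AE_all_countable)
    then have "(\<integral>\<omega>. iexp ((\<Sum>i<n. Z i \<omega>) / sqrt n) \<partial>M) = (\<integral>\<omega>. 1 \<partial>M)" for n
      by (intro integral_cong_AE) auto
    then show ?thesis using \<tau> True by (simp add: prob_space)
  next
    case False
    then have pos: "0 < \<tau>" using \<tau> by simp
    have "weak_conv_m (\<lambda>n. distr M borel (\<lambda>x. (\<Sum>i<n. Z i x) / sqrt (n * \<tau>\<^sup>2))) std_normal_distribution"
      by (rule central_limit_theorem_zero_mean[OF ind _ pos _ _ law]) (simp_all add: Z2 \<tau>)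
    then have "(\<lambda>n. char (distr M borel (\<lambda>x. (\<Sum>i<n. Z i x) / sqrt (n * \<tau>\<^sup>2))) \<tau>) \<longlonglongrightarrow> char std_normal_distribution \<tau>"
      by (intro levy_continuity1 real_dist_normal_dist real_distribution_distr) auto
    moreover have "char (distr M borel (\<lambda>x. (\<Sum>i<n. Z i x) / sqrt (n * \<tau>\<^sup>2))) \<tau>
        = (\<integral>\<omega>. iexp ((\<Sum>i<n. Z i \<omega>) / sqrt n) \<partial>M)" for n
      unfolding char_def using pos by (subst integral_distr) (auto simp: real_sqrt_mult)
    ultimately show ?thesis by (simp add: char_std_normal_distribution \<tau>)
  qed
qed

section \<open>The central limit theorem for finite-rank maps\<close>

text \<open>The bound is assumed for all sequences obtained from \<open>Y\<close> by a Borel map, since it is applied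
  to approximations of \<open>Y\<close> and to their errors.\<close>

locale iid_second_moment_bound = prob_space M
  for M :: "'a measure" and Y :: "nat \<Rightarrow> 'a \<Rightarrow> 'v::{banach, second_countable_topology}"
    and \<mu> :: "'v measure" and K :: real +
  assumes ind: "indep_vars (\<lambda>_. borel) Y UNIV"
    and law: "\<And>i. distr M borel (Y i) = \<mu>"
    and K: "0 \<le> K"
    and sum_bound: "\<And>(F :: 'v \<Rightarrow> 'v) n. F \<in> borel_measurable borel \<Longrightarrow> integrable \<mu> F \<Longrightarrow> (\<integral>x. F x \<partial>\<mu>) = 0 \<Longrightarrow>
      (\<integral>\<^sup>+\<omega>. ennreal ((norm (\<Sum>i<n. F (Y i \<omega>)))\<^sup>2) \<partial>M) \<le> ennreal (K * real n) * (\<integral>\<^sup>+x. ennreal ((norm (F x))\<^sup>2) \<partial>\<mu>)"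
begin

lemma Y_measurable[measurable]: "Y i \<in> borel_measurable M"
  using ind by (auto simp: indep_vars_def)

lemma sets_\<mu>[measurable_cong, simp]: "sets \<mu> = sets borel" and space_\<mu>[simp]: "space \<mu> = UNIV"
  using law[of 0] by (auto simp flip: law)

sublocale \<mu>: prob_space \<mu>
  unfolding law[of 0, symmetric] by (rule prob_space_distr) simp

lemma
  fixes g :: "'v \<Rightarrow> 'c::{banach, second_countable_topology}"
  assumes [measurable]: "g \<in> borel_measurable borel"
  shows integrable_Y: "integrable M (\<lambda>\<omega>. g (Y i \<omega>)) \<longleftrightarrow> integrable \<mu> g"
    and integral_Y: "(\<integral>\<omega>. g (Y i \<omega>) \<partial>M) = (\<integral>x. g x \<partial>\<mu>)"
    and distr_Y: "distr M borel (\<lambda>\<omega>. g (Y i \<omega>)) = distr \<mu> borel g"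
  unfolding law[of i, symmetric] by (simp_all add: integrable_distr_eq integral_distr distr_distr comp_def)

definition normalized_sum :: "('v \<Rightarrow> 'c::real_vector) \<Rightarrow> nat \<Rightarrow> 'a \<Rightarrow> 'c" where
  "normalized_sum F n \<omega> = (\<Sum>i<n. F (Y i \<omega>)) /\<^sub>R sqrt (real n)"

lemma normalized_sum_measurable[measurable]:
  fixes F :: "'v \<Rightarrow> 'c::{banach, second_countable_topology}"
  assumes [measurable]: "F \<in> borel_measurable borel"
  shows "normalized_sum F n \<in> borel_measurable M"
  unfolding normalized_sum_def by measurable

lemma normalized_sum_bound:
  fixes F :: "'v \<Rightarrow> 'v"
  assumes F[measurable]: "F \<in> borel_measurable borel" and int: "integrable \<mu> F" "(\<integral>x. F x \<partial>\<mu>) = 0"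
  shows "(\<integral>\<^sup>+\<omega>. ennreal ((norm (normalized_sum F n \<omega>))\<^sup>2) \<partial>M) \<le> ennreal K * (\<integral>\<^sup>+x. ennreal ((norm (F x))\<^sup>2) \<partial>\<mu>)"
proof (cases "n = 0")
  case False
  have "(\<integral>\<^sup>+\<omega>. ennreal ((norm (normalized_sum F n \<omega>))\<^sup>2) \<partial>M)
      = (\<integral>\<^sup>+\<omega>. ennreal (inverse (real n)) * ennreal ((norm (\<Sum>i<n. F (Y i \<omega>)))\<^sup>2) \<partial>M)"
    unfolding normalized_sum_def
    by (intro nn_integral_cong) (simp add: power_mult_distrib power_inverse flip: ennreal_mult)
  also have "\<dots> = ennreal (inverse (real n)) * (\<integral>\<^sup>+\<omega>. ennreal ((norm (\<Sum>i<n. F (Y i \<omega>)))\<^sup>2) \<partial>M)"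
    by (rule nn_integral_cmult) measurable
  also have "\<dots> \<le> ennreal (inverse (real n)) * (ennreal (K * real n) * (\<integral>\<^sup>+x. ennreal ((norm (F x))\<^sup>2) \<partial>\<mu>))"
    by (intro mult_left_mono sum_bound F int) simp
  also have "\<dots> = ennreal K * (\<integral>\<^sup>+x. ennreal ((norm (F x))\<^sup>2) \<partial>\<mu>)"
  proof -
    have "ennreal (inverse (real n)) * ennreal (K * real n) = ennreal K"
      using False K by (simp flip: ennreal_mult)
    then show ?thesis by (simp add: mult.assoc[symmetric])
  qed
  finally show ?thesis .
qed (simp add: normalized_sum_def)

lemma real_clt_char:
  assumes [measurable]: "g \<in> borel_measurable borel" and g: "integrable \<mu> (\<lambda>x. (g x)\<^sup>2)" "(\<integral>x. g x \<partial>\<mu>) = 0"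
  shows "(\<lambda>n. \<integral>\<omega>. iexp (normalized_sum g n \<omega>) \<partial>M) \<longlonglongrightarrow> complex_of_real (exp (- (\<integral>x. (g x)\<^sup>2 \<partial>\<mu>) / 2))"
proof -
  have "(\<lambda>n. \<integral>\<omega>. iexp ((\<Sum>i<n. g (Y i \<omega>)) / sqrt n) \<partial>M)
      \<longlonglongrightarrow> complex_of_real (exp (- (\<integral>x. x\<^sup>2 \<partial>distr \<mu> borel g) / 2))"
    by (rule clt_char[where Z = "\<lambda>i \<omega>. g (Y i \<omega>)", OF indep_vars_compose2[OF ind] distr_Y])
      (use g in \<open>auto simp: integrable_distr_eq integral_distr\<close>)
  moreover have "normalized_sum g n \<omega> = (\<Sum>i<n. g (Y i \<omega>)) / sqrt n" for n \<omega>
    by (simp add: normalized_sum_def divide_inverse mult.commute[of "inverse _"])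
  moreover have "(\<integral>x. x\<^sup>2 \<partial>distr \<mu> borel g) = (\<integral>x. (g x)\<^sup>2 \<partial>\<mu>)"
    by (rule integral_distr) measurable
  ultimately show ?thesis by (simp only:)
qed

text \<open>Uncorrelated coordinate functions have independent coordinates in the Gaussian limit, which can then be
  written down explicitly.  A function \<open>u i\<close> may vanish almost everywhere.\<close>

definition orthogonal_family :: "(nat \<Rightarrow> 'v \<Rightarrow> real) \<Rightarrow> bool" where
  "orthogonal_family u \<longleftrightarrow> (\<forall>i. u i \<in> borel_measurable borel \<and> integrable \<mu> (\<lambda>x. (u i x)\<^sup>2) \<and> (\<integral>x. u i x \<partial>\<mu>) = 0) \<and>
     (\<forall>i j. i \<noteq> j \<longrightarrow> (\<integral>x. u i x * u j x \<partial>\<mu>) = 0)"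

definition sd :: "('v \<Rightarrow> real) \<Rightarrow> real" where "sd g = sqrt (\<integral>x. (g x)\<^sup>2 \<partial>\<mu>)"

lemma sd_squared: "(sd g)\<^sup>2 = (\<integral>x. (g x)\<^sup>2 \<partial>\<mu>)" by (simp add: sd_def)

definition white_noise :: "(nat \<Rightarrow> real) measure" where
  "white_noise = PiM UNIV (\<lambda>_. std_normal_distribution)"

text \<open>The Gaussian counterpart of the map \<open>\<lambda>v. \<Sum>i<m. u i v *\<^sub>R x i\<close>: each coordinate
  function is replaced by a normal variable with the same variance.\<close>

definition gaussian_sum :: "(nat \<Rightarrow> 'v \<Rightarrow> real) \<Rightarrow> nat \<Rightarrow> (nat \<Rightarrow> 'v) \<Rightarrow> (nat \<Rightarrow> real) \<Rightarrow> 'v" where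
  "gaussian_sum u m x \<omega> = (\<Sum>i<m. (sd (u i) * \<omega> i) *\<^sub>R x i)"

end

lemma std_normal_sets: "sets std_normal_distribution = sets borel" by simp

lemma prob_space_std_normal: "prob_space std_normal_distribution"
  using real_dist_normal_dist by (simp add: real_distribution_def)

lemmas white_noise_coordinates = iid_coordinates[OF prob_space_std_normal std_normal_sets]

context iid_second_moment_bound
begin

sublocale noise: prob_space white_noise
  unfolding white_noise_def by (rule white_noise_coordinates)

lemma noise_measurable[measurable]: "(\<lambda>\<omega>. \<omega> i) \<in> borel_measurable white_noise"
  using white_noise_coordinates(3) unfolding prob_space.indep_vars_def[OF white_noise_coordinates(1)]
  by (simp add: white_noise_def)

lemma noise_sq: "integrable white_noise (\<lambda>\<omega>. (\<omega> i)\<^sup>2)" "(\<integral>\<omega>. (\<omega> i)\<^sup>2 \<partial>white_noise) = 1"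
proof -
  have l: "distr white_noise borel (\<lambda>\<omega>. \<omega> i) = std_normal_distribution"
    unfolding white_noise_def by (rule white_noise_coordinates)
  have "integrable std_normal_distribution (\<lambda>x. x\<^sup>2)" by (rule integrable_std_normal_distribution_moment)
  then show "integrable white_noise (\<lambda>\<omega>. (\<omega> i)\<^sup>2)" unfolding l[symmetric] by (simp add: integrable_distr_eq)
  have "(\<integral>x. x\<^sup>2 \<partial>std_normal_distribution) = 1"
    using std_normal_distribution_even_moments(1)[of 1] by simp
  then show "(\<integral>\<omega>. (\<omega> i)\<^sup>2 \<partial>white_noise) = 1" unfolding l[symmetric] by (simp add: integral_distr)
qed

lemma noise_char: "(\<integral>\<omega>. iexp (\<Sum>i<m. \<theta> i * \<omega> i) \<partial>white_noise) = complex_of_real (exp (- (\<Sum>i<m. (\<theta> i)\<^sup>2) / 2))"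
proof -
  have l: "distr white_noise borel (\<lambda>\<omega>. \<omega> i) = std_normal_distribution" for i
    unfolding white_noise_def by (rule white_noise_coordinates)
  have "noise.indep_vars (\<lambda>_. borel) (\<lambda>i \<omega>. \<omega> i) UNIV"
    unfolding white_noise_def by (rule white_noise_coordinates)
  then have "noise.indep_vars (\<lambda>_. borel) (\<lambda>i \<omega>. \<omega> i) {..<m}" by (rule noise.indep_vars_subset) simp
  then have "noise.indep_vars (\<lambda>_. borel) (\<lambda>i \<omega>. \<theta> i * \<omega> i) {..<m}"
    by (rule noise.indep_vars_compose2) simp
  then have "char (distr white_noise borel (\<lambda>\<omega>. \<Sum>i<m. \<theta> i * \<omega> i)) 1
      = (\<Prod>i<m. char (distr white_noise borel (\<lambda>\<omega>. \<theta> i * \<omega> i)) 1)"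
    by (rule noise.char_distr_sum)
  moreover have "char (distr white_noise borel (\<lambda>\<omega>. \<theta> i * \<omega> i)) 1 = complex_of_real (exp (- ((\<theta> i)\<^sup>2) / 2))" for i
  proof -
    have "char (distr white_noise borel (\<lambda>\<omega>. \<theta> i * \<omega> i)) 1 = char (distr white_noise borel (\<lambda>\<omega>. \<omega> i)) (\<theta> i)"
      by (simp add: char_def integral_distr)
    then show ?thesis by (simp add: l char_std_normal_distribution)
  qed
  ultimately show ?thesis
    by (simp add: char_def integral_distr flip: exp_sum of_real_prod)
       (simp add: exp_sum sum_negf sum_divide_distrib)
qed

lemma gaussian_sum_measurable[measurable]: "gaussian_sum u m x \<in> borel_measurable white_noise"
  unfolding gaussian_sum_def by measurable

lemma orthogonal_combination_sq:
  assumes u: "orthogonal_family u"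
  shows "integrable \<mu> (\<lambda>x. (\<Sum>i<m. \<theta> i * u i x)\<^sup>2)" and "(\<integral>x. (\<Sum>i<m. \<theta> i * u i x)\<^sup>2 \<partial>\<mu>) = (\<Sum>i<m. (\<theta> i * sd (u i))\<^sup>2)"
proof -
  have [measurable]: "u i \<in> borel_measurable borel" for i using u by (simp add: orthogonal_family_def)
  have int: "integrable \<mu> (\<lambda>x. u i x * u j x)" for i j
    using u by (intro integrable_prod_of_sq) (auto simp: orthogonal_family_def)
  have eq: "(\<Sum>i<m. \<theta> i * u i x)\<^sup>2 = (\<Sum>i<m. \<Sum>j<m. (\<theta> i * \<theta> j) * (u i x * u j x))" for x
    by (simp add: power2_eq_square sum_product mult_ac)
  show "integrable \<mu> (\<lambda>x. (\<Sum>i<m. \<theta> i * u i x)\<^sup>2)" unfolding eq using int by simp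
  have orth: "(\<integral>x. u i x * u j x \<partial>\<mu>) = (if j = i then (sd (u i))\<^sup>2 else 0)" for i j
    using u sd_squared[of "u i"] by (auto simp: orthogonal_family_def power2_eq_square)
  have "(\<integral>x. (\<Sum>i<m. \<theta> i * u i x)\<^sup>2 \<partial>\<mu>) = (\<Sum>i<m. \<Sum>j<m. (\<theta> i * \<theta> j) * (\<integral>x. u i x * u j x \<partial>\<mu>))"
    unfolding eq using int by simp
  also have "\<dots> = (\<Sum>i<m. \<theta> i * \<theta> i * (sd (u i))\<^sup>2)"
    unfolding orth by (simp add: if_distrib[of "\<lambda>c. _ * c"] cong: if_cong)
  also have "\<dots> = (\<Sum>i<m. (\<theta> i * sd (u i))\<^sup>2)" by (simp add: power2_eq_square mult_ac)
  finally show "(\<integral>x. (\<Sum>i<m. \<theta> i * u i x)\<^sup>2 \<partial>\<mu>) = (\<Sum>i<m. (\<theta> i * sd (u i))\<^sup>2)" .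
qed

lemma normalized_sum_scaleR_sum:
  "normalized_sum (\<lambda>v. \<Sum>i<m. u i v *\<^sub>R x i) n \<omega> = (\<Sum>i<m. normalized_sum (u i) n \<omega> *\<^sub>R (x i :: 'c::real_vector))"
  unfolding normalized_sum_def
  by (subst sum.swap) (simp add: scaleR_sum_left[symmetric] scaleR_sum_right mult.commute)

text \<open>Every linear combination of the coordinates is a normalized sum of real variables, so the real central limit
  theorem gives convergence of the joint characteristic functions; orthogonality makes the limiting variance
  that of the corresponding combination of independent normal variables.\<close>

lemma finite_rank_clt:
  fixes f :: "'v \<Rightarrow> real" and x :: "nat \<Rightarrow> 'v"
  assumes u: "orthogonal_family u" and f: "continuous_on UNIV f" "\<And>v. \<bar>f v\<bar> \<le> B"
  shows "(\<lambda>n. \<integral>\<omega>. f (normalized_sum (\<lambda>v. \<Sum>i<m. u i v *\<^sub>R x i) n \<omega>) \<partial>M)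
    \<longlonglongrightarrow> (\<integral>\<omega>. f (gaussian_sum u m x \<omega>) \<partial>white_noise)"
proof -
  have [measurable]: "u i \<in> borel_measurable borel" for i using u by (simp add: orthogonal_family_def)
  have mean: "(\<integral>x. u i x \<partial>\<mu>) = 0" and sq: "integrable \<mu> (\<lambda>x. (u i x)\<^sup>2)" for i
    using u by (simp_all add: orthogonal_family_def)
  have int: "integrable \<mu> (u i)" for i by (rule \<mu>.square_integrable_imp_integrable[OF _ sq]) simp
  have comb: "(\<Sum>i<m. \<theta> i * normalized_sum (u i) n \<omega>) = normalized_sum (\<lambda>v. \<Sum>i<m. \<theta> i * u i v) n \<omega>" for \<theta> n \<omega> m
    using normalized_sum_scaleR_sum[of u \<theta> m n \<omega>] by (simp add: mult.commute)
  have char: "(\<lambda>n. \<integral>\<omega>. iexp (\<Sum>i<m. \<theta> i * normalized_sum (u i) n \<omega>) \<partial>M)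
      \<longlonglongrightarrow> (\<integral>\<omega>. iexp (\<Sum>i<m. \<theta> i * (sd (u i) * \<omega> i)) \<partial>white_noise)" for \<theta>
  proof -
    have "(\<lambda>n. \<integral>\<omega>. iexp (normalized_sum (\<lambda>v. \<Sum>i<m. \<theta> i * u i v) n \<omega>) \<partial>M)
      \<longlonglongrightarrow> complex_of_real (exp (- (\<integral>x. (\<Sum>i<m. \<theta> i * u i x)\<^sup>2 \<partial>\<mu>) / 2))"
      by (rule real_clt_char) (use orthogonal_combination_sq[OF u] int mean in auto)
    then show ?thesis
      using noise_char[where m = m and \<theta> = "\<lambda>i. \<theta> i * sd (u i)"] orthogonal_combination_sq(2)[OF u]
      unfolding comb by (simp add: mult.assoc)
  qed
  have T2: "integrable M (\<lambda>\<omega>. (normalized_sum (u i) n \<omega>)\<^sup>2)"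
    "(\<integral>\<omega>. (normalized_sum (u i) n \<omega>)\<^sup>2 \<partial>M) \<le> (sd (u i))\<^sup>2" for i n
  proof -
    have iM: "integrable M (\<lambda>\<omega>. (u i (Y s \<omega>))\<^sup>2)" for s using sq by (subst integrable_Y) auto
    have prod: "integrable M (\<lambda>\<omega>. u i (Y s \<omega>) * u i (Y t \<omega>))" for s t
      by (rule integrable_prod_of_sq) (auto simp: iM)
    have orth: "(\<integral>\<omega>. u i (Y s \<omega>) * u i (Y t \<omega>) \<partial>M) = (if t = s then (sd (u i))\<^sup>2 else 0)" for s t
    proof (cases "t = s")
      case True
      then show ?thesis using integral_Y[of "\<lambda>v. (u i v)\<^sup>2" s] sd_squared[of "u i"]
        by (simp add: power2_eq_square)
    next
      case False
      have "indep_vars (\<lambda>_. borel) (\<lambda>s \<omega>. u i (Y s \<omega>)) {s, t}"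
        by (rule indep_vars_compose2[OF indep_vars_subset[OF ind]]) auto
      then have "(\<integral>\<omega>. (\<Prod>r\<in>{s, t}. u i (Y r \<omega>)) \<partial>M) = (\<Prod>r\<in>{s, t}. \<integral>\<omega>. u i (Y r \<omega>) \<partial>M)"
        by (intro indep_vars_lebesgue_integral) (auto simp: integrable_Y int)
      then show ?thesis using False by (simp add: integral_Y mean)
    qed
    have eq: "(normalized_sum (u i) n \<omega>)\<^sup>2 = inverse (real n) * (\<Sum>s<n. \<Sum>t<n. u i (Y s \<omega>) * u i (Y t \<omega>))" for \<omega>
    proof -
      have "(\<Sum>s<n. u i (Y s \<omega>))\<^sup>2 = (\<Sum>s<n. \<Sum>t<n. u i (Y s \<omega>) * u i (Y t \<omega>))"
        by (simp only: power2_eq_square sum_product)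
      then show ?thesis by (simp add: normalized_sum_def power_mult_distrib power_inverse)
    qed
    show "integrable M (\<lambda>\<omega>. (normalized_sum (u i) n \<omega>)\<^sup>2)" unfolding eq using prod by simp
    have "(\<integral>\<omega>. (normalized_sum (u i) n \<omega>)\<^sup>2 \<partial>M) = inverse (real n) * (\<Sum>s<n. \<Sum>t<n. \<integral>\<omega>. u i (Y s \<omega>) * u i (Y t \<omega>) \<partial>M)"
      unfolding eq using prod by simp
    also have "\<dots> \<le> (sd (u i))\<^sup>2" unfolding orth by (cases "n = 0") (simp_all flip: mult.assoc)
    finally show "(\<integral>\<omega>. (normalized_sum (u i) n \<omega>)\<^sup>2 \<partial>M) \<le> (sd (u i))\<^sup>2" .
  qed
  have cont: "continuous_on UNIV (\<lambda>t :: nat \<Rightarrow> real. f (\<Sum>i<m. t i *\<^sub>R x i))"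
  proof (rule continuous_on_compose2[OF f(1)])
    show "continuous_on UNIV (\<lambda>t :: nat \<Rightarrow> real. \<Sum>i<m. t i *\<^sub>R x i)"
      by (intro continuous_on_sum continuous_on_scaleR continuous_on_const continuous_on_product_coordinates)
  qed simp
  have T_sum: "(\<Sum>i<m. \<integral>\<omega>. (normalized_sum (u i) n \<omega>)\<^sup>2 \<partial>M) \<le> (\<Sum>i<m. (sd (u i))\<^sup>2)" for n
    by (intro sum_mono T2)
  have S_sq: "integrable white_noise (\<lambda>\<omega>. (sd (u i) * \<omega> i)\<^sup>2)" for i
    by (simp add: power_mult_distrib noise_sq)
  have S_sum: "(\<Sum>i<m. \<integral>\<omega>. (sd (u i) * \<omega> i)\<^sup>2 \<partial>white_noise) \<le> (\<Sum>i<m. (sd (u i))\<^sup>2)"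
    by (simp add: power_mult_distrib noise_sq)
  have "(\<lambda>n. \<integral>\<omega>. f (\<Sum>i<m. normalized_sum (u i) n \<omega> *\<^sub>R x i) \<partial>M)
    \<longlonglongrightarrow> (\<integral>\<omega>. f (\<Sum>i<m. (sd (u i) * \<omega> i) *\<^sub>R x i) \<partial>white_noise)"
    by (rule joint_char_convergence_imp_weak[where T = "\<lambda>n i. normalized_sum (u i) n" and
        S = "\<lambda>i \<omega>. sd (u i) * \<omega> i" and F = "\<lambda>t. f (\<Sum>i<m. t i *\<^sub>R x i)" and m = m,
        OF prob_space_axioms noise.prob_space_axioms _ _ char T2(1) T_sum S_sq S_sum cont f(2)]) auto
  then show ?thesis by (simp add: normalized_sum_scaleR_sum gaussian_sum_def)
qed

text \<open>The bound for normalized sums is inherited by their weak limit: the squared norm is truncated to obtain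
  bounded continuous test functions, and the truncation is removed by Fatou's lemma.\<close>

lemma gaussian_sum_bound:
  assumes u: "orthogonal_family u"
  shows "(\<integral>\<^sup>+\<omega>. ennreal ((norm (gaussian_sum u m x \<omega>))\<^sup>2) \<partial>white_noise)
    \<le> ennreal K * (\<integral>\<^sup>+v. ennreal ((norm (\<Sum>i<m. u i v *\<^sub>R x i))\<^sup>2) \<partial>\<mu>)" (is "_ \<le> ?B")
proof (cases "?B = \<infinity>")
  case False
  then obtain b where b: "0 \<le> b" "?B = ennreal b" by (cases ?B rule: ennreal_cases) auto
  let ?F = "\<lambda>v. \<Sum>i<m. u i v *\<^sub>R x i"
  have [measurable]: "u i \<in> borel_measurable borel" for i using u by (simp add: orthogonal_family_def)
  have mean: "(\<integral>x. u i x \<partial>\<mu>) = 0" and sq: "integrable \<mu> (\<lambda>x. (u i x)\<^sup>2)" for i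
    using u by (simp_all add: orthogonal_family_def)
  have int: "integrable \<mu> (u i)" for i by (rule \<mu>.square_integrable_imp_integrable[OF _ sq]) simp
  have trunc: "(\<integral>\<^sup>+\<omega>. ennreal (min ((norm (gaussian_sum u m x \<omega>))\<^sup>2) (real k)) \<partial>white_noise) \<le> ?B" for k :: nat
  proof -
    let ?f = "\<lambda>v :: 'v. min ((norm v)\<^sup>2) (real k)"
    have "(\<integral>\<omega>. ?f (normalized_sum ?F n \<omega>) \<partial>M) \<le> b" for n
    proof -
      have "ennreal (\<integral>\<omega>. ?f (normalized_sum ?F n \<omega>) \<partial>M) = (\<integral>\<^sup>+\<omega>. ennreal (?f (normalized_sum ?F n \<omega>)) \<partial>M)"
        by (intro nn_integral_eq_integral[symmetric] integrable_const_bound[of _ "real k"]) auto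
      also have "\<dots> \<le> (\<integral>\<^sup>+\<omega>. ennreal ((norm (normalized_sum ?F n \<omega>))\<^sup>2) \<partial>M)"
        by (intro nn_integral_mono ennreal_leI) simp
      also have "\<dots> \<le> ?B"
        by (intro normalized_sum_bound) (auto simp: int mean)
      finally show ?thesis using b by simp
    qed
    moreover have "(\<lambda>n. \<integral>\<omega>. ?f (normalized_sum ?F n \<omega>) \<partial>M) \<longlonglongrightarrow> (\<integral>\<omega>. ?f (gaussian_sum u m x \<omega>) \<partial>white_noise)"
      by (rule finite_rank_clt[OF u, of _ "real k"]) (auto intro!: continuous_intros)
    ultimately have "(\<integral>\<omega>. ?f (gaussian_sum u m x \<omega>) \<partial>white_noise) \<le> b"
      by (intro LIMSEQ_le_const2) auto
    moreover have "(\<integral>\<^sup>+\<omega>. ennreal (?f (gaussian_sum u m x \<omega>)) \<partial>white_noise)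
        = ennreal (\<integral>\<omega>. ?f (gaussian_sum u m x \<omega>) \<partial>white_noise)"
      by (intro nn_integral_eq_integral noise.integrable_const_bound[of _ "real k"]) auto
    ultimately show ?thesis using b by (simp add: ennreal_leI)
  qed
  show ?thesis
  proof (rule nn_integral_le_of_tendsto[OF _ _ always_eventually[OF allI[OF trunc]]])
    show "AE \<omega> in white_noise. (\<lambda>k. ennreal (min ((norm (gaussian_sum u m x \<omega>))\<^sup>2) (real k))) \<longlonglongrightarrow> ennreal ((norm (gaussian_sum u m x \<omega>))\<^sup>2)"
    proof (rule AE_I2, rule tendsto_eventually)
      fix \<omega>
      obtain N where "(norm (gaussian_sum u m x \<omega>))\<^sup>2 \<le> real N" using real_arch_simple by blast
      then show "\<forall>\<^sub>F k in sequentially. ennreal (min ((norm (gaussian_sum u m x \<omega>))\<^sup>2) (real k)) = ennreal ((norm (gaussian_sum u m x \<omega>))\<^sup>2)"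
        by (intro eventually_sequentiallyI[of N]) (simp add: min_def)
    qed
  qed measurable
next
  case True
  show ?thesis unfolding True by simp
qed

end

section \<open>Approximation by maps of finite rank\<close>

text \<open>The vectors are orthogonalized but not normalized, so that functions which vanish almost everywhere can
  stay in the family.\<close>

fun gram_schmidt :: "'b measure \<Rightarrow> (nat \<Rightarrow> 'b \<Rightarrow> real) \<Rightarrow> nat \<Rightarrow> 'b \<Rightarrow> real" where
  "gram_schmidt L f n = (\<lambda>x. f n x -
     (\<Sum>i<n. (\<integral>y. f n y * gram_schmidt L f i y \<partial>L) / (\<integral>y. (gram_schmidt L f i y)\<^sup>2 \<partial>L) * gram_schmidt L f i x))"

declare gram_schmidt.simps[simp del]

lemma gram_schmidt_measurable:
  assumes "\<And>n. f n \<in> borel_measurable L"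
  shows "gram_schmidt L f n \<in> borel_measurable L"
proof (induction n rule: less_induct)
  case (less n)
  show ?case
    by (subst gram_schmidt.simps) (intro borel_measurable_diff borel_measurable_sum borel_measurable_times
      borel_measurable_const assms less; simp)
qed

lemma gram_schmidt_bounded:
  assumes "\<And>n x. \<bar>f n x\<bar> \<le> B"
  shows "\<exists>B. \<forall>x. \<bar>gram_schmidt L f n x\<bar> \<le> B"
proof (induction n rule: less_induct)
  case (less n)
  obtain C where C: "\<And>i x. i < n \<Longrightarrow> \<bar>gram_schmidt L f i x\<bar> \<le> C i" using less by metis
  define c where "c i = (\<integral>y. f n y * gram_schmidt L f i y \<partial>L) / (\<integral>y. (gram_schmidt L f i y)\<^sup>2 \<partial>L)" for i
  have "\<bar>gram_schmidt L f n x\<bar> \<le> B + (\<Sum>i<n. \<bar>c i\<bar> * C i)" for x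
  proof -
    have "\<bar>\<Sum>i<n. c i * gram_schmidt L f i x\<bar> \<le> (\<Sum>i<n. \<bar>c i * gram_schmidt L f i x\<bar>)" by (rule sum_abs)
    also have "\<dots> \<le> (\<Sum>i<n. \<bar>c i\<bar> * C i)"
      by (intro sum_mono) (auto simp: abs_mult C intro: mult_left_mono)
    finally show ?thesis
      using assms[of n x] by (subst gram_schmidt.simps) (simp flip: c_def)
  qed
  then show ?case by blast
qed

lemma gram_schmidt_span:
  "\<exists>c. \<forall>x. f n x = (\<Sum>i<Suc n. c i * gram_schmidt L f i x)"
proof -
  define c where "c i = (if i = n then 1 else
    (\<integral>y. f n y * gram_schmidt L f i y \<partial>L) / (\<integral>y. (gram_schmidt L f i y)\<^sup>2 \<partial>L))" for i
  have "f n x = (\<Sum>i<Suc n. c i * gram_schmidt L f i x)" for x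
    using gram_schmidt.simps[of L f n] by (simp add: c_def)
  then show ?thesis by blast
qed

lemma (in prob_space) gram_schmidt_orthogonal:
  assumes f: "\<And>n. f n \<in> borel_measurable M" and B: "\<And>n x. \<bar>f n x\<bar> \<le> B" and mean: "\<And>n. (\<integral>x. f n x \<partial>M) = 0"
  defines "u \<equiv> gram_schmidt M f"
  shows "integrable M (\<lambda>x. (u n x)\<^sup>2)" and "(\<integral>x. u n x \<partial>M) = 0" and "n \<noteq> j \<Longrightarrow> (\<integral>x. u n x * u j x \<partial>M) = 0"
proof -
  have u[measurable]: "u n \<in> borel_measurable M" for n unfolding u_def by (rule gram_schmidt_measurable[OF f])
  note f[measurable]
  have "\<forall>n. \<exists>B. \<forall>x. \<bar>u n x\<bar> \<le> B" unfolding u_def by (intro allI gram_schmidt_bounded[of f B] B)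
  then obtain C where C: "\<And>n x. \<bar>u n x\<bar> \<le> C n" using choice[of "\<lambda>n B. \<forall>x. \<bar>u n x\<bar> \<le> B"] by blast
  define c where "c n i = (\<integral>y. f n y * u i y \<partial>M) / (\<integral>y. (u i y)\<^sup>2 \<partial>M)" for n i
  have rec: "u n x = f n x - (\<Sum>i<n. c n i * u i x)" for n x
    using gram_schmidt.simps[of M f n] unfolding u_def c_def by simp
  have int: "integrable M (u n)" "integrable M (f n)" for n
    by (rule integrable_const_bound[of _ "C n"], use C in auto)
      (rule integrable_const_bound[of _ B], use B in auto)
  have ff: "integrable M (\<lambda>x. (f n x)\<^sup>2)" for n
  proof (rule integrable_const_bound[of _ "B\<^sup>2"])
    show "AE x in M. norm ((f n x)\<^sup>2) \<le> B\<^sup>2"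
      using B by (intro AE_I2) (simp add: abs_le_square_iff[symmetric] order_trans[OF B abs_ge_self])
  qed simp
  have uu: "integrable M (\<lambda>x. (u n x)\<^sup>2)" for n
  proof (rule integrable_const_bound[of _ "(C n)\<^sup>2"])
    show "AE x in M. norm ((u n x)\<^sup>2) \<le> (C n)\<^sup>2"
      using C by (intro AE_I2) (simp add: abs_le_square_iff[symmetric] order_trans[OF C abs_ge_self])
  qed simp
  then show "integrable M (\<lambda>x. (u n x)\<^sup>2)" .
  have prod: "integrable M (\<lambda>x. u i x * u j x)" "integrable M (\<lambda>x. f i x * u j x)" for i j
    by (intro integrable_prod_of_sq u f uu ff)+
  show "(\<integral>x. u n x \<partial>M) = 0"
  proof (induction n rule: less_induct)
    case (less n)
    then show ?case unfolding rec[of n] using int mean by simp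
  qed
  have orth: "\<forall>j<n. (\<integral>x. u n x * u j x \<partial>M) = 0" for n
  proof (induction n rule: less_induct)
    case (less n)
    show ?case
    proof (intro allI impI)
      fix j assume j: "j < n"
      have zero: "(\<integral>x. u i x * u j x \<partial>M) = 0" if "i < n" "i \<noteq> j" for i
        using less[OF that(1)] less[OF j] that by (cases i j rule: linorder_cases) (auto simp: mult.commute)
      have "(\<integral>x. u n x * u j x \<partial>M) = (\<integral>x. f n x * u j x - (\<Sum>i<n. c n i * (u i x * u j x)) \<partial>M)"
        unfolding rec[of n] by (simp add: left_diff_distrib sum_distrib_right mult.assoc)
      also have "\<dots> = (\<integral>x. f n x * u j x \<partial>M) - (\<Sum>i<n. c n i * (\<integral>x. u i x * u j x \<partial>M))"
        using prod by simp
      also have "(\<Sum>i<n. c n i * (\<integral>x. u i x * u j x \<partial>M)) = (\<Sum>i<n. if i = j then c n j * (\<integral>x. (u j x)\<^sup>2 \<partial>M) else 0)"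
        by (rule sum.cong) (auto simp: zero power2_eq_square)
      also have "\<dots> = c n j * (\<integral>x. (u j x)\<^sup>2 \<partial>M)" using j by simp
      also have "(\<integral>x. f n x * u j x \<partial>M) - c n j * (\<integral>x. (u j x)\<^sup>2 \<partial>M) = 0"
      proof (cases "(\<integral>x. (u j x)\<^sup>2 \<partial>M) = 0")
        case True
        (* A vanishing direction gives the coefficient 0 by the convention x / 0 = 0. *)
        then have "AE x in M. (u j x)\<^sup>2 = 0"
          using uu by (subst integral_nonneg_eq_0_iff_AE[symmetric]) auto
        then have "(\<integral>x. f n x * u j x \<partial>M) = (\<integral>x. 0 \<partial>M)"
          by (intro integral_cong_AE) auto
        then show ?thesis using True by simp
      next
        case False
        then show ?thesis by (simp add: c_def)
      qed
      finally show "(\<integral>x. u n x * u j x \<partial>M) = 0" .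
    qed
  qed
  show "n \<noteq> j \<Longrightarrow> (\<integral>x. u n x * u j x \<partial>M) = 0"
    using orth[of n] orth[of j] by (cases n j rule: linorder_cases) (auto simp: mult.commute)
qed

text \<open>The coefficients vanish from \<open>m\<close> on, so \<open>m\<close> may be enlarged.  This puts two maps over a common number of
  coordinate functions.\<close>

definition finite_rank :: "(nat \<Rightarrow> 'b \<Rightarrow> real) \<Rightarrow> nat \<Rightarrow> (nat \<Rightarrow> 'v::real_vector) \<Rightarrow> ('b \<Rightarrow> 'v) \<Rightarrow> bool" where
  "finite_rank u m x F \<longleftrightarrow> (\<forall>i\<ge>m. x i = 0) \<and> F = (\<lambda>v. \<Sum>i<m. u i v *\<^sub>R x i)"

lemma finite_rank_mono: "finite_rank u m x F \<Longrightarrow> m \<le> N \<Longrightarrow> finite_rank u N x F"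
  unfolding finite_rank_def by (auto simp: fun_eq_iff intro!: sum.mono_neutral_left) (meson not_le)

lemma finite_rank_add:
  assumes "finite_rank u m x F" "finite_rank u n y H"
  shows "finite_rank u (max m n) (\<lambda>i. x i + y i) (\<lambda>v. F v + H v)"
  using finite_rank_mono[OF assms(1), of "max m n"] finite_rank_mono[OF assms(2), of "max m n"]
  unfolding finite_rank_def by (auto simp: fun_eq_iff sum.distrib scaleR_add_right)

lemma finite_rank_sum:
  assumes "finite S" "\<And>s. s \<in> S \<Longrightarrow> \<exists>m x. finite_rank u m x (F s)"
  shows "\<exists>m x. finite_rank u m x (\<lambda>v. \<Sum>s\<in>S. F s v)"
  using assms
proof (induction S rule: finite_induct)
  case empty
  have "finite_rank u 0 (\<lambda>_. 0) (\<lambda>v. 0)" by (simp add: finite_rank_def)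
  then show ?case by auto
next
  case (insert s S)
  obtain m x where "finite_rank u m x (F s)" using insert.prems by blast
  moreover obtain n y where "finite_rank u n y (\<lambda>v. \<Sum>s\<in>S. F s v)" using insert by blast
  ultimately have "finite_rank u (max m n) (\<lambda>i. x i + y i) (\<lambda>v. F s v + (\<Sum>s\<in>S. F s v))"
    by (rule finite_rank_add)
  then show ?case using insert.hyps by auto
qed

lemma finite_rank_gram_schmidt: "\<exists>m x. finite_rank (gram_schmidt L f) m x (\<lambda>v. f n v *\<^sub>R y)"
proof -
  obtain c where c: "\<And>v. f n v = (\<Sum>i<Suc n. c i * gram_schmidt L f i v)" using gram_schmidt_span by blast
  have "finite_rank (gram_schmidt L f) (Suc n) (\<lambda>i. (if i < Suc n then c i else 0) *\<^sub>R y) (\<lambda>v. f n v *\<^sub>R y)"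
    unfolding finite_rank_def by (auto simp: c scaleR_sum_left scaleR_add_left mult.commute)
  then show ?thesis by blast
qed

context iid_second_moment_bound
begin

text \<open>Simple functions approximate the identity in the square mean.  Only countably many level sets occur in
  them; orthogonalizing the centered indicators of all these sets gives a single orthogonal sequence \<open>u\<close> that
  serves every approximation.\<close>

lemma finite_rank_approximation:
  assumes sq: "integrable \<mu> (\<lambda>x. (norm x)\<^sup>2)" and mean: "(\<integral>x. x \<partial>\<mu>) = 0"
  shows "\<exists>u F b. orthogonal_family u \<and> (\<forall>k. \<exists>m x. finite_rank u m x (F k)) \<and> b \<longlonglongrightarrow> 0 \<and>
    (\<forall>k::nat. 0 \<le> b k \<and> (\<integral>\<^sup>+x. ennreal ((norm (F k x - x))\<^sup>2) \<partial>\<mu>) \<le> ennreal (b k))"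
proof -
  have int: "integrable \<mu> (\<lambda>x. norm x)" by (rule \<mu>.square_integrable_imp_integrable[OF _ sq]) simp
  have "\<exists>s. (\<forall>i. simple_function \<mu> (s i)) \<and> (\<forall>x\<in>space \<mu>. (\<lambda>i. s i x) \<longlonglongrightarrow> x) \<and>
    (\<forall>i. \<forall>x\<in>space \<mu>. dist (s i x) 0 \<le> 2 * dist x 0)"
    by (rule borel_measurable_implies_sequence_metric) simp
  then obtain s where s: "\<And>k. simple_function \<mu> (s k)" "\<And>x. (\<lambda>k. s k x) \<longlonglongrightarrow> x"
    "\<And>k x. norm (s k x) \<le> 2 * norm x" by (auto simp del: dist_0_norm simp: dist_norm)
  have sm[measurable]: "s k \<in> borel_measurable borel" for k
    using borel_measurable_simple_function[OF s(1)] by simp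
  have fin: "finite (range (s k))" for k using simple_functionD(1)[OF s(1)] by simp
  define \<E> where "\<E> = (\<Union>k. (\<lambda>y. s k -` {y}) ` range (s k))"
  have \<E>: "countable \<E>" "\<E> \<noteq> {}"
    unfolding \<E>_def using fin by (auto intro!: countable_UN countable_image simp: countable_finite)
  have \<E>_sets: "A \<in> sets borel" if "A \<in> \<E>" for A
    using that measurable_sets[OF sm, of "{_}"] by (auto simp: \<E>_def)
  define f where "f n v = indicat_real (from_nat_into \<E> n) v - measure \<mu> (from_nat_into \<E> n)" for n v
  have fm[measurable]: "f n \<in> borel_measurable borel" for n
    unfolding f_def using \<E>_sets[OF from_nat_into[OF \<E>(2)]] by measurable
  have f_bd: "\<bar>f n v\<bar> \<le> 2" for n v
    unfolding f_def using \<mu>.prob_le_1[of "from_nat_into \<E> n"] measure_nonneg[of \<mu> "from_nat_into \<E> n"]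
    by (auto simp: indicator_def abs_le_iff simp del: \<mu>.prob_le_1 measure_nonneg)
  have f_mean: "(\<integral>v. f n v \<partial>\<mu>) = 0" for n
  proof -
    have A: "from_nat_into \<E> n \<in> sets \<mu>" using \<E>_sets[OF from_nat_into[OF \<E>(2)]] by simp
    have "integrable \<mu> (indicat_real (from_nat_into \<E> n))"
      using A by (intro integrable_real_indicator) (auto simp: \<mu>.emeasure_eq_measure)
    then show ?thesis unfolding f_def using A \<mu>.prob_space by simp
  qed
  define u where "u = gram_schmidt \<mu> f"
  have "orthogonal_family u"
    unfolding orthogonal_family_def u_def
    using gram_schmidt_measurable[of f \<mu>] \<mu>.gram_schmidt_orthogonal[of f 2] f_bd f_mean by auto
  moreover define a where "a k = (\<integral>v. s k v \<partial>\<mu>)" for k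
  define F where "F k v = s k v - a k" for k v
  have rank: "\<exists>m x. finite_rank u m x (F k)" for k
  proof -
    have dec: "s k v = (\<Sum>y\<in>range (s k). indicat_real (s k -` {y}) v *\<^sub>R y)" for v
    proof -
      have "(\<Sum>y\<in>range (s k). indicat_real (s k -` {y}) v *\<^sub>R y) = (\<Sum>y\<in>range (s k). if y = s k v then y else 0)"
        by (rule sum.cong) (auto simp: indicator_def)
      then show ?thesis using fin by simp
    qed
    have sets: "s k -` {y} \<in> sets borel" for y using measurable_sets[OF sm, of "{y}"] by simp
    then have int_ind: "integrable \<mu> (indicat_real (s k -` {y}))" for y
      by (intro integrable_real_indicator) (auto simp: \<mu>.emeasure_eq_measure)
    have "a k = (\<integral>v. (\<Sum>y\<in>range (s k). indicat_real (s k -` {y}) v *\<^sub>R y) \<partial>\<mu>)"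
      unfolding a_def by (intro Bochner_Integration.integral_cong refl dec)
    also have "\<dots> = (\<Sum>y\<in>range (s k). measure \<mu> (s k -` {y}) *\<^sub>R y)"
      by (subst Bochner_Integration.integral_sum) (use sets int_ind in simp_all)
    finally have "a k = (\<Sum>y\<in>range (s k). measure \<mu> (s k -` {y}) *\<^sub>R y)" .
    then have F: "F k v = (\<Sum>y\<in>range (s k). (indicat_real (s k -` {y}) v - measure \<mu> (s k -` {y})) *\<^sub>R y)" for v
      unfolding F_def dec[of v] by (simp add: sum_subtractf scaleR_diff_left)
    have "\<exists>m x. finite_rank u m x (\<lambda>v. (indicat_real (s k -` {y}) v - measure \<mu> (s k -` {y})) *\<^sub>R y)"
      if "y \<in> range (s k)" for y
    proof -
      have "s k -` {y} \<in> \<E>" using that by (auto simp: \<E>_def)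
      then obtain n where "from_nat_into \<E> n = s k -` {y}"
        using from_nat_into_surj[OF \<E>(1)] by blast
      then show ?thesis
        using finite_rank_gram_schmidt[of \<mu> f n y] by (simp add: u_def f_def)
    qed
    then show ?thesis
      unfolding ext[of "F k", OF F] by (intro finite_rank_sum[OF fin])
  qed
  define c where "c k = (\<integral>x. (norm (s k x - x))\<^sup>2 \<partial>\<mu>)" for k
  have bd: "(norm (s k x - x))\<^sup>2 \<le> 9 * (norm x)\<^sup>2" for k x
  proof -
    have "norm (s k x - x) \<le> 3 * norm x" using s(3)[of k x] norm_triangle_ineq4[of "s k x" x] by linarith
    then have "(norm (s k x - x))\<^sup>2 \<le> (3 * norm x)\<^sup>2" by (rule power_mono) simp
    then show ?thesis by (simp add: power_mult_distrib)
  qed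
  have c_int: "integrable \<mu> (\<lambda>x. (norm (s k x - x))\<^sup>2)" for k
    by (rule Bochner_Integration.integrable_bound[of _ "\<lambda>x. 9 * (norm x)\<^sup>2"]) (use sq bd in auto)
  have "c \<longlonglongrightarrow> (\<integral>x. 0 \<partial>\<mu>)"
    unfolding c_def
  proof (rule integral_dominated_convergence[where w = "\<lambda>x. 9 * (norm x)\<^sup>2"])
    show "AE x in \<mu>. (\<lambda>k. (norm (s k x - x))\<^sup>2) \<longlonglongrightarrow> 0"
    proof (rule AE_I2)
      fix x
      have "(\<lambda>k. (norm (s k x - x))\<^sup>2) \<longlonglongrightarrow> (norm (x - x))\<^sup>2" by (intro tendsto_intros s)
      then show "(\<lambda>k. (norm (s k x - x))\<^sup>2) \<longlonglongrightarrow> 0" by simp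
    qed
  qed (use sq bd in auto)
  then have c: "c \<longlonglongrightarrow> 0" by simp
  have "a \<longlonglongrightarrow> (\<integral>x. x \<partial>\<mu>)"
    unfolding a_def
    by (rule integral_dominated_convergence[where w = "\<lambda>x. 2 * norm x"]) (use int s in auto)
  then have a: "a \<longlonglongrightarrow> 0" by (simp add: mean)
  define b where "b k = 2 * c k + 2 * (norm (a k))\<^sup>2" for k
  have "b \<longlonglongrightarrow> 2 * 0 + 2 * (norm (0 :: 'v))\<^sup>2"
    unfolding b_def by (intro tendsto_intros c a)
  then have "b \<longlonglongrightarrow> 0" by simp
  moreover have "0 \<le> b k \<and> (\<integral>\<^sup>+x. ennreal ((norm (F k x - x))\<^sup>2) \<partial>\<mu>) \<le> ennreal (b k)" for k
  proof
    show "0 \<le> b k" by (simp add: b_def c_def)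
    have "(\<integral>\<^sup>+x. ennreal ((norm (F k x - x))\<^sup>2) \<partial>\<mu>) \<le> (\<integral>\<^sup>+x. ennreal (2 * (norm (s k x - x))\<^sup>2 + 2 * (norm (a k))\<^sup>2) \<partial>\<mu>)"
    proof (intro nn_integral_mono ennreal_leI)
      fix x
      show "(norm (F k x - x))\<^sup>2 \<le> 2 * (norm (s k x - x))\<^sup>2 + 2 * (norm (a k))\<^sup>2"
        using norm_diff_sq_le[of "s k x - x" "a k"] by (simp add: F_def algebra_simps)
    qed
    also have "\<dots> = ennreal (\<integral>x. 2 * (norm (s k x - x))\<^sup>2 + 2 * (norm (a k))\<^sup>2 \<partial>\<mu>)"
      by (rule nn_integral_eq_integral) (use c_int in auto)
    also have "(\<integral>x. 2 * (norm (s k x - x))\<^sup>2 + 2 * (norm (a k))\<^sup>2 \<partial>\<mu>) = b k"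
      unfolding b_def c_def using c_int \<mu>.prob_space by simp
    finally show "(\<integral>\<^sup>+x. ennreal ((norm (F k x - x))\<^sup>2) \<partial>\<mu>) \<le> ennreal (b k)" .
  qed
  ultimately show ?thesis using rank by blast
qed

end

section \<open>Convergence to a Gaussian limit\<close>

text \<open>The greatest \<open>j\<close>-Lipschitz minorant of a bounded function.\<close>

definition lipschitz_minorant :: "('v::metric_space \<Rightarrow> real) \<Rightarrow> nat \<Rightarrow> 'v \<Rightarrow> real" where
  "lipschitz_minorant f j x = (INF y. f y + real j * dist x y)"

lemma lipschitz_minorant_props:
  fixes f :: "'v::metric_space \<Rightarrow> real"
  assumes bd: "\<And>x. \<bar>f x\<bar> \<le> B"
  shows "lipschitz_minorant f j x \<le> f x" and "\<bar>lipschitz_minorant f j x\<bar> \<le> B"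
    and "lipschitz_minorant f j x - lipschitz_minorant f j z \<le> real j * dist x z"
    and "isCont f x \<Longrightarrow> (\<lambda>j. lipschitz_minorant f j x) \<longlonglongrightarrow> f x"
proof -
  let ?g = "lipschitz_minorant f"
  have below: "- B \<le> f y + real j * dist x y" for j x y
    using bd[of y] by (simp add: abs_le_iff add_increasing2 minus_le_iff)
  then have bdd: "bdd_below (range (\<lambda>y. f y + real j * dist x y))" for j x by (intro bdd_belowI2) auto
  have lower: "?g j x \<le> f y + real j * dist x y" for j x y
    unfolding lipschitz_minorant_def by (rule cINF_lower[OF bdd]) simp
  have greatest: "c \<le> ?g j x" if "\<And>y. c \<le> f y + real j * dist x y" for c j x
    unfolding lipschitz_minorant_def by (rule cINF_greatest) (use that in auto)
  show le: "?g j x \<le> f x" for j x using lower[of j x x] by simp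
  show "\<bar>?g j x\<bar> \<le> B" using le[of j x] bd[of x] greatest[of "- B" j x] below by (simp add: abs_le_iff)
  have "?g j x - real j * dist x z \<le> ?g j z"
  proof (rule greatest)
    fix y
    have "real j * dist x y \<le> real j * dist x z + real j * dist z y"
      using dist_triangle[of x y z] by (simp add: mult_left_mono flip: distrib_left)
    then show "?g j x - real j * dist x z \<le> f y + real j * dist z y" using lower[of j x y] by linarith
  qed
  then show "?g j x - ?g j z \<le> real j * dist x z" by simp
  show "(\<lambda>j. ?g j x) \<longlonglongrightarrow> f x" if cont: "isCont f x"
  proof (rule LIMSEQ_I)
    fix e :: real assume e: "0 < e"
    obtain d where d: "0 < d" "\<And>y. dist y x < d \<Longrightarrow> dist (f y) (f x) < e / 2"
      using cont e unfolding continuous_at_eps_delta by (meson half_gt_zero)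
    obtain N where N: "2 * B / d \<le> real N" using real_arch_simple by blast
    have "norm (?g j x - f x) < e" if "N \<le> j" for j
    proof -
      have "f x - e / 2 \<le> ?g j x"
      proof (rule greatest)
        fix y
        show "f x - e / 2 \<le> f y + real j * dist x y"
        proof (cases "dist x y < d")
          case True
          then have "\<bar>f y - f x\<bar> < e / 2" using d(2)[of y] unfolding dist_real_def by (simp only: dist_commute)
          then have "f x - e / 2 \<le> f y" by linarith
          then show ?thesis by (simp add: add_increasing2)
        next
          case False
          have "2 * B \<le> real N * d" using N d by (simp add: field_simps)
          also have "\<dots> \<le> real j * dist x y" using that False d by (intro mult_mono) auto
          finally show ?thesis using bd[of x] bd[of y] e by linarith
        qed
      qed
      then show ?thesis using le[of j x] e by simp
    qed
    then show "\<exists>N. \<forall>j\<ge>N. norm (?g j x - f x) < e" by blast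
  qed
qed

text \<open>A bounded continuous function is the increasing limit of its Lipschitz minorants, which bounds the limit
  inferior of its integrals from below; the same bound for the negated function gives convergence.\<close>

lemma weak_convergence_if_lipschitz:
  fixes Y :: "nat \<Rightarrow> 'a \<Rightarrow> 'v::{banach, second_countable_topology}" and f :: "'v \<Rightarrow> real"
  assumes M: "prob_space M" and N: "prob_space N"
    and Y[measurable]: "\<And>n. Y n \<in> borel_measurable M" and G[measurable]: "G \<in> borel_measurable N"
    and lip: "\<And>(g :: 'v \<Rightarrow> real) L B. (\<And>x y. \<bar>g x - g y\<bar> \<le> L * norm (x - y)) \<Longrightarrow> (\<And>x. \<bar>g x\<bar> \<le> B) \<Longrightarrow>
      (\<lambda>n. \<integral>\<omega>. g (Y n \<omega>) \<partial>M) \<longlonglongrightarrow> (\<integral>\<omega>. g (G \<omega>) \<partial>N)"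
    and f: "continuous_on UNIV f" "\<And>x. \<bar>f x\<bar> \<le> B"
  shows "(\<lambda>n. \<integral>\<omega>. f (Y n \<omega>) \<partial>M) \<longlonglongrightarrow> (\<integral>\<omega>. f (G \<omega>) \<partial>N)"
proof -
  interpret M: prob_space M by fact
  interpret N: prob_space N by fact
  have half: "\<forall>\<^sub>F n in sequentially. (\<integral>\<omega>. h (G \<omega>) \<partial>N) - e < (\<integral>\<omega>. h (Y n \<omega>) \<partial>M)"
    if h: "continuous_on UNIV h" "\<And>x. \<bar>h x\<bar> \<le> B" and e: "0 < e" for h :: "'v \<Rightarrow> real" and e
  proof -
    let ?g = "lipschitz_minorant h"
    note P = lipschitz_minorant_props[where f = h, OF h(2)]
    have g_lip: "\<bar>?g j x - ?g j y\<bar> \<le> real j * norm (x - y)" for j x y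
      using P(3)[of j x y] P(3)[of j y x] by (simp add: dist_norm norm_minus_commute abs_le_iff)
    have g_meas[measurable]: "?g j \<in> borel_measurable borel" for j
    proof (intro borel_measurable_continuous_onI lipschitz_on_continuous_on)
      show "lipschitz_on (real j) UNIV (?g j)"
        by (rule lipschitz_onI) (use g_lip in \<open>auto simp: dist_norm\<close>)
    qed
    have h_meas[measurable]: "h \<in> borel_measurable borel" by (rule borel_measurable_continuous_onI[OF h(1)])
    have "(\<lambda>j. \<integral>\<omega>. ?g j (G \<omega>) \<partial>N) \<longlonglongrightarrow> (\<integral>\<omega>. h (G \<omega>) \<partial>N)"
    proof (rule integral_dominated_convergence[where w = "\<lambda>_. B"])
      show "AE \<omega> in N. (\<lambda>j. ?g j (G \<omega>)) \<longlonglongrightarrow> h (G \<omega>)"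
        using h(1) by (intro AE_I2 P(4)) (simp add: continuous_on_eq_continuous_at)
    qed (use P(2) in auto)
    then have "\<forall>\<^sub>F j in sequentially. (\<integral>\<omega>. h (G \<omega>) \<partial>N) - e / 2 < (\<integral>\<omega>. ?g j (G \<omega>) \<partial>N)"
      using e by (intro order_tendstoD(1)) auto
    then obtain j where j: "(\<integral>\<omega>. h (G \<omega>) \<partial>N) - e / 2 < (\<integral>\<omega>. ?g j (G \<omega>) \<partial>N)"
      by (auto simp: eventually_sequentially)
    have "\<forall>\<^sub>F n in sequentially. (\<integral>\<omega>. ?g j (G \<omega>) \<partial>N) - e / 2 < (\<integral>\<omega>. ?g j (Y n \<omega>) \<partial>M)"
      using e lip[OF g_lip P(2)] by (intro order_tendstoD(1)) auto
    then show ?thesis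
    proof eventually_elim
      case (elim n)
      have "(\<integral>\<omega>. ?g j (Y n \<omega>) \<partial>M) \<le> (\<integral>\<omega>. h (Y n \<omega>) \<partial>M)"
        using P(1,2) h(2) by (intro integral_mono M.integrable_const_bound[of _ B]) auto
      then show ?case using elim j by linarith
    qed
  qed
  have neg: "(\<integral>\<omega>. - f (Y n \<omega>) \<partial>M) = - (\<integral>\<omega>. f (Y n \<omega>) \<partial>M)" "(\<integral>\<omega>. - f (G \<omega>) \<partial>N) = - (\<integral>\<omega>. f (G \<omega>) \<partial>N)" for n
    by simp_all
  show ?thesis
  proof (rule order_tendstoI)
    fix a assume "a < (\<integral>\<omega>. f (G \<omega>) \<partial>N)"
    then show "\<forall>\<^sub>F n in sequentially. a < (\<integral>\<omega>. f (Y n \<omega>) \<partial>M)"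
      using half[OF f, of "(\<integral>\<omega>. f (G \<omega>) \<partial>N) - a"] by simp
  next
    fix a assume "(\<integral>\<omega>. f (G \<omega>) \<partial>N) < a"
    then show "\<forall>\<^sub>F n in sequentially. (\<integral>\<omega>. f (Y n \<omega>) \<partial>M) < a"
      using half[of "\<lambda>x. - f x" "a - (\<integral>\<omega>. f (G \<omega>) \<partial>N)"] f
      by (simp add: neg continuous_on_minus)
  qed
qed

lemma expectation_lipschitz_diff:
  fixes A B :: "'a \<Rightarrow> 'v::{banach, second_countable_topology}" and g :: "'v \<Rightarrow> real"
  assumes "prob_space P" and [measurable]: "A \<in> borel_measurable P" "B \<in> borel_measurable P"
    and g: "\<And>x y. \<bar>g x - g y\<bar> \<le> L * norm (x - y)" "\<And>x. \<bar>g x\<bar> \<le> c" "g \<in> borel_measurable borel"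
    and le: "(\<integral>\<^sup>+\<omega>. ennreal ((norm (A \<omega> - B \<omega>))\<^sup>2) \<partial>P) \<le> ennreal b" "0 \<le> b"
  shows "\<bar>(\<integral>\<omega>. g (A \<omega>) \<partial>P) - (\<integral>\<omega>. g (B \<omega>) \<partial>P)\<bar> \<le> \<bar>L\<bar> * sqrt b"
proof -
  interpret P: prob_space P by fact
  note g(3)[measurable]
  have int: "integrable P (\<lambda>\<omega>. g (A \<omega>))" "integrable P (\<lambda>\<omega>. g (B \<omega>))"
    using g(2) by (auto intro!: P.integrable_const_bound[of _ c])
  have i: "integrable P (\<lambda>\<omega>. A \<omega> - B \<omega>)" "(\<integral>\<omega>. norm (A \<omega> - B \<omega>) \<partial>P) \<le> sqrt b"
    using P.second_moment_bound_imp_integrable[OF _ le] by auto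
  have "\<bar>(\<integral>\<omega>. g (A \<omega>) \<partial>P) - (\<integral>\<omega>. g (B \<omega>) \<partial>P)\<bar> = \<bar>\<integral>\<omega>. g (A \<omega>) - g (B \<omega>) \<partial>P\<bar>" using int by simp
  also have "\<dots> \<le> (\<integral>\<omega>. \<bar>g (A \<omega>) - g (B \<omega>)\<bar> \<partial>P)" by (rule integral_abs_bound)
  also have "\<dots> \<le> (\<integral>\<omega>. \<bar>L\<bar> * norm (A \<omega> - B \<omega>) \<partial>P)"
  proof (rule integral_mono)
    show "\<bar>g (A \<omega>) - g (B \<omega>)\<bar> \<le> \<bar>L\<bar> * norm (A \<omega> - B \<omega>)" for \<omega>
      by (rule order_trans[OF g(1)]) (simp add: mult_right_mono)
  qed (use int i in auto)
  also have "\<dots> \<le> \<bar>L\<bar> * sqrt b" using i by (simp add: mult_left_mono)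
  finally show ?thesis .
qed

lemma nn_norm_diff_sq_le:
  fixes A B C :: "'a \<Rightarrow> 'v::{banach, second_countable_topology}"
  assumes [measurable]: "A \<in> borel_measurable P" "B \<in> borel_measurable P" "C \<in> borel_measurable P"
    and le: "(\<integral>\<^sup>+\<omega>. ennreal ((norm (A \<omega> - C \<omega>))\<^sup>2) \<partial>P) \<le> ennreal a"
      "(\<integral>\<^sup>+\<omega>. ennreal ((norm (B \<omega> - C \<omega>))\<^sup>2) \<partial>P) \<le> ennreal b" and "0 \<le> a" "0 \<le> b"
  shows "(\<integral>\<^sup>+\<omega>. ennreal ((norm (A \<omega> - B \<omega>))\<^sup>2) \<partial>P) \<le> ennreal (2 * a + 2 * b)"
proof -
  have "(\<integral>\<^sup>+\<omega>. ennreal ((norm (A \<omega> - B \<omega>))\<^sup>2) \<partial>P)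
      \<le> (\<integral>\<^sup>+\<omega>. 2 * ennreal ((norm (A \<omega> - C \<omega>))\<^sup>2) + 2 * ennreal ((norm (B \<omega> - C \<omega>))\<^sup>2) \<partial>P)"
  proof (rule nn_integral_mono)
    fix \<omega>
    have "ennreal ((norm (A \<omega> - B \<omega>))\<^sup>2) \<le> ennreal (2 * (norm (A \<omega> - C \<omega>))\<^sup>2 + 2 * (norm (B \<omega> - C \<omega>))\<^sup>2)"
      using norm_diff_sq_le[of "A \<omega> - C \<omega>" "B \<omega> - C \<omega>"] by (intro ennreal_leI) simp
    then show "ennreal ((norm (A \<omega> - B \<omega>))\<^sup>2)
        \<le> 2 * ennreal ((norm (A \<omega> - C \<omega>))\<^sup>2) + 2 * ennreal ((norm (B \<omega> - C \<omega>))\<^sup>2)"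
      by (simp add: ennreal_mult)
  qed
  also have "\<dots> = 2 * (\<integral>\<^sup>+\<omega>. ennreal ((norm (A \<omega> - C \<omega>))\<^sup>2) \<partial>P) + 2 * (\<integral>\<^sup>+\<omega>. ennreal ((norm (B \<omega> - C \<omega>))\<^sup>2) \<partial>P)"
    by (subst nn_integral_add) (auto simp: nn_integral_cmult)
  also have "\<dots> \<le> 2 * ennreal a + 2 * ennreal b" by (intro add_mono mult_left_mono le) auto
  also have "\<dots> = ennreal (2 * a + 2 * b)" using assms by (simp add: ennreal_mult)
  finally show ?thesis .
qed

context iid_second_moment_bound
begin

text \<open>The assignment of Gaussian sums to maps of finite rank is linear, so the bound on second moments makes it
  continuous in the square mean.\<close>

lemma gaussian_sum_diff_bound:
  assumes u: "orthogonal_family u" and F: "finite_rank u m x F" and H: "finite_rank u n y H"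
    and le: "(\<integral>\<^sup>+v. ennreal ((norm (F v - H v))\<^sup>2) \<partial>\<mu>) \<le> ennreal b" "0 \<le> b"
  shows "(\<integral>\<^sup>+\<omega>. ennreal ((norm (gaussian_sum u m x \<omega> - gaussian_sum u n y \<omega>))\<^sup>2) \<partial>white_noise) \<le> ennreal (K * b)"
proof -
  let ?N = "max m n" and ?z = "\<lambda>i. x i - y i"
  have F': "finite_rank u ?N x F" and H': "finite_rank u ?N y H"
    using finite_rank_mono[OF F] finite_rank_mono[OF H] by auto
  have extend: "gaussian_sum u m x \<omega> = gaussian_sum u N x \<omega>" if "\<forall>i\<ge>m. x i = 0" "m \<le> N" for m N x \<omega>
    unfolding gaussian_sum_def using that by (intro sum.mono_neutral_left) auto
  have "gaussian_sum u m x \<omega> = gaussian_sum u ?N x \<omega>" for \<omega>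
    by (rule extend) (use F in \<open>simp_all add: finite_rank_def\<close>)
  moreover have "gaussian_sum u n y \<omega> = gaussian_sum u ?N y \<omega>" for \<omega>
    by (rule extend) (use H in \<open>simp_all add: finite_rank_def\<close>)
  ultimately have diff: "gaussian_sum u m x \<omega> - gaussian_sum u n y \<omega> = gaussian_sum u ?N ?z \<omega>" for \<omega>
    by (simp add: gaussian_sum_def sum_subtractf scaleR_diff_right)
  have "(\<Sum>i<?N. u i v *\<^sub>R ?z i) = F v - H v" for v
    using F' H' by (simp add: finite_rank_def sum_subtractf scaleR_diff_right)
  then have "(\<integral>\<^sup>+\<omega>. ennreal ((norm (gaussian_sum u ?N ?z \<omega>))\<^sup>2) \<partial>white_noise)
      \<le> ennreal K * (\<integral>\<^sup>+v. ennreal ((norm (F v - H v))\<^sup>2) \<partial>\<mu>)"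
    using gaussian_sum_bound[OF u, of ?N ?z] by simp
  also have "\<dots> \<le> ennreal K * ennreal b" by (intro mult_left_mono le) simp
  finally show ?thesis using K le by (simp add: diff ennreal_mult)
qed

text \<open>The Gaussian sums of the approximations \<open>F k\<close> form a Cauchy sequence, whose limit is the required
  variable.  For a Lipschitz test function, replacing the identity by \<open>F k\<close> costs an error that is small uniformly
  in \<open>n\<close>, and replacing the Gaussian sum of \<open>F k\<close> by the limit costs a small error too; between
  them stands the theorem for maps of finite rank.\<close>

lemma normalized_sum_converges_weakly:
  assumes sq: "integrable \<mu> (\<lambda>x. (norm x)\<^sup>2)" and mean: "(\<integral>x. x \<partial>\<mu>) = 0"
  shows "\<exists>G \<in> borel_measurable white_noise. \<forall>(f :: 'v \<Rightarrow> real) B. continuous_on UNIV f \<longrightarrow> (\<forall>x. \<bar>f x\<bar> \<le> B) \<longrightarrow>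
    (\<lambda>n. \<integral>\<omega>. f (normalized_sum (\<lambda>x. x) n \<omega>) \<partial>M) \<longlonglongrightarrow> (\<integral>\<omega>. f (G \<omega>) \<partial>white_noise)"
proof -
  obtain u F b where u: "orthogonal_family u" and rank: "\<And>k. \<exists>m x. finite_rank u m x (F k)"
    and b: "b \<longlonglongrightarrow> 0" "\<And>k::nat. 0 \<le> b k" "\<And>k. (\<integral>\<^sup>+x. ennreal ((norm (F k x - x))\<^sup>2) \<partial>\<mu>) \<le> ennreal (b k)"
    using finite_rank_approximation[OF sq mean] by blast
  obtain m x where mx: "\<And>k. finite_rank u (m k) (x k) (F k)" using rank by metis
  then have F_eq: "F k = (\<lambda>v. \<Sum>i<m k. u i v *\<^sub>R x k i)" for k by (simp add: finite_rank_def)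
  have um[measurable]: "u i \<in> borel_measurable borel" for i using u by (simp add: orthogonal_family_def)
  have Fm[measurable]: "F k \<in> borel_measurable borel" for k unfolding F_eq by measurable
  let ?G = "\<lambda>k. gaussian_sum u (m k) (x k)"
  have FF: "(\<integral>\<^sup>+v. ennreal ((norm (F k v - F l v))\<^sup>2) \<partial>\<mu>) \<le> ennreal (2 * b k + 2 * b l)" for k l
    by (rule nn_norm_diff_sq_le[where C = "\<lambda>v. v"]) (use b in auto)
  have GG: "(\<integral>\<^sup>+\<omega>. ennreal ((norm (?G k \<omega> - ?G l \<omega>))\<^sup>2) \<partial>white_noise) \<le> ennreal (K * (2 * b k + 2 * b l))" for k l
    using b(2) by (intro gaussian_sum_diff_bound[OF u mx mx FF]) simp
  have G_L1: "integrable white_noise (\<lambda>\<omega>. ?G k \<omega> - ?G l \<omega>)"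
    "(\<integral>\<omega>. norm (?G k \<omega> - ?G l \<omega>) \<partial>white_noise) \<le> sqrt (K * (2 * b k + 2 * b l))" for k l
    using noise.second_moment_bound_imp_integrable[OF _ GG] b(2) K by auto
  have small: "\<exists>N. \<forall>k\<ge>N. b k < \<eta>" if "0 < \<eta>" for \<eta>
    using order_tendstoD(2)[OF b(1) that] by (simp add: eventually_sequentially)
  obtain r where r: "strict_mono r" "AE \<omega> in white_noise. Cauchy (\<lambda>k. ?G (r k) \<omega> - ?G 0 \<omega>)"
  proof (rule cauchy_L1_AE_cauchy_subseq[of white_noise "\<lambda>k \<omega>. ?G k \<omega> - ?G 0 \<omega>"])
    show "integrable white_noise (\<lambda>\<omega>. ?G k \<omega> - ?G 0 \<omega>)" for k by (rule G_L1)
    fix e :: real assume e: "0 < e"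
    (* Gaussian sums of approximations with b below \<eta> have mean square distance at most 4 * K * \<eta> < e\<^sup>2. *)
    define \<eta> where "\<eta> = e\<^sup>2 / (4 * (K + 1))"
    have \<eta>: "0 < \<eta>" "4 * (K + 1) * \<eta> = e\<^sup>2" unfolding \<eta>_def using e K by auto
    obtain N where N: "\<And>k. N \<le> k \<Longrightarrow> b k < \<eta>" using small[OF \<eta>(1)] by blast
    have "(\<integral>\<omega>. norm (?G i \<omega> - ?G 0 \<omega> - (?G j \<omega> - ?G 0 \<omega>)) \<partial>white_noise) < e" if "N \<le> i" "N \<le> j" for i j
    proof -
      have "K * (2 * b i + 2 * b j) \<le> K * (4 * \<eta>)"
        using N[OF that(1)] N[OF that(2)] K by (intro mult_left_mono) auto
      also have "\<dots> < e\<^sup>2" unfolding \<eta>(2)[symmetric] using \<eta>(1) by (simp add: algebra_simps)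
      finally have "sqrt (K * (2 * b i + 2 * b j)) < e" using e by (intro real_less_lsqrt) auto
      then show ?thesis using G_L1(2)[of i j] by simp
    qed
    then show "\<exists>N. \<forall>i\<ge>N. \<forall>j\<ge>N. (\<integral>\<omega>. norm (?G i \<omega> - ?G 0 \<omega> - (?G j \<omega> - ?G 0 \<omega>)) \<partial>white_noise) < e" by blast
  qed
  define G where "G \<omega> = lim (\<lambda>k. ?G (r k) \<omega>)" for \<omega>
  have Gm[measurable]: "G \<in> borel_measurable white_noise"
    unfolding G_def by (rule borel_measurable_lim_metric) measurable
  have G_lim: "AE \<omega> in white_noise. (\<lambda>k. ?G (r k) \<omega>) \<longlonglongrightarrow> G \<omega>"
    using r(2)
  proof eventually_elim
    case (elim \<omega>)
    then have "convergent (\<lambda>k. (?G (r k) \<omega> - ?G 0 \<omega>) + ?G 0 \<omega>)"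
      by (intro convergent_add Cauchy_convergent convergent_const)
    then show ?case unfolding G_def by (simp add: convergent_LIMSEQ_iff)
  qed
  have GkG: "(\<integral>\<^sup>+\<omega>. ennreal ((norm (?G k \<omega> - G \<omega>))\<^sup>2) \<partial>white_noise) \<le> ennreal (K * (4 * \<eta>))"
    if N: "\<And>k. N \<le> k \<Longrightarrow> b k < \<eta>" and k: "N \<le> k" and \<eta>: "0 < \<eta>" for k N \<eta>
  proof (rule nn_integral_le_of_tendsto)
    show "AE \<omega> in white_noise. (\<lambda>l. ennreal ((norm (?G k \<omega> - ?G (r l) \<omega>))\<^sup>2)) \<longlonglongrightarrow> ennreal ((norm (?G k \<omega> - G \<omega>))\<^sup>2)"
      using G_lim by eventually_elim (intro tendsto_intros tendsto_ennrealI)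
    show "\<forall>\<^sub>F l in sequentially. (\<integral>\<^sup>+\<omega>. ennreal ((norm (?G k \<omega> - ?G (r l) \<omega>))\<^sup>2) \<partial>white_noise) \<le> ennreal (K * (4 * \<eta>))"
    proof (rule eventually_sequentiallyI[of N])
      fix l assume "N \<le> l"
      then have "N \<le> r l" using seq_suble[OF r(1), of l] by simp
      then have "K * (2 * b k + 2 * b (r l)) \<le> K * (4 * \<eta>)"
        using N[of "r l"] N[OF k] K by (intro mult_left_mono) auto
      then show "(\<integral>\<^sup>+\<omega>. ennreal ((norm (?G k \<omega> - ?G (r l) \<omega>))\<^sup>2) \<partial>white_noise) \<le> ennreal (K * (4 * \<eta>))"
        using GG[of k "r l"] by (meson ennreal_leI order_trans)
    qed
  qed measurable
  have int_id: "integrable \<mu> (\<lambda>x. x)"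
  proof -
    have "integrable \<mu> (\<lambda>x. norm x)" by (rule \<mu>.square_integrable_imp_integrable[OF _ sq]) simp
    then show ?thesis by (subst (asm) integrable_norm_iff) auto
  qed
  have u_mean: "(\<integral>x. u i x \<partial>\<mu>) = 0" and u_sq: "integrable \<mu> (\<lambda>x. (u i x)\<^sup>2)" for i
    using u by (simp_all add: orthogonal_family_def)
  have u_int: "integrable \<mu> (u i)" for i by (rule \<mu>.square_integrable_imp_integrable[OF _ u_sq]) simp
  have F_int: "integrable \<mu> (F k)" "(\<integral>x. F k x \<partial>\<mu>) = 0" for k
    unfolding F_eq by (simp_all add: u_int u_mean)
  have S_diff: "(\<integral>\<^sup>+\<omega>. ennreal ((norm (normalized_sum (\<lambda>x. x) n \<omega> - normalized_sum (F k) n \<omega>))\<^sup>2) \<partial>M) \<le> ennreal (K * b k)" for n k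
  proof -
    have "normalized_sum (\<lambda>x. x) n \<omega> - normalized_sum (F k) n \<omega> = normalized_sum (\<lambda>x. x - F k x) n \<omega>" for \<omega>
      by (simp add: normalized_sum_def sum_subtractf scaleR_diff_right)
    moreover have "(\<integral>x. x - F k x \<partial>\<mu>) = 0"
      using Bochner_Integration.integral_diff[OF int_id F_int(1)[of k]] F_int(2)[of k] mean by simp
    then have "(\<integral>\<^sup>+\<omega>. ennreal ((norm (normalized_sum (\<lambda>x. x - F k x) n \<omega>))\<^sup>2) \<partial>M)
        \<le> ennreal K * (\<integral>\<^sup>+x. ennreal ((norm (x - F k x))\<^sup>2) \<partial>\<mu>)"
      by (intro normalized_sum_bound Bochner_Integration.integrable_diff int_id F_int(1)) measurable
    ultimately have "(\<integral>\<^sup>+\<omega>. ennreal ((norm (normalized_sum (\<lambda>x. x) n \<omega> - normalized_sum (F k) n \<omega>))\<^sup>2) \<partial>M)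
        \<le> ennreal K * (\<integral>\<^sup>+x. ennreal ((norm (x - F k x))\<^sup>2) \<partial>\<mu>)" by (simp only:)
    also have "\<dots> \<le> ennreal K * ennreal (b k)"
      using b(3)[of k] by (intro mult_left_mono) (simp_all add: norm_minus_commute)
    finally show ?thesis using K b(2) by (simp add: ennreal_mult)
  qed
  have lip: "(\<lambda>n. \<integral>\<omega>. g (normalized_sum (\<lambda>x. x) n \<omega>) \<partial>M) \<longlonglongrightarrow> (\<integral>\<omega>. g (G \<omega>) \<partial>white_noise)"
    if g: "\<And>x y. \<bar>g x - g y\<bar> \<le> L * norm (x - y)" "\<And>x. \<bar>g x\<bar> \<le> B" for g :: "'v \<Rightarrow> real" and L B
  proof (rule LIMSEQ_I)
    have g_cont: "continuous_on UNIV g"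
    proof (rule lipschitz_on_continuous_on)
      have "\<bar>g x - g y\<bar> \<le> \<bar>L\<bar> * norm (x - y)" for x y
        by (rule order_trans[OF g(1)]) (simp add: mult_right_mono)
      then show "lipschitz_on \<bar>L\<bar> UNIV g" by (intro lipschitz_onI) (auto simp: dist_norm)
    qed
    have gm[measurable]: "g \<in> borel_measurable borel" by (rule borel_measurable_continuous_onI[OF g_cont])
    fix e :: real assume e: "0 < e"
    define d where "d = e / (3 * (\<bar>L\<bar> + 1))"
    have d: "0 < d" "\<bar>L\<bar> * d < e / 3"
      unfolding d_def using e by (auto simp: field_simps add_pos_nonneg intro!: divide_pos_pos)
    define \<eta> where "\<eta> = d\<^sup>2 / (4 * (K + 1))"
    have \<eta>: "0 < \<eta>" "4 * (K + 1) * \<eta> = d\<^sup>2" unfolding \<eta>_def using d K by auto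
    then have K\<eta>: "K * (4 * \<eta>) \<le> d\<^sup>2" by (simp add: algebra_simps)
    obtain k where N: "\<And>l. k \<le> l \<Longrightarrow> b l < \<eta>" using small[OF \<eta>(1)] by blast
    have "K * b k \<le> K * (4 * \<eta>)" using N[of k] \<eta> K by (intro mult_left_mono) auto
    then have Kb: "K * b k \<le> d\<^sup>2" using K\<eta> by simp
    have 1: "\<bar>(\<integral>\<omega>. g (normalized_sum (\<lambda>x. x) n \<omega>) \<partial>M) - (\<integral>\<omega>. g (normalized_sum (F k) n \<omega>) \<partial>M)\<bar> < e / 3" for n
    proof -
      have "\<bar>(\<integral>\<omega>. g (normalized_sum (\<lambda>x. x) n \<omega>) \<partial>M) - (\<integral>\<omega>. g (normalized_sum (F k) n \<omega>) \<partial>M)\<bar> \<le> \<bar>L\<bar> * sqrt (d\<^sup>2)"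
        by (rule expectation_lipschitz_diff[OF prob_space_axioms _ _ g gm order_trans[OF S_diff]])
          (use Kb in \<open>auto intro: ennreal_leI\<close>)
      then show ?thesis using d by simp
    qed
    have 2: "\<bar>(\<integral>\<omega>. g (?G k \<omega>) \<partial>white_noise) - (\<integral>\<omega>. g (G \<omega>) \<partial>white_noise)\<bar> < e / 3"
    proof -
      have "\<bar>(\<integral>\<omega>. g (?G k \<omega>) \<partial>white_noise) - (\<integral>\<omega>. g (G \<omega>) \<partial>white_noise)\<bar> \<le> \<bar>L\<bar> * sqrt (d\<^sup>2)"
        by (rule expectation_lipschitz_diff[OF noise.prob_space_axioms _ _ g gm order_trans[OF GkG[OF N _ \<eta>(1), of k]]])
          (use K\<eta> in \<open>auto intro: ennreal_leI\<close>)
      then show ?thesis using d by simp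
    qed
    have "(\<lambda>n. \<integral>\<omega>. g (normalized_sum (F k) n \<omega>) \<partial>M) \<longlonglongrightarrow> (\<integral>\<omega>. g (?G k \<omega>) \<partial>white_noise)"
      unfolding F_eq by (rule finite_rank_clt[OF u g_cont g(2)])
    from LIMSEQ_D[OF this, of "e / 3"] obtain N where 3: "\<And>n. N \<le> n \<Longrightarrow> \<bar>(\<integral>\<omega>. g (normalized_sum (F k) n \<omega>) \<partial>M) - (\<integral>\<omega>. g (?G k \<omega>) \<partial>white_noise)\<bar> < e / 3"
      using e unfolding real_norm_def by auto
    have "norm ((\<integral>\<omega>. g (normalized_sum (\<lambda>x. x) n \<omega>) \<partial>M) - (\<integral>\<omega>. g (G \<omega>) \<partial>white_noise)) < e" if "N \<le> n" for n
      using 1[of n] 2 3[OF that] unfolding real_norm_def by linarith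
    then show "\<exists>N. \<forall>n\<ge>N. norm ((\<integral>\<omega>. g (normalized_sum (\<lambda>x. x) n \<omega>) \<partial>M) - (\<integral>\<omega>. g (G \<omega>) \<partial>white_noise)) < e" by blast
  qed
  have "(\<lambda>n. \<integral>\<omega>. f (normalized_sum (\<lambda>x. x) n \<omega>) \<partial>M) \<longlonglongrightarrow> (\<integral>\<omega>. f (G \<omega>) \<partial>white_noise)"
    if "continuous_on UNIV f" "\<forall>x. \<bar>f x\<bar> \<le> B" for f :: "'v \<Rightarrow> real" and B
    by (rule weak_convergence_if_lipschitz[OF prob_space_axioms noise.prob_space_axioms _ Gm lip])
      (use that in auto)
  then show ?thesis using Gm by blast
qed

end

section \<open>Identification of the limit\<close>

text \<open>By uniqueness of characteristic functions the law is that of \<open>s\<close> times a standard normal variable,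
  which is the point mass at 0 if \<open>s = 0\<close>.\<close>

lemma
  assumes N: "prob_space N" and X[measurable]: "X \<in> borel_measurable N" and s: "0 \<le> s"
    and char: "\<And>t. char (distr N borel X) t = complex_of_real (exp (- (t\<^sup>2 * s\<^sup>2) / 2))"
  shows normal_law_if_char: "distr N borel X = return borel 0 \<or> (\<exists>\<sigma>>0. distributed N lborel X (normal_density 0 \<sigma>))"
    and normal_second_moment_if_char: "integrable N (\<lambda>\<omega>. (X \<omega>)\<^sup>2)" "(\<integral>\<omega>. (X \<omega>)\<^sup>2 \<partial>N) = s\<^sup>2"
proof -
  interpret N: prob_space N by fact
  interpret S: prob_space std_normal_distribution by (rule prob_space_std_normal)
  let ?S = "std_normal_distribution"
  have eq: "distr N borel X = distr ?S borel (\<lambda>x. s * x)"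
  proof (rule Levy_uniqueness)
    show "real_distribution (distr N borel X)" by (rule N.real_distribution_distr) simp
    show "real_distribution (distr ?S borel (\<lambda>x. s * x))" by (rule S.real_distribution_distr) simp
    have "char (distr ?S borel (\<lambda>x. s * x)) t = complex_of_real (exp (- (t\<^sup>2 * s\<^sup>2) / 2))" for t
    proof -
      have "char (distr ?S borel (\<lambda>x. s * x)) t = char ?S (t * s)"
        unfolding char_def by (subst integral_distr) (auto simp: mult.assoc)
      then show ?thesis by (simp add: char_std_normal_distribution power_mult_distrib)
    qed
    then show "char (distr N borel X) = char (distr ?S borel (\<lambda>x. s * x))" using char by (intro ext) simp
  qed
  show "distr N borel X = return borel 0 \<or> (\<exists>\<sigma>>0. distributed N lborel X (normal_density 0 \<sigma>))"
  proof (cases "s = 0")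
    case True
    then show ?thesis using eq by (simp add: S.distr_const)
  next
    case False
    then have pos: "0 < s" using s by simp
    have "distr ?S lborel (\<lambda>x. x) = distr ?S ?S (\<lambda>x. x)" by (rule distr_cong) auto
    then have "distributed ?S lborel (\<lambda>x. x) std_normal_density"
      by (auto simp: distributed_def)
    then have "distributed ?S lborel (\<lambda>x. 0 + s * x) (normal_density (0 + s * 0) (\<bar>s\<bar> * 1))"
      using pos by (intro S.normal_density_affine) auto
    then have "distr ?S lborel (\<lambda>x. s * x) = density lborel (normal_density 0 s)"
      using pos by (simp add: distributed_def)
    moreover have "distr N lborel X = distr N borel X" "distr ?S lborel (\<lambda>x. s * x) = distr ?S borel (\<lambda>x. s * x)"
      by (auto intro!: distr_cong)
    ultimately have "distributed N lborel X (normal_density 0 s)"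
      using eq by (simp add: distributed_def)
    then show ?thesis using pos by blast
  qed
  have "(\<integral>x. x\<^sup>2 \<partial>?S) = 1" using std_normal_distribution_even_moments(1)[of 1] by simp
  moreover have "integrable ?S (\<lambda>x. x\<^sup>2)" by (rule integrable_std_normal_distribution_moment)
  ultimately have "integrable (distr N borel X) (\<lambda>x. x\<^sup>2)" "(\<integral>x. x\<^sup>2 \<partial>distr N borel X) = s\<^sup>2"
    unfolding eq by (simp_all add: integrable_distr_eq integral_distr power_mult_distrib)
  then show "integrable N (\<lambda>\<omega>. (X \<omega>)\<^sup>2)" "(\<integral>\<omega>. (X \<omega>)\<^sup>2 \<partial>N) = s\<^sup>2"
    by (simp_all add: integrable_distr_eq integral_distr)
qed

lemma square_integrable_functional:
  fixes \<phi> :: "'v::{banach, second_countable_topology} \<Rightarrow> real"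
  assumes \<phi>: "bounded_linear \<phi>" and [measurable_cong]: "sets L = sets borel" and sq: "integrable L (\<lambda>x. (norm x)\<^sup>2)"
  shows "integrable L (\<lambda>x. (\<phi> x)\<^sup>2)"
proof -
  have [measurable]: "\<phi> \<in> borel_measurable borel"
    by (intro borel_measurable_continuous_onI linear_continuous_on \<phi>)
  obtain c where c: "\<And>x. norm (\<phi> x) \<le> norm x * c" using bounded_linear.bounded[OF \<phi>] by blast
  show ?thesis
  proof (rule Bochner_Integration.integrable_bound[of _ "\<lambda>x. c\<^sup>2 * (norm x)\<^sup>2"])
    show "AE x in L. norm ((\<phi> x)\<^sup>2) \<le> norm (c\<^sup>2 * (norm x)\<^sup>2)"
    proof (rule AE_I2)
      fix x
      have "(norm (\<phi> x))\<^sup>2 \<le> (norm x * c)\<^sup>2" by (rule power_mono[OF c]) simp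
      then show "norm ((\<phi> x)\<^sup>2) \<le> norm (c\<^sup>2 * (norm x)\<^sup>2)" by (simp add: power_mult_distrib mult.commute)
    qed
    show "integrable L (\<lambda>x. c\<^sup>2 * (norm x)\<^sup>2)" using sq by simp
  qed measurable
qed

context iid_second_moment_bound
begin

text \<open>The functional \<open>\<phi>\<close> turns the sums in the Banach space into sums of real variables.  The limits of their
  characteristic functions are computed once from weak convergence and once from the real central limit
  theorem.\<close>

lemma weak_limit_char:
  fixes \<phi> :: "'v \<Rightarrow> real"
  assumes sq: "integrable \<mu> (\<lambda>x. (norm x)\<^sup>2)" and mean: "(\<integral>x. x \<partial>\<mu>) = 0"
    and G[measurable]: "G \<in> borel_measurable N" and N: "prob_space N"
    and conv: "\<And>(f :: 'v \<Rightarrow> real) B. continuous_on UNIV f \<Longrightarrow> (\<And>x. \<bar>f x\<bar> \<le> B) \<Longrightarrow>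
      (\<lambda>n. \<integral>\<omega>. f (normalized_sum (\<lambda>x. x) n \<omega>) \<partial>M) \<longlonglongrightarrow> (\<integral>\<omega>. f (G \<omega>) \<partial>N)"
    and \<phi>: "bounded_linear \<phi>"
  shows "char (distr N borel (\<lambda>\<omega>. \<phi> (G \<omega>))) t = complex_of_real (exp (- (t\<^sup>2 * (sd \<phi>)\<^sup>2) / 2))"
proof -
  interpret N: prob_space N by fact
  have \<phi>_cont: "continuous_on UNIV \<phi>" by (intro linear_continuous_on \<phi>)
  then have [measurable]: "\<phi> \<in> borel_measurable borel" by (rule borel_measurable_continuous_onI)
  have \<phi>_sq: "integrable \<mu> (\<lambda>x. (\<phi> x)\<^sup>2)" by (rule square_integrable_functional[OF \<phi> sets_\<mu> sq])
  have "integrable \<mu> (\<lambda>x. norm x)" by (rule \<mu>.square_integrable_imp_integrable[OF _ sq]) simp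
  then have "integrable \<mu> (\<lambda>x. x)" by (subst (asm) integrable_norm_iff) auto
  then have \<phi>_mean: "(\<integral>x. \<phi> x \<partial>\<mu>) = 0"
    using integral_bounded_linear[OF \<phi>, of \<mu> "\<lambda>x. x"] mean linear_0[OF bounded_linear.linear[OF \<phi>]] by simp
  have lin: "normalized_sum (\<lambda>v. t * \<phi> v) n \<omega> = t * \<phi> (normalized_sum (\<lambda>x. x) n \<omega>)" for n \<omega>
    by (simp add: normalized_sum_def sum_distrib_left[symmetric] mult.left_commute
        linear_sum[OF bounded_linear.linear[OF \<phi>]] linear_scale[OF bounded_linear.linear[OF \<phi>]])
  have lim: "(\<lambda>n. \<integral>\<omega>. iexp (t * \<phi> (normalized_sum (\<lambda>x. x) n \<omega>)) \<partial>M) \<longlonglongrightarrow> complex_of_real (exp (- (t\<^sup>2 * (sd \<phi>)\<^sup>2) / 2))"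
    using real_clt_char[of "\<lambda>v. t * \<phi> v"] \<phi>_sq \<phi>_mean unfolding lin by (simp add: power_mult_distrib sd_squared)
  have iM: "integrable M (\<lambda>\<omega>. iexp (t * \<phi> (normalized_sum (\<lambda>x. x) n \<omega>)))" for n
    by (rule integrable_iexp) auto
  have iN: "integrable N (\<lambda>\<omega>. iexp (t * \<phi> (G \<omega>)))" by (rule N.integrable_iexp) auto
  have re: "Re (iexp x) = cos x" and im: "Im (iexp x) = sin x" for x by (simp_all add: Re_exp Im_exp)
  have "(\<lambda>n. \<integral>\<omega>. cos (t * \<phi> (normalized_sum (\<lambda>x. x) n \<omega>)) \<partial>M) \<longlonglongrightarrow> (\<integral>\<omega>. cos (t * \<phi> (G \<omega>)) \<partial>N)"
    by (rule conv[of "\<lambda>v. cos (t * \<phi> v)" 1]) (auto intro!: continuous_intros \<phi>_cont)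
  moreover have "(\<lambda>n. \<integral>\<omega>. cos (t * \<phi> (normalized_sum (\<lambda>x. x) n \<omega>)) \<partial>M) \<longlonglongrightarrow> exp (- (t\<^sup>2 * (sd \<phi>)\<^sup>2) / 2)"
    using tendsto_Re[OF lim] iM unfolding re[symmetric] by (simp only: integral_Re Re_complex_of_real)
  ultimately have 1: "(\<integral>\<omega>. cos (t * \<phi> (G \<omega>)) \<partial>N) = exp (- (t\<^sup>2 * (sd \<phi>)\<^sup>2) / 2)" by (rule LIMSEQ_unique)
  have "(\<lambda>n. \<integral>\<omega>. sin (t * \<phi> (normalized_sum (\<lambda>x. x) n \<omega>)) \<partial>M) \<longlonglongrightarrow> (\<integral>\<omega>. sin (t * \<phi> (G \<omega>)) \<partial>N)"
    by (rule conv[of "\<lambda>v. sin (t * \<phi> v)" 1]) (auto intro!: continuous_intros \<phi>_cont)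
  moreover have "(\<lambda>n. \<integral>\<omega>. sin (t * \<phi> (normalized_sum (\<lambda>x. x) n \<omega>)) \<partial>M) \<longlonglongrightarrow> 0"
    using tendsto_Im[OF lim] iM unfolding im[symmetric] by (simp only: integral_Im Im_complex_of_real)
  ultimately have 2: "(\<integral>\<omega>. sin (t * \<phi> (G \<omega>)) \<partial>N) = 0" by (rule LIMSEQ_unique)
  have "char (distr N borel (\<lambda>\<omega>. \<phi> (G \<omega>))) t = (\<integral>\<omega>. iexp (t * \<phi> (G \<omega>)) \<partial>N)"
    unfolding char_def by (subst integral_distr) auto
  also have "\<dots> = complex_of_real (exp (- (t\<^sup>2 * (sd \<phi>)\<^sup>2) / 2))"
  proof (rule complex_eqI)
    show "Re (\<integral>\<omega>. iexp (t * \<phi> (G \<omega>)) \<partial>N) = Re (complex_of_real (exp (- (t\<^sup>2 * (sd \<phi>)\<^sup>2) / 2)))"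
      unfolding integral_Re[OF iN, symmetric] re using 1 by (simp only: Re_complex_of_real)
    show "Im (\<integral>\<omega>. iexp (t * \<phi> (G \<omega>)) \<partial>N) = Im (complex_of_real (exp (- (t\<^sup>2 * (sd \<phi>)\<^sup>2) / 2)))"
      unfolding integral_Im[OF iN, symmetric] im using 2 by (simp only: Im_complex_of_real)
  qed
  finally show ?thesis .
qed

text \<open>The characteristic functions just found determine the law and the variance of every functional of \<open>G\<close>;
  covariances follow from variances by polarization.\<close>

lemma weak_limit_gaussian:
  assumes sq: "integrable \<mu> (\<lambda>x. (norm x)\<^sup>2)" and mean: "(\<integral>x. x \<partial>\<mu>) = 0"
    and G[measurable]: "G \<in> borel_measurable N" and N: "prob_space N"
    and conv: "\<And>(f :: 'v \<Rightarrow> real) B. continuous_on UNIV f \<Longrightarrow> (\<And>x. \<bar>f x\<bar> \<le> B) \<Longrightarrow>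
      (\<lambda>n. \<integral>\<omega>. f (normalized_sum (\<lambda>x. x) n \<omega>) \<partial>M) \<longlonglongrightarrow> (\<integral>\<omega>. f (G \<omega>) \<partial>N)"
  shows "centered_gaussian N G" and "same_covariance N G M (Y i)"
proof -
  have meas: "\<phi> \<in> borel_measurable borel" if "bounded_linear \<phi>" for \<phi> :: "'v \<Rightarrow> real"
    by (intro borel_measurable_continuous_onI linear_continuous_on that)
  have measG: "(\<lambda>\<omega>. \<phi> (G \<omega>)) \<in> borel_measurable N" if "bounded_linear \<phi>" for \<phi> :: "'v \<Rightarrow> real"
    using measurable_compose[OF G meas[OF that]] .
  have char: "char (distr N borel (\<lambda>\<omega>. \<phi> (G \<omega>))) t = complex_of_real (exp (- (t\<^sup>2 * (sd \<phi>)\<^sup>2) / 2))"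
    if "bounded_linear \<phi>" for \<phi> :: "'v \<Rightarrow> real" and t
    by (rule weak_limit_char[OF sq mean G N conv that])
  have sd_nonneg: "0 \<le> sd \<phi>" for \<phi> by (simp add: sd_def)
  show "centered_gaussian N G"
    unfolding centered_gaussian_def
    by (intro conjI allI impI N G normal_law_if_char[OF N measG sd_nonneg char])
  have mom: "integrable N (\<lambda>\<omega>. (\<phi> (G \<omega>))\<^sup>2)" "(\<integral>\<omega>. (\<phi> (G \<omega>))\<^sup>2 \<partial>N) = (\<integral>x. (\<phi> x)\<^sup>2 \<partial>\<mu>)"
    if \<phi>: "bounded_linear \<phi>" for \<phi> :: "'v \<Rightarrow> real"
    using normal_second_moment_if_char[OF N measG[OF \<phi>] sd_nonneg char[OF \<phi>]] by (simp_all add: sd_squared)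
  show "same_covariance N G M (Y i)"
    unfolding same_covariance_def
  proof (intro allI impI)
    fix \<phi> \<psi> :: "'v \<Rightarrow> real"
    assume \<phi>: "bounded_linear \<phi>" and \<psi>: "bounded_linear \<psi>"
    note p = bounded_linear_add[OF \<phi> \<psi>] and m = bounded_linear_sub[OF \<phi> \<psi>]
    have pol: "a * b = ((a + b)\<^sup>2 - (a - b)\<^sup>2) / 4" for a b :: real
      by (simp add: power2_eq_square algebra_simps)
    note \<mu>_sq = square_integrable_functional[OF _ sets_\<mu> sq]
    have "(\<integral>\<omega>. \<phi> (G \<omega>) * \<psi> (G \<omega>) \<partial>N) = ((\<integral>\<omega>. (\<phi> (G \<omega>) + \<psi> (G \<omega>))\<^sup>2 \<partial>N) - (\<integral>\<omega>. (\<phi> (G \<omega>) - \<psi> (G \<omega>))\<^sup>2 \<partial>N)) / 4"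
      unfolding pol using mom(1)[OF p] mom(1)[OF m] by simp
    also have "\<dots> = ((\<integral>x. (\<phi> x + \<psi> x)\<^sup>2 \<partial>\<mu>) - (\<integral>x. (\<phi> x - \<psi> x)\<^sup>2 \<partial>\<mu>)) / 4"
      by (simp only: mom(2)[OF p] mom(2)[OF m])
    also have "\<dots> = (\<integral>x. \<phi> x * \<psi> x \<partial>\<mu>)"
      unfolding pol using \<mu>_sq[OF p] \<mu>_sq[OF m] by simp
    also have "\<dots> = (\<integral>\<omega>. \<phi> (Y i \<omega>) * \<psi> (Y i \<omega>) \<partial>M)"
      by (rule integral_Y[symmetric]) (intro borel_measurable_times meas \<phi> \<psi>)
    finally show "(\<integral>\<omega>. \<phi> (G \<omega>) * \<psi> (G \<omega>) \<partial>N) = (\<integral>\<omega>. \<phi> (Y i \<omega>) * \<psi> (Y i \<omega>) \<partial>M)" .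
  qed
qed

end

text \<open>Functionals commute with the Bochner integral, so all of them vanish at the mean.\<close>

lemma pettis_expectation_0_imp_integral_0:
  fixes \<xi> :: "'w \<Rightarrow> 'v::{banach, second_countable_topology}"
  assumes "pettis_expectation M \<xi> 0" and int: "integrable M \<xi>"
  shows "(\<integral>\<omega>. \<xi> \<omega> \<partial>M) = 0"
proof (rule eq_0_if_all_functionals_0)
  fix \<phi> :: "'v \<Rightarrow> real" assume \<phi>: "bounded_linear \<phi>"
  then have "(\<integral>\<omega>. \<phi> (\<xi> \<omega>) \<partial>M) = \<phi> 0" using assms(1) unfolding pettis_expectation_def by blast
  then show "\<phi> (\<integral>\<omega>. \<xi> \<omega> \<partial>M) = 0"
    using integral_bounded_linear[OF \<phi> int] linear_0[OF bounded_linear.linear[OF \<phi>]] by simp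
qed

theorem theorem4p2:
  fixes T :: "barcode completion \<Rightarrow> 'v::{banach, second_countable_topology}"
    and M :: "'w measure"
    and X :: "nat \<Rightarrow> 'w \<Rightarrow> barcode completion"
  assumes "type_2 TYPE('v)"
    and "continuous_on UNIV T"
    and "prob_space M"
    and "prob_space.indep_vars M (\<lambda>_. borel) X {1..}"
    and "\<forall>i\<ge>1. distr M borel (X i) = distr M borel (X 1)"
    and "pettis_expectation M (\<lambda>\<omega>. T (X 1 \<omega>)) 0"
    and "integrable M (\<lambda>\<omega>. (norm (T (X 1 \<omega>)))\<^sup>2)"
  shows "\<exists>(N :: 'v measure) (G :: 'v \<Rightarrow> 'v).
    centered_gaussian N G \<and>
    same_covariance N G M (\<lambda>\<omega>. T (X 1 \<omega>)) \<and>
    converges_weakly M (\<lambda>n \<omega>. sqrt (real n) *\<^sub>R ((\<Sum>i=1..n. T (X i \<omega>)) /\<^sub>R real n)) N G"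
proof -
  interpret M: prob_space M by fact
  have T: "T \<in> borel_measurable borel" by (rule borel_measurable_continuous_onI) fact
  have X: "X i \<in> borel_measurable M" if "1 \<le> i" for i
    using assms(4) that by (auto simp: M.indep_vars_def)
  define Y where "Y n \<omega> = T (X (Suc n) \<omega>)" for n \<omega>
  have Y[measurable]: "Y n \<in> borel_measurable M" for n
    unfolding Y_def by (rule measurable_compose[OF X T]) simp
  define \<mu> where "\<mu> = distr M borel (Y 0)"
  have law: "distr M borel (Y n) = \<mu>" for n
  proof -
    have "distr M borel (Y n) = distr (distr M borel (X (Suc n))) borel T" for n
      unfolding Y_def using X[of "Suc n"] T by (subst distr_distr) (auto simp: comp_def)
    moreover have "distr M borel (X (Suc n)) = distr M borel (X (Suc 0))" for n
      using assms(5)[rule_format, of "Suc n"] by simp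
    ultimately show ?thesis unfolding \<mu>_def by metis
  qed
  have ind: "M.indep_vars (\<lambda>_. borel) Y UNIV"
  proof -
    (* Restriction to the singletons {Suc j} reindexes the family from 0. *)
    have "M.indep_vars (\<lambda>j. PiM {Suc j} (\<lambda>_. borel)) (\<lambda>j \<omega>. restrict (\<lambda>i. X i \<omega>) {Suc j}) UNIV"
      by (rule M.indep_vars_restrict[OF assms(4)]) (auto simp: disjoint_family_on_def)
    then have "M.indep_vars (\<lambda>_. borel) (\<lambda>j \<omega>. (\<lambda>x. T (x (Suc j))) (restrict (\<lambda>i. X i \<omega>) {Suc j})) UNIV"
      by (rule M.indep_vars_compose2) (rule measurable_compose[OF _ T], rule measurable_component_singleton, simp)
    then show ?thesis by (simp add: Y_def[abs_def])
  qed
  have Y_sq: "integrable M (\<lambda>\<omega>. (norm (Y 0 \<omega>))\<^sup>2)" using assms(7) by (simp add: Y_def)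
  then have "integrable M (\<lambda>\<omega>. norm (Y 0 \<omega>))"
    by (rule M.square_integrable_imp_integrable[rotated]) simp
  then have Y_int: "integrable M (Y 0)" by (subst (asm) integrable_norm_iff) auto
  have "(\<integral>\<omega>. Y 0 \<omega> \<partial>M) = 0"
    by (rule pettis_expectation_0_imp_integral_0[OF _ Y_int]) (use assms(6) in \<open>simp add: Y_def[abs_def]\<close>)
  then have mean: "(\<integral>x. x \<partial>\<mu>) = 0" by (simp add: \<mu>_def integral_distr)
  have sq: "integrable \<mu> (\<lambda>x. (norm x)\<^sup>2)" using Y_sq by (simp add: \<mu>_def integrable_distr_eq)
  obtain K where K: "0 \<le> K"
    "\<And>(Z :: nat \<Rightarrow> 'w \<Rightarrow> 'v) \<mu> n. M.indep_vars (\<lambda>_. borel) Z UNIV \<Longrightarrow> (\<And>i. distr M borel (Z i) = \<mu>) \<Longrightarrow>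
      integrable \<mu> (\<lambda>x. x) \<Longrightarrow> (\<integral>x. x \<partial>\<mu>) = 0 \<Longrightarrow>
      (\<integral>\<^sup>+\<omega>. ennreal ((norm (\<Sum>i<n. Z i \<omega>))\<^sup>2) \<partial>M) \<le> ennreal (K * real n) * (\<integral>\<^sup>+x. ennreal ((norm x)\<^sup>2) \<partial>\<mu>)"
    using M.type_2_iid_sum_bound[OF assms(1)] by blast
  interpret iid_second_moment_bound M Y \<mu> K
  proof
    show "0 \<le> K" "M.indep_vars (\<lambda>_. borel) Y UNIV" "distr M borel (Y i) = \<mu>" for i by fact+
    fix F :: "'v \<Rightarrow> 'v" and n
    assume F[measurable]: "F \<in> borel_measurable borel" and int: "integrable \<mu> F" "(\<integral>x. F x \<partial>\<mu>) = 0"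
    have [measurable_cong]: "sets \<mu> = sets borel" by (simp add: \<mu>_def)
    have "(\<integral>\<^sup>+\<omega>. ennreal ((norm (\<Sum>i<n. F (Y i \<omega>)))\<^sup>2) \<partial>M)
        \<le> ennreal (K * real n) * (\<integral>\<^sup>+x. ennreal ((norm x)\<^sup>2) \<partial>distr \<mu> borel F)"
    proof (rule K(2))
      show "M.indep_vars (\<lambda>_. borel) (\<lambda>i \<omega>. F (Y i \<omega>)) UNIV" by (rule M.indep_vars_compose2[OF ind]) simp
      show "distr M borel (\<lambda>\<omega>. F (Y i \<omega>)) = distr \<mu> borel F" for i
        unfolding law[of i, symmetric] by (subst distr_distr) (auto simp: comp_def)
    qed (use int in \<open>simp_all add: integrable_distr_eq integral_distr\<close>)
    also have "(\<integral>\<^sup>+x. ennreal ((norm x)\<^sup>2) \<partial>distr \<mu> borel F) = (\<integral>\<^sup>+x. ennreal ((norm (F x))\<^sup>2) \<partial>\<mu>)"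
      by (rule nn_integral_distr) measurable
    finally show "(\<integral>\<^sup>+\<omega>. ennreal ((norm (\<Sum>i<n. F (Y i \<omega>)))\<^sup>2) \<partial>M)
        \<le> ennreal (K * real n) * (\<integral>\<^sup>+x. ennreal ((norm (F x))\<^sup>2) \<partial>\<mu>)" .
  qed
  obtain H where H[measurable]: "H \<in> borel_measurable white_noise"
    and H_conv: "\<And>(f :: 'v \<Rightarrow> real) B. continuous_on UNIV f \<Longrightarrow> (\<And>x. \<bar>f x\<bar> \<le> B) \<Longrightarrow>
      (\<lambda>n. \<integral>\<omega>. f (normalized_sum (\<lambda>x. x) n \<omega>) \<partial>M) \<longlonglongrightarrow> (\<integral>\<omega>. f (H \<omega>) \<partial>white_noise)"
    using normalized_sum_converges_weakly[OF sq mean] by blast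
  (* The limit is transported to the Banach space, where it is the identity under its own law. *)
  define N where "N = distr white_noise borel H"
  have N: "prob_space N" unfolding N_def by (rule noise.prob_space_distr) simp
  have G: "(\<lambda>x. x) \<in> borel_measurable N" by (simp add: N_def)
  have conv: "(\<lambda>n. \<integral>\<omega>. f (normalized_sum (\<lambda>x. x) n \<omega>) \<partial>M) \<longlonglongrightarrow> (\<integral>x. f x \<partial>N)"
    if f: "continuous_on UNIV f" "\<And>x. \<bar>f x\<bar> \<le> B" for f :: "'v \<Rightarrow> real" and B
  proof -
    have "(\<integral>x. f x \<partial>N) = (\<integral>\<omega>. f (H \<omega>) \<partial>white_noise)"
      unfolding N_def by (rule integral_distr[OF H borel_measurable_continuous_onI[OF f(1)]])
    then show ?thesis using H_conv[OF f] by simp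
  qed
  have sums: "sqrt (real n) *\<^sub>R ((\<Sum>i=1..n. T (X i \<omega>)) /\<^sub>R real n) = normalized_sum (\<lambda>x. x) n \<omega>" for n \<omega>
  proof -
    have "(\<Sum>i=1..n. T (X i \<omega>)) = (\<Sum>i<n. Y i \<omega>)"
      unfolding Y_def using sum.atLeast1_atMost_eq[of "\<lambda>i. T (X i \<omega>)" n] by simp
    moreover have "sqrt (real n) * inverse (real n) = inverse (sqrt (real n))"
      by (cases "n = 0") (auto simp: field_simps)
    ultimately show ?thesis by (simp add: normalized_sum_def)
  qed
  have "converges_weakly M (\<lambda>n \<omega>. sqrt (real n) *\<^sub>R ((\<Sum>i=1..n. T (X i \<omega>)) /\<^sub>R real n)) N (\<lambda>x. x)"
    unfolding converges_weakly_def sums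
  proof (intro conjI allI impI G)
    show "(\<lambda>\<omega>. normalized_sum (\<lambda>x. x) n \<omega>) \<in> borel_measurable M" for n by measurable
    fix f :: "'v \<Rightarrow> real" assume f: "continuous_on UNIV f" "bounded (range f)"
    then obtain B where "\<And>x. \<bar>f x\<bar> \<le> B" unfolding bounded_iff by auto
    then show "(\<lambda>n. \<integral>\<omega>. f (normalized_sum (\<lambda>x. x) n \<omega>) \<partial>M) \<longlonglongrightarrow> (\<integral>x. f x \<partial>N)" by (rule conv[OF f(1)])
  qed
  moreover have "centered_gaussian N (\<lambda>x. x)" by (rule weak_limit_gaussian(1)[OF sq mean G N conv])
  moreover have "same_covariance N (\<lambda>x. x) M (Y 0)" by (rule weak_limit_gaussian(2)[OF sq mean G N conv])
  then have "same_covariance N (\<lambda>x. x) M (\<lambda>\<omega>. T (X 1 \<omega>))" by (simp add: Y_def[abs_def])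
  ultimately show ?thesis by blast
qed

end
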